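(* Let $g^+,g^-,f^+,f^-$ be probability mass functions on $\{0,1,2,\dots\}$ such that $g^+,g^-$ have common mean $\nu\in(0,\infty)$ and $f^+,f^-$ have common mean $\mu\in(1,\infty)$. Let $\varepsilon>0$, $0<\kappa\le1$, $K_\kappa<\infty$. Suppose that the bi-degree sequence $(\mathbf{D}_n^-,\mathbf{D}_n^+)$ satisfies $$\sum_{k=0}^\infty\Big|\sum_{i=0}^k(g_n^\pm(i)-g^\pm(i))\Big|\le n^{-\varepsilon},\qquad \sum_{k=0}^\infty\Big|\sum_{i=0}^k(f_n^\pm(i)-f^\pm(i))\Big|\le n^{-\varepsilon},$$ and $\sum_{r=1}^n((D_r^-)^\kappa+(D_r^+)^\kappa)D_r^+D_r^-\le K_\kappa n$. Let $A_m^\pm,\hat A_m^\pm,\hat Z_m^\pm$ be given by the coupling of the graph exploration process and the delayed branching process described in the context. Then, for any $0<\delta<1$ and any $0<\gamma<\min\{\delta\kappa,\varepsilon\}$, there exist finite constants $K,a>0$ (not depending on $n$ or $k$) such that for all $1\le k\le(1-\delta)\log_\mu n$, $$\mathbb{P}_n\left(\bigcap_{m=1}^k\left\{\left|\hat A_m^\pm\cap(A_m^\pm)^c\right|\le\hat Z_m^\pm n^{-\gamma},\ \left|A_m^\pm\cap(\hat A_m^\pm)^c\right|\le\hat Z_m^\pm n^{-\gamma}\right\}\right)\ge1-Kn^{-a}.$$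
   Context: Directed configuration model: nodes $1,\dots,n$ have (possibly random) in- and out-degrees $D_r^-,D_r^+\in\{0,1,2,\dots\}$ with $L_n=\sum_rD_r^-=\sum_rD_r^+$; node $r$ gets $D_r^-$ inbound and $D_r^+$ outbound stubs, and inbound stubs are matched to outbound stubs by a uniformly random bijection, each pair forming a directed edge. $\mathbb{P}_n,\mathbb{E}_n$ denote conditional probability and expectation given the bi-degree sequence. Define $g_n^\pm(t)=\frac1n\sum_r1(D_r^\pm=t)$, $f_n^+(t)=\frac1{L_n}\sum_r1(D_r^+=t)D_r^-$, $f_n^-(t)=\frac1{L_n}\sum_r1(D_r^-=t)D_r^+$, with cumulative distribution functions $G_n^\pm,F_n^\pm$; $G^\pm,F^\pm$ are those of $g^\pm,f^\pm$. The superscript $\pm$ means that the statement holds with $\pm$ replaced consistently by $+$ or by $-$. Exploration process and coupling (the $+$ case; the $-$ case is obtained by exchanging the roles of inbound/outbound and of $D^+/D^-$). Let $U=\bigcup_{k\ge0}\mathbb{N}_+^k$ with $\mathbb{N}_+^0=\{\emptyset\}$, let $\{U_{\mathbf{i}}\}_{\mathbf{i}\in U}$ be i.i.d. Uniform$(0,1)$ independent of the bi-degree sequence, and write $F^{-1}(u)=\inf\{x:F(x)\ge u\}$. All nodes start inactive. Set $A_0^+=\{\emptyset\}$ and $\chi_\emptyset^+=(G_n^+)^{-1}(U_\emptyset)$; a node chosen uniformly among those with out-degree $\chi_\emptyset^+$ becomes active and its outbound stubs are indexed $1,\dots,\chi_\emptyset^+$; $A_1^+=\{1,\dots,\chi_\emptyset^+\}$.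 In step $k\ge2$ the outbound stubs $\mathbf{i}\in A_{k-1}^+$ are traversed one by one in lexicographic order. When $\mathbf{i}$ is about to be traversed, let $T_{\mathbf{i}}^+$ be the number of outbound stubs already traversed (equivalently, of already paired inbound stubs), let $\mathcal{I}_r(T_{\mathbf{i}}^+)$ be the indicator that node $r$ is inactive at that moment, and $V_{\mathbf{i}}^-=L_n-\sum_rD_r^-\mathcal{I}_r(T_{\mathbf{i}}^+)-T_{\mathbf{i}}^+$ (the number of unpaired inbound stubs of active nodes). Let $$h_{\mathbf{i}}^+(t)=\frac{1}{L_n-T_{\mathbf{i}}^+}\Big\{\sum_{r=1}^n1(D_r^+=t)D_r^-\mathcal{I}_r(T_{\mathbf{i}}^+)+1(t=0)V_{\mathbf{i}}^-\Big\},\quad t=0,1,2,\dots,$$ with cumulative distribution function $H_{\mathbf{i}}^+$, and set $\chi_{\mathbf{i}}^+=(H_{\mathbf{i}}^+)^{-1}(U_{\mathbf{i}})$. If $\chi_{\mathbf{i}}^+=t>0$, stub $\mathbf{i}$ is paired with an inbound stub chosen uniformly among the unpaired inbound stubs of inactive nodes with out-degree exactly $t$; if $\chi_{\mathbf{i}}^+=0$, it is paired with one chosen uniformly among the unpaired inbound stubs belonging either to active nodes or to inactive nodes with out-degree $0$. If the node reached was inactive, it becomes active and its $\chi_{\mathbf{i}}^+$ outbound stubs are indexed $(\mathbf{i},1),\dots,(\mathbf{i},\chi_{\mathbf{i}}^+)$; if it was already active no new stubs are discovered. $A_k^+$ is the set of indices of the outbound stubs discovered in step $k$, and $Z_k^+=|A_k^+|$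 (all later $A_k^+$ are empty once one is empty). Coupled delayed branching process: $\hat\chi_\emptyset^+=(G^+)^{-1}(U_\emptyset)$ and $\hat\chi_{\mathbf{i}}^+=(F^+)^{-1}(U_{\mathbf{i}})$ for $\mathbf{i}\ne\emptyset$, with the same $U_{\mathbf{i}}$; $\hat A_0^+=\{\emptyset\}$, $\hat A_k^+=\{(\mathbf{i},j):\mathbf{i}\in\hat A_{k-1}^+,1\le j\le\hat\chi_{\mathbf{i}}^+\}$, $\hat Z_k^+=|\hat A_k^+|$. *)

theory Defs
  imports "HOL-Probability.Probability" "HOL-Library.List_Lexorder"
begin

section \<open>Bi-degree sequences\<close>

text \<open>Entry \<open>r\<close> of the list is the pair \<open>(D\<^sup>-\<^sub>r, D\<^sup>+\<^sub>r)\<close>; the nodes are \<open>0, \<dots>, n - 1\<close>.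
  Everything below is written for the \<open>+\<close> case. Exchanging the roles of inbound and outbound
  stubs means passing to \<open>flip_dir d\<close>, so the \<open>-\<close> case is the \<open>+\<close> case of \<open>flip_dir d\<close>.\<close>

type_synonym bidegree = "(nat \<times> nat) list"

definition indeg :: "bidegree \<Rightarrow> nat \<Rightarrow> nat" where
  "indeg d r = fst (d ! r)"

definition outdeg :: "bidegree \<Rightarrow> nat \<Rightarrow> nat" where
  "outdeg d r = snd (d ! r)"

definition flip_dir :: "bidegree \<Rightarrow> bidegree" where
  "flip_dir d = map prod.swap d"

definition bidegree_seq :: "nat \<Rightarrow> bidegree \<Rightarrow> bool" where
  "bidegree_seq n d \<longleftrightarrow> length d = n \<and> (\<Sum>r<n. indeg d r) = (\<Sum>r<n. outdeg d r)"

definition stub_count :: "bidegree \<Rightarrow> nat" where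
  "stub_count d = (\<Sum>r<length d. indeg d r)"

definition g_emp :: "bidegree \<Rightarrow> nat \<Rightarrow> real" where
  "g_emp d t = (\<Sum>r<length d. of_bool (outdeg d r = t)) / real (length d)"

definition f_emp :: "bidegree \<Rightarrow> nat \<Rightarrow> real" where
  "f_emp d t = (\<Sum>r<length d. of_bool (outdeg d r = t) * real (indeg d r)) / real (stub_count d)"

text \<open>Valued in \<open>ennreal\<close>, so that a divergent series is \<open>\<infinity>\<close> rather than a junk value.\<close>

definition cdf_dist :: "(nat \<Rightarrow> real) \<Rightarrow> (nat \<Rightarrow> real) \<Rightarrow> ennreal" where
  "cdf_dist p q = (\<Sum>k. ennreal \<bar>\<Sum>i\<le>k. p i - q i\<bar>)"

definition regular_bidegree ::
  "nat pmf \<Rightarrow> nat pmf \<Rightarrow> nat pmf \<Rightarrow> nat pmf \<Rightarrow> real \<Rightarrow> real \<Rightarrow> real \<Rightarrow> nat \<Rightarrow> bidegree \<Rightarrow> bool" where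
  "regular_bidegree gp gm fp fm \<epsilon> \<kappa> K\<^sub>\<kappa> n d \<longleftrightarrow>
     cdf_dist (g_emp d) (pmf gp) \<le> ennreal (real n powr (- \<epsilon>)) \<and>
     cdf_dist (g_emp (flip_dir d)) (pmf gm) \<le> ennreal (real n powr (- \<epsilon>)) \<and>
     cdf_dist (f_emp d) (pmf fp) \<le> ennreal (real n powr (- \<epsilon>)) \<and>
     cdf_dist (f_emp (flip_dir d)) (pmf fm) \<le> ennreal (real n powr (- \<epsilon>)) \<and>
     (\<Sum>r<n. (real (indeg d r) powr \<kappa> + real (outdeg d r) powr \<kappa>)
            * real (outdeg d r) * real (indeg d r)) \<le> K\<^sub>\<kappa> * real n"

section \<open>Quantiles and uniform choices\<close>

text \<open>The generalized inverse \<open>u \<mapsto> inf {x. F x \<ge> u}\<close> of the distribution function \<open>F\<close> of the mass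
  function \<open>p\<close> on the natural numbers; for \<open>0 < u < 1\<close> the infimum over the reals is attained
  at a natural number.\<close>

definition quantile :: "(nat \<Rightarrow> real) \<Rightarrow> real \<Rightarrow> nat" where
  "quantile p u = Inf {x. u \<le> (\<Sum>t\<le>x. p t)}"

text \<open>A uniform choice from the finite nonempty set \<open>S\<close>, driven by a uniform variable \<open>w\<close> on
  \<open>(0,1)\<close>: split the unit interval into \<open>card S\<close> equal parts.\<close>

definition pick :: "'a set \<Rightarrow> real \<Rightarrow> 'a" where
  "pick S w = from_nat_into S (nat \<lfloor>w * real (card S)\<rfloor>)"

lemma pick_uniform:
  assumes S: "finite S" and x: "x \<in> S"
  shows "measure (uniform_measure lborel {0<..<1}) {w. pick S w = x} = 1 / real (card S)"
proof -
  have c: "0 < card S"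
    using S x by (auto simp: card_gt_0_iff)
  note bij = bij_betw_from_nat_into_finite[OF S]
  obtain k where k: "k < card S" "from_nat_into S k = x"
    using bij x by (metis bij_betw_def imageE lessThan_iff)
  let ?I = "{real k / real (card S) ..< (real k + 1) / real (card S)}"
  have iff: "pick S w = x \<longleftrightarrow> w \<in> ?I" if w: "w \<in> {0<..<1}" for w
  proof -
    have nn: "0 \<le> w * real (card S)"
      using w by simp
    have "w * real (card S) < real (card S)"
      using w c by simp
    then have lt: "nat \<lfloor>w * real (card S)\<rfloor> < card S"
      using nn by linarith
    have "pick S w = x \<longleftrightarrow> nat \<lfloor>w * real (card S)\<rfloor> = k"
      using bij lt k unfolding pick_def bij_betw_def by (metis inj_onD lessThan_iff)
    also have "\<dots> \<longleftrightarrow> real k \<le> w * real (card S) \<and> w * real (card S) < real k + 1"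
      using nn by linarith
    also have "\<dots> \<longleftrightarrow> w \<in> ?I"
      using c by (simp add: field_simps)
    finally show ?thesis .
  qed
  have le: "(real k + 1) / real (card S) \<le> 1"
    using k c by (simp add: field_simps)
  have eq: "{0<..<1} \<inter> {w. pick S w = x} = ?I - {0}"
  proof (intro set_eqI iffI)
    fix w assume "w \<in> {0<..<1} \<inter> {w. pick S w = x}"
    then show "w \<in> ?I - {0}" using iff[of w] by auto
  next
    fix w assume w: "w \<in> ?I - {0}"
    have "0 \<le> real k / real (card S)" by simp
    with w have "0 \<le> w" "w \<noteq> 0" "w < 1" using le by (simp_all, linarith+)
    then have "w \<in> {0<..<1}" by simp
    then show "w \<in> {0<..<1} \<inter> {w. pick S w = x}" using w iff[of w] by auto
  qed
  have meas: "{w. pick S w = x} \<in> sets lborel"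
    unfolding pick_def by measurable
  have "measure (uniform_measure lborel {0<..<1}) {w. pick S w = x} = measure lborel (?I - {0})"
    using meas by (simp add: measure_uniform_measure eq)
  also have "\<dots> = measure lborel ?I"
    by (rule measure_Diff_null_set) auto
  also have "\<dots> = 1 / real (card S)"
    using c by (simp add: field_simps)
  finally show ?thesis .
qed

section \<open>The exploration process\<close>

type_synonym label = "nat list"

definition labels :: "label set" where
  "labels = {i. \<forall>j \<in> set i. 1 \<le> j}"

definition children :: "label \<Rightarrow> nat \<Rightarrow> label set" where
  "children i c = (\<lambda>j. i @ [j]) ` {1..c}"

text \<open>An inbound stub is a pair \<open>(r, j)\<close> with \<open>j < indeg d r\<close>. The field \<open>found\<close> collects the
  labels of the outbound stubs discovered in the current step. The number of traversed outbound
  stubs is \<open>card (paired s)\<close>.\<close>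

record exploration =
  active :: "nat set"
  paired :: "(nat \<times> nat) set"
  found :: "label set"

definition active_unpaired :: "bidegree \<Rightarrow> exploration \<Rightarrow> real" where
  "active_unpaired d s = real (stub_count d)
     - (\<Sum>r<length d. real (indeg d r) * of_bool (r \<notin> active s)) - real (card (paired s))"

definition h_emp :: "bidegree \<Rightarrow> exploration \<Rightarrow> nat \<Rightarrow> real" where
  "h_emp d s t =
     ((\<Sum>r<length d. of_bool (outdeg d r = t) * real (indeg d r) * of_bool (r \<notin> active s))
        + of_bool (t = 0) * active_unpaired d s)
     / (real (stub_count d) - real (card (paired s)))"

definition unpaired :: "bidegree \<Rightarrow> exploration \<Rightarrow> (nat \<times> nat) set" where
  "unpaired d s = {(r, j). r < length d \<and> j < indeg d r} - paired s"

definition candidates :: "bidegree \<Rightarrow> exploration \<Rightarrow> nat \<Rightarrow> (nat \<times> nat) set" where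
  "candidates d s t =
     (if t > 0 then {(r, j) \<in> unpaired d s. r \<notin> active s \<and> outdeg d r = t}
      else {(r, j) \<in> unpaired d s. r \<in> active s \<or> outdeg d r = 0})"

definition traverse ::
  "bidegree \<Rightarrow> (label \<Rightarrow> real) \<Rightarrow> (label \<Rightarrow> real) \<Rightarrow> label \<Rightarrow> exploration \<Rightarrow> exploration" where
  "traverse d u w i s =
     (let c = quantile (h_emp d s) (u i);
          x = pick (candidates d s c) (w i)
      in \<lparr>active = insert (fst x) (active s),
          paired = insert x (paired s),
          found = found s \<union> (if fst x \<in> active s then {} else children i c)\<rparr>)"

text \<open>\<open>List_Lexorder\<close> makes \<open>sorted_list_of_set\<close> enumerate labels in lexicographic order.\<close>

fun explore ::
  "bidegree \<Rightarrow> (label \<Rightarrow> real) \<Rightarrow> (label \<Rightarrow> real) \<Rightarrow> nat \<Rightarrow> exploration" where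
  "explore d u w 0 = \<lparr>active = {}, paired = {}, found = {[]}\<rparr>"
| "explore d u w (Suc 0) =
     (let c = quantile (g_emp d) (u [])
      in \<lparr>active = {pick {r. r < length d \<and> outdeg d r = c} (w [])},
          paired = {},
          found = children [] c\<rparr>)"
| "explore d u w (Suc (Suc k)) =
     (let s = explore d u w (Suc k)
      in fold (traverse d u w) (sorted_list_of_set (found s)) (s\<lparr>found := {}\<rparr>))"

definition A_set ::
  "bidegree \<Rightarrow> (label \<Rightarrow> real) \<Rightarrow> (label \<Rightarrow> real) \<Rightarrow> nat \<Rightarrow> label set" where
  "A_set d u w k = found (explore d u w k)"

section \<open>The coupled delayed branching process\<close>

definition chi_hat :: "nat pmf \<Rightarrow> nat pmf \<Rightarrow> (label \<Rightarrow> real) \<Rightarrow> label \<Rightarrow> nat" where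
  "chi_hat g f u i = quantile (pmf (if i = [] then g else f)) (u i)"

fun A_hat :: "nat pmf \<Rightarrow> nat pmf \<Rightarrow> (label \<Rightarrow> real) \<Rightarrow> nat \<Rightarrow> label set" where
  "A_hat g f u 0 = {[]}"
| "A_hat g f u (Suc k) = (\<Union>i \<in> A_hat g f u k. children i (chi_hat g f u i))"

definition Z_hat :: "nat pmf \<Rightarrow> nat pmf \<Rightarrow> (label \<Rightarrow> real) \<Rightarrow> nat \<Rightarrow> nat" where
  "Z_hat g f u k = card (A_hat g f u k)"

definition coupled_upto ::
  "nat pmf \<Rightarrow> nat pmf \<Rightarrow> bidegree \<Rightarrow> (label \<Rightarrow> real) \<Rightarrow> (label \<Rightarrow> real) \<Rightarrow> real \<Rightarrow> nat \<Rightarrow> bool" where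
  "coupled_upto g f d u w \<gamma> k \<longleftrightarrow>
     (\<forall>m \<in> {1..k}.
        real (card (A_hat g f u m - A_set d u w m))
          \<le> real (Z_hat g f u m) * real (length d) powr (- \<gamma>) \<and>
        real (card (A_set d u w m - A_hat g f u m))
          \<le> real (Z_hat g f u m) * real (length d) powr (- \<gamma>))"

section \<open>The probability space\<close>

text \<open>The (possibly random) bi-degree sequence \<open>D\<close> lives on the same space as the variables
  \<open>U\<^sub>i\<close>. The auxiliary variables \<open>W\<^sub>i\<close> drive the uniform choices of the exploration: given \<open>D\<close>,
  all the \<open>U\<^sub>i\<close> and the earlier choices, each choice is uniform on its candidate set. This
  determines the joint law of \<open>D\<close>, the \<open>U\<^sub>i\<close> and the exploration, whatever the realization.\<close>

locale coupling_space = prob_space M for M :: "'w measure" +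
  fixes n :: nat
    and D :: "'w \<Rightarrow> bidegree"
    and U W :: "label \<Rightarrow> 'w \<Rightarrow> real"
  assumes D_measurable: "D \<in> M \<rightarrow>\<^sub>M count_space UNIV"
    and D_bidegree: "\<omega> \<in> space M \<Longrightarrow> bidegree_seq n (D \<omega>)"
    and UW_uniform:
      "x \<in> labels <+> labels \<Longrightarrow> distr M borel (case_sum U W x) = uniform_measure lborel {0<..<1}"
    and UW_indep: "indep_vars (\<lambda>_. borel) (case_sum U W) (labels <+> labels)"
    and D_indep: "indep_set (sets (vimage_algebra (space M) D (count_space UNIV)))
      (sets (vimage_algebra (space M) (\<lambda>\<omega>. \<lambda>x \<in> labels <+> labels. case_sum U W x \<omega>)
        (Pi\<^sub>M (labels <+> labels) (\<lambda>_. borel))))"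

end

theory Submission
  imports Defs
begin

text \<open>All variables at one label can be integrated out first, since the state in which a stub is
  traversed does not depend on them. Under the quantile coupling the offspring
  numbers of one stub in the two processes therefore differ in mean by the Wasserstein distance
  between the current step distribution and \<open>f\<close>. It is at most \<open>n\<^bsup>-\<epsilon>\<^esup>\<close> plus a multiple of the share of the stubs used so
  far and of \<open>\<Sum>D\<^sup>+D\<^sup>- / L\<close> over the active nodes; a node is active after \<open>T\<close> steps with
  probability at most \<open>1 / n + 2 T D\<^sup>- / L\<close>, so the moment condition bounds the last term by a
  multiple of \<open>(T / n)\<^bsup>\<kappa>\<^esup>\<close>.

  The symmetric difference of the two generations grows by the offspring of its own members, a
  factor \<open>\<mu>\<close> on average, plus these errors. Markov's inequality thus bounds it by
  \<open>\<mu>\<^sup>m n\<^bsup>-\<gamma> - 2\<eta>\<^esup>\<close> for all \<open>m \<le> k\<close>, with \<open>\<eta>\<close> small, outside an event of polynomially small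
  probability. Up to generation \<open>\<eta> log\<^sub>\<mu> n\<close> this is less than \<open>1\<close>, so the coupling is exact. If
  the branching process dies out by then, nothing happens later. Otherwise each generation
  multiplies its size by at least \<open>\<mu>\<^bsup>1 - \<eta>\<^esup>\<close>, except with a probability of the order of
  \<open>E[\<sigma>\<^bsup>Z\<^esup>; Z > 0]\<close> for some \<open>\<sigma> < 1\<close>, which decays geometrically in the generation.\<close>

section \<open>Quantile functions of uniform variables\<close>

text \<open>Two obstacles shape the bookkeeping. The step law \<open>h_emp\<close> is a mass
  function only while unpaired stubs remain, and the estimates need \<open>T\<close> to stay below
  \<open>L / 2\<close>. Every expectation is therefore taken on the event \<open>good m\<close> that
  generations 1 to \<open>m\<close> stay below the thresholds \<open>\<tau>\<close>; the failure of
  this event is itself estimated where it first occurs, since \<open>A_set\<close> is contained in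
  the union of \<open>A_hat\<close> and the discrepancy.

  Given \<open>D = d\<close>, the variables \<open>U\<close> and \<open>W\<close> have the product
  law \<open>label_space\<close>; up to the final conditioning everything concerns one fixed
  \<open>d\<close> on that space.

  The parameter of the overview called \<open>\<eta>\<close> is \<open>2 * \<zeta>\<close> in the
  code. In \<open>\<gamma> + 12 * \<zeta> \<le> \<omega>\<close> with
  \<open>\<omega> = min (\<delta> * \<kappa>) \<epsilon>\<close>, six \<open>\<zeta>\<close> are
  lost in the bound for the discrepancy, four are the margin in its threshold, and two remain so
  that the sum over the generations still decays.\<close>

definition unif :: "real measure" where
  "unif = uniform_measure lborel {0<..<1}"

lemma prob_space_unif: "prob_space unif"
  unfolding unif_def by (rule prob_space_uniform_measure) auto

interpretation unif: prob_space unif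
  by (rule prob_space_unif)

lemma sets_unif [measurable_cong]: "sets unif = sets borel"
  by (simp add: unif_def)

lemma space_unif [simp]: "space unif = UNIV"
  by (simp add: unif_def)

lemma AE_unif: "AE u in unif. 0 < u \<and> u < 1"
  unfolding unif_def by (rule AE_uniform_measureI) auto

lemma emeasure_unif_atMost:
  assumes "0 \<le> x" "x \<le> 1"
  shows "emeasure unif {u. u \<le> x} = ennreal x"
proof -
  have "emeasure unif {u. u \<le> x} = emeasure lborel ({0<..<1} \<inter> {..x})"
    unfolding unif_def by (subst emeasure_uniform_measure) (auto simp: atMost_def divide_ennreal_def)
  also have "\<dots> = emeasure lborel {0<..x}"
  proof (cases "x = 1")
    case True
    then have "{0<..<1} \<inter> {..x} = {0<..<1}" by auto
    then show ?thesis using True by simp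
  next
    case False
    then have "{0<..<1} \<inter> {..x} = {0<..x}" using assms by auto
    then show ?thesis by simp
  qed
  finally show ?thesis using assms by simp
qed

lemma emeasure_unif_interval:
  assumes "0 \<le> x" "x \<le> y" "y \<le> 1"
  shows "emeasure unif {u. x < u \<and> u \<le> y} = ennreal (y - x)"
proof -
  have "{u. x < u \<and> u \<le> y} = {u. u \<le> y} - {u. u \<le> x}" by auto
  moreover have "emeasure unif ({u. u \<le> y} - {u. u \<le> x})
      = emeasure unif {u. u \<le> y} - emeasure unif {u. u \<le> x}"
    using assms by (intro emeasure_Diff) auto
  ultimately show ?thesis
    using assms by (simp add: emeasure_unif_atMost ennreal_minus)
qed

text \<open>Stated for plain functions because \<open>g_emp d\<close> and \<open>h_emp d s\<close>
  are formulas that become mass functions only for nonempty \<open>d\<close> and while unpaired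
  stubs remain.\<close>

definition mass_function :: "(nat \<Rightarrow> real) \<Rightarrow> bool" where
  "mass_function p \<longleftrightarrow> (\<forall>t. 0 \<le> p t) \<and> p sums 1"

lemma mass_function_pmf: "mass_function (pmf p)"
proof -
  have "(\<Sum>n. ennreal (pmf p n)) = (\<integral>\<^sup>+x. ennreal (pmf p x) \<partial>count_space UNIV)"
    by (rule nn_integral_count_space_nat[symmetric])
  also have "\<dots> = 1"
    unfolding nn_integral_pmf using measure_pmf.emeasure_space_1[of p] by (simp only: space_measure_pmf)
  finally have "(\<Sum>n. ennreal (pmf p n)) = ennreal 1"
    by simp
  moreover have "(\<lambda>n. ennreal (pmf p n)) sums (\<Sum>n. ennreal (pmf p n))"
    by (rule summable_sums) (rule summableI)
  ultimately have "(\<lambda>n. ennreal (pmf p n)) sums ennreal 1"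
    by (simp only:)
  then have "pmf p sums 1"
    by (subst (asm) sums_ennreal) simp_all
  then show ?thesis by (simp add: mass_function_def)
qed

lemma mass_function_partial_le_1:
  assumes "mass_function p"
  shows "(\<Sum>t\<le>k. p t) \<le> 1"
  using assms unfolding mass_function_def
  by (metis finite_atMost sum_le_suminf sums_summable sums_unique)

lemma mass_function_partial_nonneg: "mass_function p \<Longrightarrow> 0 \<le> (\<Sum>t\<le>k. p t)"
  unfolding mass_function_def by (simp add: sum_nonneg)

text \<open>Galois connection between a distribution function and its inverse. The condition
  \<open>u < 1\<close> makes the set under the infimum nonempty; \<open>Inf\<close> of the empty set
  of naturals would be a default value.\<close>

lemma quantile_le_iff:
  assumes p: "mass_function p" and u: "u < 1"
  shows "quantile p u \<le> k \<longleftrightarrow> u \<le> (\<Sum>t\<le>k. p t)"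
proof -
  have "(\<lambda>n. \<Sum>t\<le>n. p t) \<longlonglongrightarrow> 1"
    using p by (simp add: mass_function_def sums_def_le)
  then have "eventually (\<lambda>n. u < (\<Sum>t\<le>n. p t)) sequentially"
    using u by (rule order_tendstoD)
  then obtain N where "u < (\<Sum>t\<le>N. p t)"
    by (auto simp: eventually_sequentially)
  then have ne: "{x. u \<le> (\<Sum>t\<le>x. p t)} \<noteq> {}" by (auto intro: less_imp_le)
  have mem: "u \<le> (\<Sum>t\<le>quantile p u. p t)"
    using Inf_nat_def1[OF ne] unfolding quantile_def by simp
  have mono: "(\<Sum>t\<le>a. p t) \<le> (\<Sum>t\<le>b. p t)" if "a \<le> b" for a b
    using p that by (intro sum_mono2) (auto simp: mass_function_def)
  show ?thesis
  proof
    assume "quantile p u \<le> k"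
    then show "u \<le> (\<Sum>t\<le>k. p t)" using mem mono by (rule_tac order_trans)
  next
    assume "u \<le> (\<Sum>t\<le>k. p t)"
    then show "quantile p u \<le> k"
      unfolding quantile_def by (intro wellorder_Inf_le1) simp
  qed
qed

lemma quantile_eq_iff:
  assumes p: "mass_function p" and u: "0 < u" "u < 1"
  shows "quantile p u = c \<longleftrightarrow> (\<Sum>t<c. p t) < u \<and> u \<le> (\<Sum>t\<le>c. p t)"
proof (cases c)
  case 0
  then show ?thesis using quantile_le_iff[OF p u(2), of 0] u by simp
next
  case (Suc c')
  have "quantile p u = c \<longleftrightarrow> quantile p u \<le> c \<and> \<not> quantile p u \<le> c'"
    using Suc by auto
  then show ?thesis
    using quantile_le_iff[OF p u(2), of c] quantile_le_iff[OF p u(2), of c']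
    unfolding Suc lessThan_Suc_atMost by linarith
qed

text \<open>Later applied with \<open>p\<close> proportional to the size of a candidate set: a drawn
  value always has candidates, so \<open>pick\<close> never chooses from the empty set.\<close>

lemma quantile_mass_pos:
  assumes p: "mass_function p" and u: "0 < u" "u < 1"
  shows "0 < p (quantile p u)"
proof -
  have "(\<Sum>t<quantile p u. p t) < (\<Sum>t\<le>quantile p u. p t)"
    using quantile_eq_iff[OF p u, of "quantile p u"] by simp
  then show ?thesis by (simp flip: lessThan_Suc_atMost)
qed

lemma measurable_quantile [measurable]: "quantile p \<in> borel \<rightarrow>\<^sub>M count_space UNIV"
proof -
  have "quantile p = (\<lambda>u. LEAST x. u \<le> (\<Sum>t\<le>x. p t))"
    by (simp add: quantile_def Inf_nat_def fun_eq_iff)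
  moreover have "(\<lambda>u. LEAST x. u \<le> (\<Sum>t\<le>x. p t)) \<in> borel \<rightarrow>\<^sub>M count_space UNIV"
    by measurable
  ultimately show ?thesis by simp
qed

lemma emeasure_quantile_eq:
  assumes p: "mass_function p"
  shows "emeasure unif {u. quantile p u = c} = ennreal (p c)"
proof -
  have "emeasure unif {u. quantile p u = c}
      = emeasure unif {u. (\<Sum>t<c. p t) < u \<and> u \<le> (\<Sum>t\<le>c. p t)}"
    by (intro emeasure_eq_AE eventually_mono[OF AE_unif]) (auto simp: quantile_eq_iff[OF p])
  also have "\<dots> = ennreal ((\<Sum>t\<le>c. p t) - (\<Sum>t<c. p t))"
    using p mass_function_partial_le_1[OF p, of c]
    by (intro emeasure_unif_interval) (auto simp: mass_function_def sum_nonneg intro!: sum_mono2)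
  also have "(\<Sum>t\<le>c. p t) - (\<Sum>t<c. p t) = p c"
    by (simp flip: lessThan_Suc_atMost)
  finally show ?thesis .
qed

lemma distr_quantile_pmf: "distr unif (count_space UNIV) (quantile (pmf p)) = measure_pmf p"
proof (rule measure_eqI_countable[where A=UNIV])
  show "sets (distr unif (count_space UNIV) (quantile (pmf p))) = Pow UNIV" "sets (measure_pmf p) = Pow UNIV"
    by (simp_all only: sets_distr sets_count_space sets_measure_pmf_count_space)
  show "emeasure (distr unif (count_space UNIV) (quantile (pmf p))) {a} = emeasure (measure_pmf p) {a}" for a
  proof -
    have "emeasure (distr unif (count_space UNIV) (quantile (pmf p))) {a} = emeasure unif (quantile (pmf p) -` {a} \<inter> space unif)"
      by (rule emeasure_distr) auto
    also have "quantile (pmf p) -` {a} \<inter> space unif = {u. quantile (pmf p) u = a}"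
      by auto
    finally show ?thesis
      by (simp only: emeasure_quantile_eq[OF mass_function_pmf] emeasure_pmf_single)
  qed
qed simp

lemma nn_integral_quantile_pmf:
  "(\<integral>\<^sup>+u. \<phi> (quantile (pmf p) u) \<partial>unif) = (\<integral>\<^sup>+x. \<phi> x \<partial>measure_pmf p)"
proof -
  have "(\<integral>\<^sup>+x. \<phi> x \<partial>distr unif (count_space UNIV) (quantile (pmf p))) = (\<integral>\<^sup>+u. \<phi> (quantile (pmf p) u) \<partial>unif)"
    by (rule nn_integral_distr) auto
  then show ?thesis by (simp only: distr_quantile_pmf)
qed

section \<open>Quantile coupling and Wasserstein distance on the natural numbers\<close>

lemma nat_dist_eq_suminf:
  "ennreal \<bar>real a - real b\<bar> = (\<Sum>k. of_bool ((a \<le> k) \<noteq> (b \<le> k)))"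
proof -
  have eq: "(\<Sum>k. of_bool ((a \<le> k) \<noteq> (b \<le> k))) = ennreal (real b - real a)" if "a \<le> b" for a b :: nat
  proof -
    have "(\<lambda>k. of_bool ((a \<le> k) \<noteq> (b \<le> k)) :: ennreal) = (\<lambda>k. indicator {a..<b} k)"
      using that by (auto simp: fun_eq_iff indicator_def)
    then have "(\<Sum>k. of_bool ((a \<le> k) \<noteq> (b \<le> k)) :: ennreal) = (\<Sum>k. indicator {a..<b} k)"
      by (rule arg_cong)
    also have "\<dots> = (\<Sum>k\<in>{a..<b}. indicator {a..<b} k)"
      by (intro suminf_finite) auto
    also have "\<dots> = of_nat (b - a)" by simp
    also have "\<dots> = ennreal (real b - real a)"
      using that by (subst ennreal_of_nat_eq_real_of_nat) (simp only: of_nat_diff)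
    finally show ?thesis .
  qed
  show ?thesis
  proof (cases "a \<le> b")
    case True
    then show ?thesis using eq[OF True] by (simp add: abs_real_def)
  next
    case False
    then show ?thesis using eq[of b a] by (simp add: abs_real_def eq_commute)
  qed
qed

text \<open>The quantile coupling realises the Wasserstein distance: \<open>\<bar>a - b\<bar>\<close> counts the levels \<open>k\<close>
  that separate \<open>a\<close> from \<open>b\<close>.\<close>

lemma nn_integral_quantile_dist:
  assumes p: "mass_function p" and q: "mass_function q"
  shows "(\<integral>\<^sup>+u. ennreal \<bar>real (quantile p u) - real (quantile q u)\<bar> \<partial>unif) = cdf_dist p q"
proof -
  \<comment> \<open>Exactly one of the two quantiles is at most \<open>k\<close> iff
    \<open>u\<close> lies between the two partial sums up to \<open>k\<close>, an interval whose
    length is the distance of the distribution functions at \<open>k\<close>.\<close>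
  have lev: "(\<integral>\<^sup>+u. of_bool ((quantile p u \<le> k) \<noteq> (quantile q u \<le> k)) \<partial>unif)
      = ennreal \<bar>\<Sum>i\<le>k. p i - q i\<bar>" for k
  proof -
    let ?P = "\<Sum>t\<le>k. p t" and ?Q = "\<Sum>t\<le>k. q t"
    let ?I = "{u. min ?P ?Q < u \<and> u \<le> max ?P ?Q}"
    have "(\<integral>\<^sup>+u. of_bool ((quantile p u \<le> k) \<noteq> (quantile q u \<le> k)) \<partial>unif) = (\<integral>\<^sup>+u. indicator ?I u \<partial>unif)"
      by (intro nn_integral_cong_AE eventually_mono[OF AE_unif])
         (auto simp: quantile_le_iff[OF p] quantile_le_iff[OF q] indicator_def)
    also have "\<dots> = emeasure unif ?I"
      by (intro nn_integral_indicator) auto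
    also have "\<dots> = ennreal (max ?P ?Q - min ?P ?Q)"
      using mass_function_partial_le_1 mass_function_partial_nonneg p q
      by (intro emeasure_unif_interval) auto
    also have "max ?P ?Q - min ?P ?Q = \<bar>\<Sum>i\<le>k. p i - q i\<bar>"
      by (simp add: sum_subtractf)
    finally show ?thesis .
  qed
  have "(\<integral>\<^sup>+u. ennreal \<bar>real (quantile p u) - real (quantile q u)\<bar> \<partial>unif)
      = (\<Sum>k. \<integral>\<^sup>+u. of_bool ((quantile p u \<le> k) \<noteq> (quantile q u \<le> k)) \<partial>unif)"
    unfolding nat_dist_eq_suminf by (rule nn_integral_suminf) measurable
  also have "\<dots> = cdf_dist p q"
    unfolding lev cdf_dist_def ..
  finally show ?thesis .
qed

lemma measurable_pick [measurable]:
  "pick S \<in> borel \<rightarrow>\<^sub>M count_space UNIV"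
  unfolding pick_def by measurable

lemma emeasure_pick_eq:
  assumes "finite S" "x \<in> S"
  shows "emeasure unif {w. pick S w = x} = ennreal (1 / real (card S))"
  using pick_uniform[OF assms] by (simp add: unif.emeasure_eq_measure flip: unif_def)

lemma cdf_dist_triangle: "cdf_dist p r \<le> cdf_dist p q + cdf_dist q r"
proof -
  have "ennreal \<bar>\<Sum>i\<le>k. p i - r i\<bar> \<le> ennreal \<bar>\<Sum>i\<le>k. p i - q i\<bar> + ennreal \<bar>\<Sum>i\<le>k. q i - r i\<bar>" for k
    by (subst ennreal_plus[symmetric]) (auto intro!: ennreal_leI simp: sum_subtractf simp del: ennreal_plus)
  then have "cdf_dist p r \<le> (\<Sum>k. ennreal \<bar>\<Sum>i\<le>k. p i - q i\<bar> + ennreal \<bar>\<Sum>i\<le>k. q i - r i\<bar>)"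
    unfolding cdf_dist_def by (intro suminf_le) auto
  then show ?thesis unfolding cdf_dist_def by (simp add: suminf_add)
qed

section \<open>Traversal of the stubs of one generation\<close>

definition chi :: "bidegree \<Rightarrow> (label \<Rightarrow> real) \<Rightarrow> exploration \<Rightarrow> label \<Rightarrow> nat" where
  "chi d u s i = quantile (h_emp d s) (u i)"

definition hit ::
  "bidegree \<Rightarrow> (label \<Rightarrow> real) \<Rightarrow> (label \<Rightarrow> real) \<Rightarrow> exploration \<Rightarrow> label \<Rightarrow> nat \<times> nat" where
  "hit d u w s i = pick (candidates d s (chi d u s i)) (w i)"

lemma traverse_sel:
  "active (traverse d u w i s) = insert (fst (hit d u w s i)) (active s)"
  "paired (traverse d u w i s) = insert (hit d u w s i) (paired s)"
  "found (traverse d u w i s) =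
     found s \<union> (if fst (hit d u w s i) \<in> active s then {} else children i (chi d u s i))"
  by (simp_all add: traverse_def hit_def chi_def Let_def)

text \<open>The fold is cut at the first occurrence of \<open>i\<close>, so that sums and unions
  over a whole generation can refer to the state at the turn of each stub. For \<open>i\<close>
  outside the list this is the final state.\<close>

definition state_before ::
  "bidegree \<Rightarrow> (label \<Rightarrow> real) \<Rightarrow> (label \<Rightarrow> real) \<Rightarrow> label list \<Rightarrow> exploration \<Rightarrow> label \<Rightarrow> exploration"
  where "state_before d u w xs s i = fold (traverse d u w) (takeWhile (\<lambda>j. j \<noteq> i) xs) s"

lemma state_before_Cons:
  "state_before d u w (x # xs) s i =
     (if i = x then s else state_before d u w xs (traverse d u w x s) i)"
  by (simp add: state_before_def)

text \<open>Rewrites the fold as a union over labels, the form in which hits can be counted;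
  distinctness lets \<open>state_before\<close> name the state at the only turn of each
  label.\<close>

lemma active_fold_traverse:
  "distinct xs \<Longrightarrow> active (fold (traverse d u w) xs s)
     = active s \<union> (\<lambda>i. fst (hit d u w (state_before d u w xs s i) i)) ` set xs"
proof (induction xs arbitrary: s)
  case (Cons x xs)
  have "(\<lambda>i. fst (hit d u w (state_before d u w xs (traverse d u w x s) i) i)) ` set xs
      = (\<lambda>i. fst (hit d u w (state_before d u w (x # xs) s i) i)) ` set xs"
    using Cons.prems by (intro image_cong) (auto simp: state_before_Cons)
  then show ?case
    using Cons.prems by (simp add: Cons.IH traverse_sel(1) state_before_Cons[of d u w x xs s x])
qed simp

lemma found_fold_traverse:
  "distinct xs \<Longrightarrow> found (fold (traverse d u w) xs s) = found s \<union>
     (\<Union>i \<in> set xs. if fst (hit d u w (state_before d u w xs s i) i) \<in> active (state_before d u w xs s i)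
        then {} else children i (chi d u (state_before d u w xs s i) i))"
proof (induction xs arbitrary: s)
  case (Cons x xs)
  let ?K = "\<lambda>i t. if fst (hit d u w t i) \<in> active t then {} else children i (chi d u t i)"
  have "(\<Union>i \<in> set xs. ?K i (state_before d u w xs (traverse d u w x s) i))
      = (\<Union>i \<in> set xs. ?K i (state_before d u w (x # xs) s i))"
    using Cons.prems by (intro SUP_cong refl) (auto simp: state_before_Cons)
  moreover have "?K x (state_before d u w (x # xs) s x) = ?K x s"
    by (simp add: state_before_Cons)
  moreover have "found (fold (traverse d u w) (x # xs) s)
      = (found s \<union> ?K x s) \<union> (\<Union>i \<in> set xs. ?K i (state_before d u w xs (traverse d u w x s) i))"
    using Cons.prems by (simp only: fold_simps Cons.IH[OF distinct.simps(2)[THEN iffD1, THEN conjunct2]] traverse_sel(3))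
  ultimately show ?case
    by (simp only: set_simps UN_insert Un_assoc)
qed simp

lemma card_paired_fold_traverse:
  "finite (paired s) \<Longrightarrow> card (paired (fold (traverse d u w) xs s)) \<le> card (paired s) + length xs"
proof (induction xs arbitrary: s)
  case (Cons x xs)
  have "card (paired (fold (traverse d u w) (x # xs) s)) \<le> card (paired (traverse d u w x s)) + length xs"
    unfolding fold_simps using Cons.prems by (intro Cons.IH) (simp add: traverse_sel(2))
  also have "card (paired (traverse d u w x s)) \<le> Suc (card (paired s))"
    by (simp add: traverse_sel(2) card_insert_le_m1 card_insert_if Cons.prems)
  finally show ?case by simp
qed simp

lemma active_fold_traverse_mono: "active s \<subseteq> active (fold (traverse d u w) xs s)"
proof (induction xs arbitrary: s)
  case (Cons x xs)
  have "active s \<subseteq> active (traverse d u w x s)" by (auto simp: traverse_sel(1))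
  then show ?case using Cons[of "traverse d u w x s"] by simp
qed simp

lemma active_state_before_mono:
  "active (state_before d u w xs s i) \<subseteq> active (fold (traverse d u w) xs s)"
proof -
  have "fold (traverse d u w) xs s
      = fold (traverse d u w) (dropWhile (\<lambda>j. j \<noteq> i) xs) (state_before d u w xs s i)"
    unfolding state_before_def
    by (metis comp_apply fold_append takeWhile_dropWhile_id)
  then show ?thesis by (simp add: active_fold_traverse_mono)
qed

text \<open>Locality: only the variables at the listed labels are read. Invariance of the
  exploration under resampling at other labels rests on this.\<close>

lemma fold_traverse_cong:
  assumes "\<And>i. i \<in> set xs \<Longrightarrow> u i = u' i \<and> w i = w' i"
  shows "fold (traverse d u w) xs s = fold (traverse d u' w') xs s"
  using assms by (intro fold_cong) (auto simp: traverse_def fun_eq_iff)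

section \<open>Consistent exploration states\<close>

text \<open>Invariant of the exploration. It leaves \<open>found\<close> free, so resetting that
  field between generations preserves it. The second conjunct is what turns the formula
  \<open>active_unpaired\<close> into a cardinality.\<close>

definition consistent :: "bidegree \<Rightarrow> exploration \<Rightarrow> bool" where
  "consistent d s \<longleftrightarrow> active s \<subseteq> {..<length d} \<and>
     paired s \<subseteq> {(r, j). r \<in> active s \<and> j < indeg d r}"

definition stubs :: "bidegree \<Rightarrow> (nat \<times> nat) set" where
  "stubs d = {(r, j). r < length d \<and> j < indeg d r}"

lemma stubs_Sigma: "stubs d = Sigma {..<length d} (\<lambda>r. {..<indeg d r})"
  by (auto simp: stubs_def)

lemma finite_stubs [simp]: "finite (stubs d)"
  unfolding stubs_Sigma by (intro finite_SigmaI) auto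

lemma card_stubs: "card (stubs d) = stub_count d"
  unfolding stubs_Sigma stub_count_def by (subst card_SigmaI) auto

lemma consistent_paired_subset: "consistent d s \<Longrightarrow> paired s \<subseteq> stubs d"
  unfolding consistent_def stubs_def by auto

lemma consistent_finite:
  assumes "consistent d s"
  shows "finite (paired s)" "finite (active s)"
  using assms finite_subset[OF consistent_paired_subset[OF assms] finite_stubs]
  by (auto simp: consistent_def intro: finite_subset)

lemma card_unpaired:
  assumes "consistent d s"
  shows "card (unpaired d s) = stub_count d - card (paired s)"
proof -
  have "unpaired d s = stubs d - paired s"
    by (simp add: unpaired_def stubs_def)
  then show ?thesis
    by (simp add: card_Diff_subset consistent_finite[OF assms] consistent_paired_subset[OF assms] card_stubs)
qed

lemma card_paired_le:
  assumes "consistent d s"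
  shows "card (paired s) \<le> stub_count d"
  using card_mono[OF finite_stubs consistent_paired_subset[OF assms]] by (simp add: card_stubs)

lemma finite_unpaired [simp]: "finite (unpaired d s)"
proof -
  have "unpaired d s \<subseteq> stubs d" by (auto simp: unpaired_def stubs_def)
  then show ?thesis by (rule finite_subset) simp
qed

text \<open>The offspring number that reaching stub \<open>x\<close> produces: an active node yields
  nothing new. In this form \<open>candidates d s t\<close> is the fibre over \<open>t\<close>, and
  the cases \<open>t > 0\<close> and \<open>t = 0\<close> merge.\<close>

definition stub_class :: "bidegree \<Rightarrow> exploration \<Rightarrow> nat \<times> nat \<Rightarrow> nat" where
  "stub_class d s x = (if fst x \<in> active s then 0 else outdeg d (fst x))"

lemma candidates_eq: "candidates d s t = {x \<in> unpaired d s. stub_class d s x = t}"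
  by (auto simp: candidates_def stub_class_def)

lemma finite_candidates [simp]: "finite (candidates d s t)"
  unfolding candidates_eq by simp

lemma sum_of_bool_eq: "finite A \<Longrightarrow> (\<Sum>r\<in>A. real (f r) * of_bool (P r)) = real (\<Sum>r\<in>{r\<in>A. P r}. f r)"
proof -
  assume A: "finite A"
  have "(\<Sum>r\<in>A. real (f r) * of_bool (P r)) = (\<Sum>r\<in>A. if P r then real (f r) else 0)"
    by (intro sum.cong) auto
  also have "\<dots> = (\<Sum>r\<in>{r\<in>A. P r}. real (f r))"
    by (rule sum.inter_filter[OF A, symmetric])
  finally show ?thesis by simp
qed

text \<open>Paired stubs belong to active nodes, so every stub of an inactive node is still available.\<close>

lemma h_emp_eq_card:
  assumes c: "consistent d s"
  shows "h_emp d s t = real (card (candidates d s t)) / real (card (unpaired d s))"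
proof -
  let ?n = "length d" and ?a = "active s"
  define N where "N = {r \<in> {..<?n}. r \<notin> ?a \<and> outdeg d r = t}"
  have act: "?a \<subseteq> {..<?n}" and pr: "paired s \<subseteq> Sigma ?a (\<lambda>r. {..<indeg d r})"
    using c by (auto simp: consistent_def)
  have fa: "finite ?a" by (rule consistent_finite[OF c])
  have S1: "(\<Sum>r<?n. of_bool (outdeg d r = t) * real (indeg d r) * of_bool (r \<notin> ?a))
      = real (card (Sigma N (\<lambda>r. {..<indeg d r})))"
  proof -
    have "(\<Sum>r<?n. of_bool (outdeg d r = t) * real (indeg d r) * of_bool (r \<notin> ?a))
        = (\<Sum>r<?n. real (indeg d r) * of_bool (r \<notin> ?a \<and> outdeg d r = t))"
      by (intro sum.cong) auto
    also have "\<dots> = real (\<Sum>r\<in>N. indeg d r)"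
      unfolding N_def by (rule sum_of_bool_eq) simp
    also have "(\<Sum>r\<in>N. indeg d r) = card (Sigma N (\<lambda>r. {..<indeg d r}))"
      by (subst card_SigmaI) (auto simp: N_def)
    finally show ?thesis .
  qed
  have S2: "active_unpaired d s = real (card (Sigma ?a (\<lambda>r. {..<indeg d r}) - paired s))"
  proof -
    have "(\<Sum>r<?n. real (indeg d r) * of_bool (r \<notin> ?a)) = real (\<Sum>r\<in>{r\<in>{..<?n}. r \<notin> ?a}. indeg d r)"
      by (rule sum_of_bool_eq) simp
    moreover have "(\<Sum>r<?n. indeg d r) = (\<Sum>r\<in>?a. indeg d r) + (\<Sum>r\<in>{r\<in>{..<?n}. r \<notin> ?a}. indeg d r)"
      using act fa by (subst sum.union_disjoint[symmetric]) (auto intro!: sum.cong)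
    moreover have "(\<Sum>r\<in>?a. indeg d r) = card (Sigma ?a (\<lambda>r. {..<indeg d r}))"
      using fa by (subst card_SigmaI) auto
    moreover have "card (Sigma ?a (\<lambda>r. {..<indeg d r}) - paired s)
        = card (Sigma ?a (\<lambda>r. {..<indeg d r})) - card (paired s)"
      using pr by (intro card_Diff_subset consistent_finite[OF c])
    moreover have "card (paired s) \<le> card (Sigma ?a (\<lambda>r. {..<indeg d r}))"
      using pr fa by (intro card_mono) auto
    ultimately show ?thesis
      by (simp add: active_unpaired_def stub_count_def of_nat_diff)
  qed
  have S3: "real (stub_count d) - real (card (paired s)) = real (card (unpaired d s))"
    by (simp add: card_unpaired[OF c] of_nat_diff card_paired_le[OF c])
  have S4: "real (card (candidates d s t)) =
      real (card (Sigma N (\<lambda>r. {..<indeg d r})))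
      + of_bool (t = 0) * real (card (Sigma ?a (\<lambda>r. {..<indeg d r}) - paired s))"
  proof (cases "t = 0")
    case True
    have "candidates d s t = Sigma N (\<lambda>r. {..<indeg d r}) \<union> (Sigma ?a (\<lambda>r. {..<indeg d r}) - paired s)"
      using act pr True by (auto simp: candidates_eq unpaired_def stub_class_def N_def)
    moreover have "card (Sigma N (\<lambda>r. {..<indeg d r}) \<union> (Sigma ?a (\<lambda>r. {..<indeg d r}) - paired s))
        = card (Sigma N (\<lambda>r. {..<indeg d r})) + card (Sigma ?a (\<lambda>r. {..<indeg d r}) - paired s)"
      using fa by (intro card_Un_disjoint) (auto simp: N_def)
    ultimately show ?thesis using True by simp
  next
    case False
    have "candidates d s t = Sigma N (\<lambda>r. {..<indeg d r})"
      using act pr False by (auto simp: candidates_eq unpaired_def stub_class_def N_def)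
    then show ?thesis using False by simp
  qed
  show ?thesis
    unfolding h_emp_def S1 S2 S3 S4 ..
qed

text \<open>The fibres of \<open>stub_class\<close> partition the unpaired stubs, so their sizes add
  up to the denominator, which is positive while some stub is unpaired.\<close>

lemma mass_function_h_emp:
  assumes c: "consistent d s" and lt: "card (paired s) < stub_count d"
  shows "mass_function (h_emp d s)"
proof -
  let ?U = "unpaired d s" and ?g = "stub_class d s"
  have pos: "0 < card ?U" using lt by (simp only: card_unpaired[OF c] zero_less_diff)
  have "(\<Sum>t\<in>?g ` ?U. h_emp d s t) = (\<Sum>t\<in>?g ` ?U. real (card (candidates d s t))) / real (card ?U)"
    by (simp add: h_emp_eq_card[OF c] sum_divide_distrib)
  also have "(\<Sum>t\<in>?g ` ?U. real (card (candidates d s t))) = real (card ?U)"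
    using sum.image_gen[of ?U "\<lambda>_. 1::real" ?g] by (simp add: candidates_eq)
  finally have "(\<Sum>t\<in>?g ` ?U. h_emp d s t) = 1" using pos by auto
  moreover have "h_emp d s sums (\<Sum>t\<in>?g ` ?U. h_emp d s t)"
  proof (rule sums_finite)
    show "h_emp d s t = 0" if "t \<notin> ?g ` ?U" for t
    proof -
      have "candidates d s t = {}" using that by (auto simp: candidates_eq)
      then show ?thesis by (simp add: h_emp_eq_card[OF c])
    qed
  qed simp
  ultimately show ?thesis
    by (simp add: mass_function_def h_emp_eq_card[OF c])
qed

text \<open>The drawn class has positive mass, hence a nonempty fibre, and
  \<open>from_nat_into\<close> of a nonempty set stays in the set for every argument.\<close>

lemma hit_mem_candidates:
  assumes c: "consistent d s" "card (paired s) < stub_count d"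
    and u: "0 < u i" "u i < 1"
  shows "hit d u w s i \<in> candidates d s (chi d u s i)"
proof -
  have "0 < h_emp d s (chi d u s i)"
    unfolding chi_def by (rule quantile_mass_pos[OF mass_function_h_emp[OF c] u])
  then have "candidates d s (chi d u s i) \<noteq> {}"
    by (auto simp: h_emp_eq_card[OF c(1)])
  then show ?thesis
    unfolding hit_def pick_def by (rule from_nat_into)
qed

lemma
  assumes "consistent d s" "card (paired s) < stub_count d" "0 < u i" "u i < 1"
  shows consistent_traverse: "consistent d (traverse d u w i s)"
    and new_stubs_eq: "(if fst (hit d u w s i) \<in> active s then {} else children i (chi d u s i))
          = children i (chi d u s i)"
proof -
  have h: "hit d u w s i \<in> unpaired d s" "stub_class d s (hit d u w s i) = chi d u s i"
    using hit_mem_candidates[where u=u and i=i, OF assms] by (auto simp: candidates_eq)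
  obtain r j where rj: "hit d u w s i = (r, j)" by force
  have "r < length d" "j < indeg d r"
    using h(1) rj by (auto simp: unpaired_def)
  then show "consistent d (traverse d u w i s)"
    using assms(1) unfolding consistent_def by (auto simp: traverse_sel rj)
  show "(if fst (hit d u w s i) \<in> active s then {} else children i (chi d u s i))
          = children i (chi d u s i)"
    using h(2) by (auto simp: stub_class_def children_def)
qed

lemma consistent_fold_traverse:
  assumes "consistent d s" "card (paired s) + length xs \<le> stub_count d"
    and "\<And>i. i \<in> set xs \<Longrightarrow> 0 < u i \<and> u i < 1"
  shows "consistent d (fold (traverse d u w) xs s)"
  using assms
proof (induction xs arbitrary: s)
  case (Cons x xs)
  have "consistent d (traverse d u w x s)"
    using Cons.prems by (intro consistent_traverse) auto
  moreover have "card (paired (traverse d u w x s)) \<le> Suc (card (paired s))"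
    by (simp add: traverse_sel(2) card_insert_if consistent_finite[OF Cons.prems(1)])
  ultimately show ?case
    using Cons.prems by (simp add: Cons.IH)
qed simp

text \<open>The strict inequality accounts for the stub \<open>i\<close> itself, which is still to
  be traversed; it guarantees an unpaired inbound stub for it.\<close>

lemma state_before_bounds:
  assumes "consistent d s" "card (paired s) + length xs \<le> stub_count d"
    and "\<And>i. i \<in> set xs \<Longrightarrow> 0 < u i \<and> u i < 1" and i: "i \<in> set xs"
  shows "consistent d (state_before d u w xs s i)"
    and "card (paired (state_before d u w xs s i)) < card (paired s) + length xs"
proof -
  obtain ys zs where xs: "xs = ys @ i # zs" "i \<notin> set ys"
    using split_list_first[OF i] by blast
  then have tw: "takeWhile (\<lambda>j. j \<noteq> i) xs = ys"
    by (subst xs(1), subst takeWhile_append2) auto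
  show "consistent d (state_before d u w xs s i)"
    unfolding state_before_def tw using assms xs by (intro consistent_fold_traverse) auto
  have "card (paired (state_before d u w xs s i)) \<le> card (paired s) + length ys"
    unfolding state_before_def tw
    by (rule card_paired_fold_traverse) (rule consistent_finite[OF assms(1)])
  then show "card (paired (state_before d u w xs s i)) < card (paired s) + length xs"
    by (simp add: xs)
qed

section \<open>Generations of the exploration and of the branching process\<close>

lemma finite_children [simp]: "finite (children i c)"
  by (simp add: children_def)

lemma card_children [simp]: "card (children i c) = c"
  by (simp add: children_def card_image inj_on_def)

lemma children_subset:
  assumes "i \<in> labels" "length i = m"
  shows "children i c \<subseteq> {j \<in> labels. length j = Suc m}"
  using assms by (auto simp: children_def labels_def)

text \<open>Two sets of children of one parent are initial segments, hence nested, and differ only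
  in the last entries between the two counts.\<close>

lemma card_children_sym_diff:
  "card (sym_diff (children i a) (children i b)) \<le> nat \<bar>int a - int b\<bar>"
proof -
  have "sym_diff (children i a) (children i b) \<subseteq> (\<lambda>j. i @ [j]) ` {min a b <.. max a b}"
  proof
    fix x assume x: "x \<in> sym_diff (children i a) (children i b)"
    then obtain j where j: "x = i @ [j]" by (auto simp: children_def)
    then have "j \<in> {min a b <.. max a b}" using x by (auto simp: children_def)
    then show "x \<in> (\<lambda>j. i @ [j]) ` {min a b <.. max a b}" using j by blast
  qed
  then have "card (sym_diff (children i a) (children i b)) \<le> card ((\<lambda>j. i @ [j]) ` {min a b <.. max a b})"
    by (intro card_mono) auto
  also have "\<dots> \<le> card {min a b <.. max a b}"
    by (rule card_image_le) simp
  also have "\<dots> \<le> nat \<bar>int a - int b\<bar>"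
    by simp
  finally show ?thesis .
qed

lemma card_children_sym_diff_real:
  "real (card (sym_diff (children i a) (children i b))) \<le> \<bar>real a - real b\<bar>"
  using card_children_sym_diff[of i a b] by linarith

text \<open>Crude, but free of conditions on \<open>u\<close> and \<open>w\<close>: it makes
  \<open>A_set_labels\<close> hold at every point of the space and not only almost
  everywhere.\<close>

lemma found_fold_subset:
  "found (fold (traverse d u w) xs s) \<subseteq> found s \<union> (\<Union>i \<in> set xs. \<Union>c. children i c)"
proof (induction xs arbitrary: s)
  case (Cons x xs)
  show ?case using Cons[of "traverse d u w x s"] by (auto simp: traverse_sel(3) split: if_splits)
qed simp

lemma finite_found_fold: "finite (found s) \<Longrightarrow> finite (found (fold (traverse d u w) xs s))"
  by (induction xs arbitrary: s) (auto simp: traverse_sel(3))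

lemma explore_Suc:
  assumes "1 \<le> m"
  shows "explore d u w (Suc m) = fold (traverse d u w) (sorted_list_of_set (A_set d u w m))
           ((explore d u w m)\<lparr>found := {}\<rparr>)"
  using assms by (cases m) (simp_all add: A_set_def Let_def)

declare explore.simps(3) [simp del]

lemma explore_1_sel:
  "active (explore d u w (Suc 0)) =
     {pick {r. r < length d \<and> outdeg d r = quantile (g_emp d) (u [])} (w [])}"
  "paired (explore d u w (Suc 0)) = {}"
  "A_set d u w (Suc 0) = children [] (quantile (g_emp d) (u []))"
  by (simp_all add: A_set_def Let_def)

lemma finite_A_set [simp]: "finite (A_set d u w m)"
proof (induction m)
  case (Suc m)
  then show ?case
  proof (cases "m = 0")
    case False
    then show ?thesis
      unfolding A_set_def[of d u w "Suc m"] by (simp only: explore_Suc) (intro finite_found_fold, simp)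
  qed (simp add: explore_1_sel)
qed (simp add: A_set_def)

text \<open>Since the generation of a stub is the length of its label, different generations use
  distinct variables.\<close>

lemma A_set_labels: "A_set d u w m \<subseteq> {i \<in> labels. length i = m}"
proof (induction m)
  case 0
  then show ?case by (simp add: A_set_def labels_def)
next
  case (Suc m)
  show ?case
  proof (cases "m = 0")
    case True
    have "[] \<in> labels" by (simp add: labels_def)
    then show ?thesis using children_subset[of "[]" 0] True by (simp add: explore_1_sel)
  next
    case False
    have "A_set d u w (Suc m) \<subseteq> (\<Union>i \<in> A_set d u w m. \<Union>c. children i c)"
      using found_fold_subset[of d u w "sorted_list_of_set (A_set d u w m)" "(explore d u w m)\<lparr>found := {}\<rparr>"] False
      unfolding A_set_def[of d u w "Suc m"] by (simp add: explore_Suc)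
    also have "\<dots> \<subseteq> {i \<in> labels. length i = Suc m}"
      using Suc children_subset by blast
    finally show ?thesis .
  qed
qed

text \<open>Adaptedness: by \<open>A_set_labels\<close>, the stubs traversed up to step
  \<open>m\<close> have labels shorter than \<open>m\<close>.\<close>

lemma explore_cong:
  assumes "\<And>i. i \<in> labels \<Longrightarrow> length i < m \<Longrightarrow> u i = u' i \<and> w i = w' i"
  shows "explore d u w m = explore d u' w' m"
  using assms
proof (induction m)
  case (Suc m)
  have IH: "explore d u w m = explore d u' w' m"
    using Suc by simp
  show ?case
  proof (cases "m = 0")
    case True
    have "[] \<in> labels" by (simp add: labels_def)
    then show ?thesis using Suc.prems[of "[]"] True by simp
  next
    case False
    have "fold (traverse d u w) (sorted_list_of_set (A_set d u w m)) s
        = fold (traverse d u' w') (sorted_list_of_set (A_set d u w m)) s" for s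
      using A_set_labels[of d u w m] Suc.prems by (intro fold_traverse_cong) auto
    then show ?thesis using False IH by (simp add: explore_Suc A_set_def)
  qed
qed simp

lemma A_set_cong:
  assumes "\<And>i. i \<in> labels \<Longrightarrow> length i < m \<Longrightarrow> u i = u' i \<and> w i = w' i"
  shows "A_set d u w m = A_set d u' w' m"
  using explore_cong[OF assms] by (simp add: A_set_def)

lemma A_set_empty_Suc: "1 \<le> m \<Longrightarrow> A_set d u w m = {} \<Longrightarrow> A_set d u w (Suc m) = {}"
  by (simp add: A_set_def[of d u w "Suc m"] explore_Suc)

section \<open>Generations of the branching process\<close>

lemma finite_A_hat [simp]: "finite (A_hat g f u m)"
  by (induction m) auto

lemma A_hat_labels: "A_hat g f u m \<subseteq> {i \<in> labels. length i = m}"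
proof (induction m)
  case (Suc m)
  then show ?case using children_subset by (simp add: UN_subset_iff) blast
qed (simp add: labels_def)

lemma A_hat_cong:
  assumes "\<And>i. i \<in> labels \<Longrightarrow> length i < m \<Longrightarrow> u i = u' i"
  shows "A_hat g f u m = A_hat g f u' m"
  using assms
proof (induction m)
  case (Suc m)
  have "A_hat g f u m = A_hat g f u' m"
    using Suc by simp
  moreover have "chi_hat g f u i = chi_hat g f u' i" if "i \<in> A_hat g f u m" for i
    using that A_hat_labels[of g f u m] Suc.prems by (auto simp: chi_hat_def)
  ultimately show ?case by simp
qed simp

lemma Z_hat_Suc: "Z_hat g f u (Suc m) = (\<Sum>i \<in> A_hat g f u m. chi_hat g f u i)"
proof -
  have "disjnt (children i a) (children j b)" if "i \<noteq> j" for i j a b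
    using that by (auto simp: children_def disjnt_def)
  then have "card (\<Union>i \<in> A_hat g f u m. children i (chi_hat g f u i))
      = (\<Sum>i \<in> A_hat g f u m. card (children i (chi_hat g f u i)))"
    by (intro card_UN_disjoint) (auto simp: disjnt_def)
  then show ?thesis by (simp add: Z_hat_def)
qed

definition before ::
  "bidegree \<Rightarrow> (label \<Rightarrow> real) \<Rightarrow> (label \<Rightarrow> real) \<Rightarrow> nat \<Rightarrow> label \<Rightarrow> exploration" where
  "before d u w m i =
     state_before d u w (sorted_list_of_set (A_set d u w m)) ((explore d u w m)\<lparr>found := {}\<rparr>) i"

text \<open>Predictability of the state at the turn of \<open>i\<close>: the prefix cut off by
  \<open>takeWhile\<close> omits \<open>i\<close>, and the earlier generations have shorter
  labels.\<close>

lemma before_cong: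
  assumes "\<And>j. j \<in> labels \<Longrightarrow> length j \<le> m \<Longrightarrow> j \<noteq> i \<Longrightarrow> u j = u' j \<and> w j = w' j"
    and "length i = m"
  shows "before d u w m i = before d u' w' m i"
proof -
  have e: "explore d u w m = explore d u' w' m"
    using assms by (intro explore_cong) (metis less_imp_le less_irrefl)
  have "fold (traverse d u w) (takeWhile (\<lambda>j. j \<noteq> i) (sorted_list_of_set (A_set d u w m))) s
      = fold (traverse d u' w') (takeWhile (\<lambda>j. j \<noteq> i) (sorted_list_of_set (A_set d u w m))) s" for s
    using A_set_labels[of d u w m] assms
    by (intro fold_traverse_cong) (auto dest!: set_takeWhileD)
  then show ?thesis
    by (simp add: before_def state_before_def A_set_def e)
qed

text \<open>Holds almost surely on \<open>label_space\<close>. Outside it a quantile may be a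
  default value and a choice may be made from an empty set, so the recursions for the exploration
  are proved on this event.\<close>

definition open_unit :: "(label \<Rightarrow> real) \<Rightarrow> (label \<Rightarrow> real) \<Rightarrow> bool" where
  "open_unit u w \<longleftrightarrow> (\<forall>i \<in> labels. 0 < u i \<and> u i < 1 \<and> 0 < w i \<and> w i < 1)"

text \<open>The stubs of generation \<open>l\<close> are traversed in step \<open>l + 1\<close>, so
  this counts the stubs traversed once step \<open>m + 1\<close> is complete; choosing the root
  pairs no stub.\<close>

definition traversed :: "bidegree \<Rightarrow> (label \<Rightarrow> real) \<Rightarrow> (label \<Rightarrow> real) \<Rightarrow> nat \<Rightarrow> nat" where
  "traversed d u w m = (\<Sum>l\<in>{1..m}. card (A_set d u w l))"

lemma traversed_Suc: "traversed d u w (Suc m) = traversed d u w m + card (A_set d u w (Suc m))"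
  by (simp add: traversed_def)

lemma g_emp_eq_card: "g_emp d t = real (card {r. r < length d \<and> outdeg d r = t}) / real (length d)"
proof -
  have "(\<Sum>r<length d. of_bool (outdeg d r = t)) = real (card {r \<in> {..<length d}. outdeg d r = t})"
    using sum_of_bool_eq[of "{..<length d}" "\<lambda>_. 1" "\<lambda>r. outdeg d r = t"] by simp
  then show ?thesis by (simp add: g_emp_def)
qed

lemma mass_function_g_emp:
  assumes "d \<noteq> []"
  shows "mass_function (g_emp d)"
proof -
  let ?R = "{..<length d}"
  have "(\<Sum>t\<in>outdeg d ` ?R. g_emp d t) = (\<Sum>t\<in>outdeg d ` ?R. real (card {r \<in> ?R. outdeg d r = t})) / real (length d)"
    by (simp add: g_emp_eq_card sum_divide_distrib)
  also have "(\<Sum>t\<in>outdeg d ` ?R. real (card {r \<in> ?R. outdeg d r = t})) = real (length d)"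
    using sum.image_gen[of ?R "\<lambda>_. 1::real" "outdeg d"] by simp
  finally have "(\<Sum>t\<in>outdeg d ` ?R. g_emp d t) = 1" using assms by simp
  moreover have "g_emp d sums (\<Sum>t\<in>outdeg d ` ?R. g_emp d t)"
  proof (rule sums_finite)
    show "g_emp d t = 0" if "t \<notin> outdeg d ` ?R" for t
      using that by (auto simp: g_emp_eq_card)
  qed simp
  ultimately show ?thesis
    by (simp add: mass_function_def g_emp_eq_card)
qed

lemma consistent_explore:
  assumes "open_unit u w" "d \<noteq> []"
  shows "traversed d u w m \<le> stub_count d \<Longrightarrow>
    consistent d (explore d u w (Suc m)) \<and> card (paired (explore d u w (Suc m))) \<le> traversed d u w m"
proof (induction m)
  case 0
  let ?c = "quantile (g_emp d) (u [])"
  let ?S = "{r. r < length d \<and> outdeg d r = ?c}"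
  have "[] \<in> labels" by (simp add: labels_def)
  then have uw: "0 < u []" "u [] < 1" using assms by (auto simp: open_unit_def)
  \<comment> \<open>The drawn out-degree has positive frequency, so the root is a genuine
    node.\<close>
  have "0 < g_emp d ?c"
    by (rule quantile_mass_pos[OF mass_function_g_emp[OF assms(2)] uw])
  then have "?S \<noteq> {}" unfolding g_emp_eq_card by (metis card.empty divide_eq_0_iff of_nat_0 less_irrefl)
  then have "pick ?S (w []) \<in> ?S" unfolding pick_def by (rule from_nat_into)
  then show ?case
    by (auto simp: consistent_def explore_1_sel simp del: explore.simps)
next
  case (Suc m)
  let ?s = "explore d u w (Suc m)" and ?xs = "sorted_list_of_set (A_set d u w (Suc m))"
  have le: "traversed d u w m \<le> stub_count d"
    using Suc.prems by (simp add: traversed_Suc)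
  have IH: "consistent d (?s\<lparr>found := {}\<rparr>)" "card (paired (?s\<lparr>found := {}\<rparr>)) \<le> traversed d u w m"
    using Suc.IH[OF le] by (auto simp: consistent_def)
  have len: "length ?xs = card (A_set d u w (Suc m))" by simp
  have u: "\<And>i. i \<in> set ?xs \<Longrightarrow> 0 < u i \<and> u i < 1"
    using A_set_labels[of d u w "Suc m"] assms by (auto simp: open_unit_def)
  have ex: "explore d u w (Suc (Suc m)) = fold (traverse d u w) ?xs (?s\<lparr>found := {}\<rparr>)"
    by (rule explore_Suc) simp
  have "consistent d (fold (traverse d u w) ?xs (?s\<lparr>found := {}\<rparr>))"
    using IH Suc.prems u by (intro consistent_fold_traverse) (auto simp: len traversed_Suc)
  moreover have "card (paired (fold (traverse d u w) ?xs (?s\<lparr>found := {}\<rparr>))) \<le> traversed d u w (Suc m)"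
    using card_paired_fold_traverse[OF consistent_finite(1)[OF IH(1)], of d u w ?xs] IH(2)
    unfolding len traversed_Suc by linarith
  ultimately show ?case unfolding ex by simp
qed

lemma before_bounds:
  assumes "open_unit u w" "d \<noteq> []" "1 \<le> m" "traversed d u w m \<le> stub_count d"
    and i: "i \<in> A_set d u w m"
  shows "consistent d (before d u w m i)"
    and "card (paired (before d u w m i)) < traversed d u w m"
proof -
  obtain m' where m: "m = Suc m'" using assms(3) by (cases m) auto
  let ?s = "(explore d u w m)\<lparr>found := {}\<rparr>" and ?xs = "sorted_list_of_set (A_set d u w m)"
  have "traversed d u w m' \<le> stub_count d"
    using assms(4) unfolding m traversed_Suc by simp
  from consistent_explore[OF assms(1,2) this]
  have s: "consistent d ?s" "card (paired ?s) + length ?xs \<le> traversed d u w m"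
    unfolding m traversed_Suc by (auto simp: consistent_def)
  have u: "\<And>i. i \<in> set ?xs \<Longrightarrow> 0 < u i \<and> u i < 1"
    using A_set_labels[of d u w m] assms(1) by (auto simp: open_unit_def)
  have *: "card (paired ?s) + length ?xs \<le> stub_count d" "i \<in> set ?xs"
    using s(2) assms(4) i by auto
  show "consistent d (before d u w m i)"
    unfolding before_def by (rule state_before_bounds(1)[OF s(1) *(1) u *(2)])
  have "card (paired (before d u w m i)) < card (paired ?s) + length ?xs"
    unfolding before_def by (rule state_before_bounds(2)[OF s(1) *(1) u *(2)])
  then show "card (paired (before d u w m i)) < traversed d u w m"
    using s(2) by linarith
qed

text \<open>By \<open>new_stubs_eq\<close> the recursion is that of \<open>A_hat\<close> with
  \<open>chi\<close> in the place of \<open>chi_hat\<close>, so the generations can be compared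
  label by label. The bound on \<open>traversed\<close> keeps \<open>h_emp\<close> a mass function
  throughout the step.\<close>

lemma A_set_Suc:
  assumes "open_unit u w" "d \<noteq> []" "1 \<le> m" "traversed d u w m \<le> stub_count d"
  shows "A_set d u w (Suc m) = (\<Union>i \<in> A_set d u w m. children i (chi d u (before d u w m i) i))"
proof -
  let ?s = "(explore d u w m)\<lparr>found := {}\<rparr>" and ?xs = "sorted_list_of_set (A_set d u w m)"
  have "A_set d u w (Suc m) = (\<Union>i \<in> A_set d u w m.
      if fst (hit d u w (before d u w m i) i) \<in> active (before d u w m i)
        then {} else children i (chi d u (before d u w m i) i))"
    unfolding A_set_def[of d u w "Suc m"] explore_Suc[OF assms(3)] before_def
    by (subst found_fold_traverse) simp_all
  also have "\<dots> = (\<Union>i \<in> A_set d u w m. children i (chi d u (before d u w m i) i))"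
  proof (intro SUP_cong refl)
    fix i assume i: "i \<in> A_set d u w m"
    have "0 < u i" "u i < 1"
      using i A_set_labels[of d u w m] assms(1) by (auto simp: open_unit_def)
    then show "(if fst (hit d u w (before d u w m i) i) \<in> active (before d u w m i)
        then {} else children i (chi d u (before d u w m i) i)) = children i (chi d u (before d u w m i) i)"
      using before_bounds[OF assms i] assms(4) by (intro new_stubs_eq) auto
  qed
  finally show ?thesis .
qed

lemma active_explore_Suc:
  assumes "1 \<le> m"
  shows "active (explore d u w (Suc m))
    = active (explore d u w m) \<union> (\<lambda>i. fst (hit d u w (before d u w m i) i)) ` A_set d u w m"
  unfolding explore_Suc[OF assms] before_def by (subst active_fold_traverse) simp_all

lemma active_before_subset:
  "1 \<le> m \<Longrightarrow> active (before d u w m i) \<subseteq> active (explore d u w (Suc m))"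
  unfolding before_def explore_Suc by (rule active_state_before_mono)

text \<open>The symmetric difference covers both differences of the coupling event and satisfies a
  one-step recursion.\<close>

definition discrepancy ::
  "nat pmf \<Rightarrow> nat pmf \<Rightarrow> bidegree \<Rightarrow> (label \<Rightarrow> real) \<Rightarrow> (label \<Rightarrow> real) \<Rightarrow> nat \<Rightarrow> label set" where
  "discrepancy g f d u w m = sym_diff (A_set d u w m) (A_hat g f u m)"

lemma finite_discrepancy [simp]: "finite (discrepancy g f d u w m)"
  by (simp add: discrepancy_def)

text \<open>A new label in the symmetric difference either is a branching child of a parent already
  in it, or its parent is in \<open>A_set\<close> and the two offspring numbers differ. Parents in
  \<open>A_set\<close> alone also count with \<open>chi_hat\<close>, whose mean given the past is
  \<open>\<mu>\<close>; the deviation of their \<open>chi\<close> is charged to the error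
  sum.\<close>

lemma card_discrepancy_Suc:
  assumes "open_unit u w" "d \<noteq> []" "1 \<le> m" "traversed d u w m \<le> stub_count d"
  shows "real (card (discrepancy g f d u w (Suc m)))
    \<le> (\<Sum>i \<in> discrepancy g f d u w m. real (chi_hat g f u i))
      + (\<Sum>i \<in> A_set d u w m. \<bar>real (chi d u (before d u w m i) i) - real (chi_hat g f u i)\<bar>)"
proof -
  let ?c = "\<lambda>i. chi d u (before d u w m i) i" and ?h = "chi_hat g f u"
  let ?A = "A_set d u w m" and ?D = "discrepancy g f d u w m"
  let ?L = "\<Union>i \<in> ?D. children i (?h i)"
  let ?R = "\<Union>i \<in> ?A. sym_diff (children i (?c i)) (children i (?h i))"
  have "discrepancy g f d u w (Suc m) \<subseteq> ?L \<union> ?R"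
    unfolding discrepancy_def A_set_Suc[OF assms] A_hat.simps by blast
  then have "card (discrepancy g f d u w (Suc m)) \<le> card (?L \<union> ?R)"
    by (intro card_mono) auto
  also have "\<dots> \<le> card ?L + card ?R" by (rule card_Un_le)
  also have "card ?L \<le> (\<Sum>i\<in>?D. card (children i (?h i)))" by (rule card_UN_le) simp
  also have "card ?R \<le> (\<Sum>i\<in>?A. card (sym_diff (children i (?c i)) (children i (?h i))))"
    by (rule card_UN_le) simp
  finally have "real (card (discrepancy g f d u w (Suc m))) \<le>
      (\<Sum>i\<in>?D. real (?h i)) + (\<Sum>i\<in>?A. real (card (sym_diff (children i (?c i)) (children i (?h i)))))"
    by (simp flip: of_nat_sum of_nat_add)
  also have "(\<Sum>i\<in>?A. real (card (sym_diff (children i (?c i)) (children i (?h i)))))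
      \<le> (\<Sum>i\<in>?A. \<bar>real (?c i) - real (?h i)\<bar>)"
    by (intro sum_mono card_children_sym_diff_real)
  finally show ?thesis by simp
qed

lemma card_discrepancy_1:
  "real (card (discrepancy g f d u w (Suc 0)))
     \<le> \<bar>real (quantile (g_emp d) (u [])) - real (quantile (pmf g) (u []))\<bar>"
  unfolding discrepancy_def explore_1_sel
  using card_children_sym_diff_real by (simp add: chi_hat_def)

section \<open>Distance between the step distribution and its limit\<close>

definition degree_product :: "bidegree \<Rightarrow> real" where
  "degree_product d = (\<Sum>r<length d. real (outdeg d r) * real (indeg d r))"

text \<open>Divided by \<open>L\<close>, this is the share of the nodes in \<open>a\<close> in the
  mean of \<open>f_emp d\<close>.\<close>

definition active_product :: "bidegree \<Rightarrow> nat set \<Rightarrow> real" where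
  "active_product d a = (\<Sum>r<length d. real (outdeg d r) * real (indeg d r) * of_bool (r \<in> a))"

lemma suminf_of_bool_less:
  "(\<Sum>k. ennreal (c * of_bool (k < (x::nat)))) = ennreal (c * real x)" if "0 \<le> c"
proof -
  have "(\<Sum>k. ennreal (c * of_bool (k < x))) = (\<Sum>k<x. ennreal (c * of_bool (k < x)))"
    by (intro suminf_finite) auto
  also have "\<dots> = (\<Sum>k<x. ennreal c)" by (intro sum.cong) auto
  also have "\<dots> = ennreal (c * real x)"
    using that by (simp add: ennreal_of_nat_eq_real_of_nat ennreal_mult' mult.commute)
  finally show ?thesis .
qed

lemma sum_le_outdeg:
  "(\<Sum>t\<le>k. \<Sum>r<n. of_bool (outdeg d r = t) * x r) = (\<Sum>r<n. x r * of_bool (outdeg d r \<le> k))" for x :: "nat \<Rightarrow> real"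
proof -
  have "(\<Sum>t\<le>k. of_bool (outdeg d r = t) * x r) = x r * of_bool (outdeg d r \<le> k)" for r
  proof -
    have "(\<Sum>t\<le>k. of_bool (outdeg d r = t) * x r) = (\<Sum>t\<le>k. if t = outdeg d r then x r else 0)"
      by (intro sum.cong) auto
    then show ?thesis by (simp add: sum.delta)
  qed
  then show ?thesis by (subst sum.swap) (simp only:)
qed

text \<open>Compare tails: \<open>f_emp\<close> puts weight \<open>1 / L\<close> on each inbound
  stub and \<open>h_emp\<close> weight \<open>1 / (L - T)\<close>, the latter only at inactive
  nodes. The extra mass at \<open>t = 0\<close> is invisible in the tails. Summing the tail
  difference of a node over \<open>k\<close> produces its out-degree.\<close>

lemma cdf_dist_h_f:
  assumes T: "real (card (paired s)) = T" and L: "real (stub_count d) = L" and "T < L"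
  shows "cdf_dist (h_emp d s) (f_emp d)
    \<le> ennreal (active_product d (active s) / L + T / (L * (L - T)) * degree_product d)"
proof -
  define y where "y r = real (indeg d r)" for r
  define I where "I r = (of_bool (r \<notin> active s) :: real)" for r
  define J where "J r = (of_bool (r \<in> active s) :: real)" for r
  define q where "q k r = (of_bool (k < outdeg d r) :: real)" for k r
  let ?n = "length d"
  have T0: "0 \<le> T" using T by simp
  have L0: "0 < L" "0 < L - T" using T0 \<open>T < L\<close> by auto
  have sL: "(\<Sum>r<?n. y r) = L"
    by (simp add: y_def L[symmetric] stub_count_def)
  have H: "(\<Sum>t\<le>k. h_emp d s t) = 1 - (\<Sum>r<?n. y r * I r * q k r) / (L - T)" for k
  proof -
    have "(\<Sum>t\<le>k. h_emp d s t) = ((\<Sum>t\<le>k. \<Sum>r<?n. of_bool (outdeg d r = t) * (y r * I r))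
        + (\<Sum>t\<le>k. of_bool (t = 0) * active_unpaired d s)) / (L - T)"
      unfolding h_emp_def T L by (simp add: sum_divide_distrib[symmetric] sum.distrib y_def I_def mult.assoc)
    also have "(\<Sum>t\<le>k. of_bool (t = 0) * active_unpaired d s) = active_unpaired d s"
      by (simp add: of_bool_def if_distrib[of "\<lambda>z. z * _"] sum.delta cong: if_cong)
    also have "active_unpaired d s = L - (\<Sum>r<?n. y r * I r) - T"
      by (simp add: active_unpaired_def T L y_def I_def)
    also have "(\<Sum>t\<le>k. \<Sum>r<?n. of_bool (outdeg d r = t) * (y r * I r)) = (\<Sum>r<?n. y r * I r * of_bool (outdeg d r \<le> k))"
      by (rule sum_le_outdeg)
    also have "\<dots> = (\<Sum>r<?n. y r * I r) - (\<Sum>r<?n. y r * I r * q k r)"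
      unfolding sum_subtractf[symmetric] by (intro sum.cong) (auto simp: q_def)
    finally show ?thesis using L0 by (simp add: field_simps)
  qed
  have F: "(\<Sum>t\<le>k. f_emp d t) = 1 - (\<Sum>r<?n. y r * q k r) / L" for k
  proof -
    have "(\<Sum>t\<le>k. f_emp d t) = (\<Sum>t\<le>k. \<Sum>r<?n. of_bool (outdeg d r = t) * y r) / L"
      unfolding f_emp_def L by (simp add: sum_divide_distrib[symmetric] y_def)
    also have "(\<Sum>t\<le>k. \<Sum>r<?n. of_bool (outdeg d r = t) * y r) = (\<Sum>r<?n. y r * of_bool (outdeg d r \<le> k))"
      by (rule sum_le_outdeg)
    also have "\<dots> = (\<Sum>r<?n. y r) - (\<Sum>r<?n. y r * q k r)"
      unfolding sum_subtractf[symmetric] by (intro sum.cong) (auto simp: q_def)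
    finally show ?thesis using L0 by (simp add: sL field_simps)
  qed
  \<comment> \<open>An active node loses its whole weight, an inactive one changes by
    \<open>1 / (L - T) - 1 / L = T / (L * (L - T))\<close>; \<open>c r\<close> covers both
    cases.\<close>
  define c where "c r = y r * J r / L + T / (L * (L - T)) * y r" for r
  have c0: "0 \<le> c r" for r
    using T0 L0 by (auto simp: c_def y_def J_def)
  have bnd: "\<bar>\<Sum>i\<le>k. h_emp d s i - f_emp d i\<bar> \<le> (\<Sum>r<?n. c r * q k r)" for k
  proof -
    have "(\<Sum>i\<le>k. h_emp d s i - f_emp d i) = (\<Sum>r<?n. y r * q k r / L - y r * I r * q k r / (L - T))"
      by (simp add: sum_subtractf H F sum_divide_distrib)
    also have "\<bar>\<dots>\<bar> \<le> (\<Sum>r<?n. \<bar>y r * q k r / L - y r * I r * q k r / (L - T)\<bar>)"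
      by (rule sum_abs)
    also have "\<dots> \<le> (\<Sum>r<?n. c r * q k r)"
    proof (rule sum_mono)
      fix r
      have yq: "0 \<le> y r" "0 \<le> q k r" by (simp_all add: y_def q_def)
      have e: "1 / (L - T) - 1 / L = T / (L * (L - T))"
        using L0 by (simp add: field_simps)
      show "\<bar>y r * q k r / L - y r * I r * q k r / (L - T)\<bar> \<le> c r * q k r"
      proof (cases "r \<in> active s")
        case True
        have "0 \<le> T / (L * (L - T)) * y r * q k r" using yq T0 L0 by simp
        then show ?thesis using True yq L0 by (simp add: I_def J_def c_def algebra_simps)
      next
        case False
        have "y r * q k r / L - y r * q k r / (L - T) = - (y r * q k r * (1 / (L - T) - 1 / L))"
          by (simp add: algebra_simps)
        also have "\<bar>\<dots>\<bar> = T / (L * (L - T)) * y r * q k r"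
          unfolding e using yq T0 L0 by (simp add: abs_mult)
        finally show ?thesis using False by (simp add: I_def J_def c_def)
      qed
    qed
    finally show ?thesis .
  qed
  have "cdf_dist (h_emp d s) (f_emp d) \<le> (\<Sum>k. ennreal (\<Sum>r<?n. c r * q k r))"
    unfolding cdf_dist_def using bnd by (intro suminf_le ennreal_leI) auto
  also have "\<dots> = (\<Sum>k. \<Sum>r<?n. ennreal (c r * q k r))"
    using c0 by (subst sum_ennreal) (auto simp: q_def)
  also have "\<dots> = (\<Sum>r<?n. \<Sum>k. ennreal (c r * q k r))"
    by (rule suminf_sum) auto
  also have "\<dots> = (\<Sum>r<?n. ennreal (c r * real (outdeg d r)))"
    unfolding q_def by (intro sum.cong refl suminf_of_bool_less c0)
  also have "\<dots> = ennreal (\<Sum>r<?n. c r * real (outdeg d r))"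
    using c0 by (intro sum_ennreal) auto
  also have "(\<Sum>r<?n. c r * real (outdeg d r))
      = active_product d (active s) / L + T / (L * (L - T)) * degree_product d"
    unfolding active_product_def degree_product_def c_def y_def J_def
    by (simp add: sum_divide_distrib sum_distrib_left sum.distrib[symmetric] algebra_simps)
  finally show ?thesis .
qed

section \<open>Countably valued random variables\<close>

text \<open>Sets of labels and exploration states form uncountable types with the discrete
  \<sigma>-algebra, where measurable maps do not combine well. Countable range restores this: any
  function of two such variables is again of this kind.\<close>

definition discrete_rv :: "'a measure \<Rightarrow> ('a \<Rightarrow> 'b) \<Rightarrow> bool" where
  "discrete_rv M f \<longleftrightarrow> countable (f ` space M) \<and> f \<in> M \<rightarrow>\<^sub>M count_space UNIV"

lemma discrete_rv_const: "discrete_rv M (\<lambda>x. c)"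
proof -
  have "countable ((\<lambda>x. c) ` space M)"
    by (rule countable_subset[of _ "{c}"]) auto
  then show ?thesis by (simp add: discrete_rv_def)
qed

lemma discrete_rv_countable:
  fixes f :: "'a \<Rightarrow> 'b :: countable"
  shows "f \<in> M \<rightarrow>\<^sub>M count_space UNIV \<Longrightarrow> discrete_rv M f"
  by (simp add: discrete_rv_def)

lemma discrete_rv_range:
  "discrete_rv M g \<Longrightarrow> g \<in> M \<rightarrow>\<^sub>M count_space (g ` space M)"
  unfolding discrete_rv_def by (rule measurable_count_space_extend[where B=UNIV]) auto

text \<open>Splitting the space into the countably many level sets of \<open>g\<close> lets a random
  parameter be treated as a constant one.\<close>

lemma measurable_discrete_bind:
  assumes g: "discrete_rv M g" and f: "\<And>a. a \<in> g ` space M \<Longrightarrow> (\<lambda>x. f a x) \<in> M \<rightarrow>\<^sub>M N"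
  shows "(\<lambda>x. f (g x) x) \<in> M \<rightarrow>\<^sub>M N"
proof (rule measurable_compose_countable'[OF f discrete_rv_range[OF g]])
  show "countable (g ` space M)" using g by (simp add: discrete_rv_def)
qed

lemma discrete_rv_bind:
  assumes g: "discrete_rv M g" and f: "\<And>a. a \<in> g ` space M \<Longrightarrow> discrete_rv M (\<lambda>x. f a x)"
  shows "discrete_rv M (\<lambda>x. f (g x) x)"
  unfolding discrete_rv_def
proof
  have "(\<lambda>x. f (g x) x) ` space M \<subseteq> (\<Union>a \<in> g ` space M. f a ` space M)" by auto
  moreover have "countable (\<Union>a \<in> g ` space M. f a ` space M)"
    using g f by (intro countable_UN) (auto simp: discrete_rv_def)
  ultimately show "countable ((\<lambda>x. f (g x) x) ` space M)"
    by (rule countable_subset)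
  show "(\<lambda>x. f (g x) x) \<in> M \<rightarrow>\<^sub>M count_space UNIV"
    by (rule measurable_discrete_bind[OF g]) (use f in \<open>simp add: discrete_rv_def\<close>)
qed

lemma discrete_rv_comp: "discrete_rv M f \<Longrightarrow> discrete_rv M (\<lambda>x. h (f x))"
  by (rule discrete_rv_bind[where f="\<lambda>a x. h a"]) (auto intro: discrete_rv_const)

lemma discrete_rv_comp2:
  "discrete_rv M f \<Longrightarrow> discrete_rv M g \<Longrightarrow> discrete_rv M (\<lambda>x. h (f x) (g x))"
  by (rule discrete_rv_bind[where f="\<lambda>a x. h a (g x)"]) (auto intro: discrete_rv_comp)

lemma borel_measurable_discrete_rv:
  "discrete_rv M f \<Longrightarrow> (\<lambda>x. h (f x)) \<in> M \<rightarrow>\<^sub>M N" if "\<And>a. h a \<in> space N"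
  by (rule measurable_compose[of f M "count_space UNIV"])
     (use that in \<open>auto simp: discrete_rv_def\<close>)

lemma measurable_discrete_ennreal: "discrete_rv M (f :: _ \<Rightarrow> ennreal) \<Longrightarrow> f \<in> borel_measurable M"
  using borel_measurable_discrete_rv[of "\<lambda>x. x" borel M f] by simp

lemma pred_discrete_rv: "discrete_rv M P \<Longrightarrow> Measurable.pred M P"
  by (simp add: discrete_rv_def)

lemma discrete_rv_fold_list:
  assumes "\<And>i s. i \<in> set xs \<Longrightarrow> discrete_rv M (\<lambda>x. F x i s)"
  shows "discrete_rv M (\<lambda>x. fold (F x) xs s)"
  using assms
proof (induction xs arbitrary: s)
  case (Cons i xs)
  show ?case
    unfolding fold_simps
    using Cons by (intro discrete_rv_bind[where f="\<lambda>t x. fold (F x) xs t" and g="\<lambda>x. F x i s"]) auto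
qed (simp add: discrete_rv_const)

lemma discrete_rv_UN:
  assumes "finite A" "\<And>i. i \<in> A \<Longrightarrow> discrete_rv M (F i)"
  shows "discrete_rv M (\<lambda>x. \<Union>i\<in>A. F i x)"
  using assms
proof (induction A rule: finite_induct)
  case (insert i A)
  then show ?case by (simp, intro discrete_rv_comp2[where h="(\<union>)"]) auto
qed (simp add: discrete_rv_const)

lemma measurable_random_sum:
  fixes f :: "'i \<Rightarrow> 'a \<Rightarrow> ennreal"
  assumes A: "discrete_rv M A" "\<And>x. x \<in> space M \<Longrightarrow> A x \<subseteq> I"
    and f: "\<And>i. i \<in> I \<Longrightarrow> f i \<in> borel_measurable M"
  shows "(\<lambda>x. \<Sum>i\<in>A x. f i x) \<in> borel_measurable M"
  by (rule measurable_discrete_bind[OF A(1)], rule borel_measurable_sum) (use A f in blast)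

text \<open>Tonelli for the counting measure on \<open>I\<close>. It replaces conditioning on the
  random set by one integral per fixed index, where coordinates can be resampled.\<close>

lemma nn_integral_random_sum:
  fixes f :: "'i \<Rightarrow> 'a \<Rightarrow> ennreal"
  assumes A: "discrete_rv M A" "\<And>x. x \<in> space M \<Longrightarrow> finite (A x) \<and> A x \<subseteq> I"
    and f: "\<And>i. i \<in> I \<Longrightarrow> f i \<in> borel_measurable M" and I: "countable I"
  shows "(\<integral>\<^sup>+x. (\<Sum>i\<in>A x. f i x) \<partial>M) = (\<integral>\<^sup>+i. (\<integral>\<^sup>+x. indicator (A x) i * f i x \<partial>M) \<partial>count_space I)"
proof -
  have meas: "(\<lambda>x. indicator (A x) i * f i x) \<in> borel_measurable M" if "i \<in> I" for i
  proof -
    have "(\<lambda>x. indicator (A x) i :: ennreal) \<in> borel_measurable M"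
      by (rule measurable_discrete_ennreal) (rule discrete_rv_comp[OF A(1)])
    then show ?thesis using f[OF that] by simp
  qed
  have "(\<Sum>i\<in>A x. f i x) = (\<integral>\<^sup>+i. indicator (A x) i * f i x \<partial>count_space I)" if "x \<in> space M" for x
  proof -
    have "(\<Sum>i\<in>A x. f i x) = (\<integral>\<^sup>+i. f i x \<partial>count_space (A x))"
      using A(2)[OF that] by (simp add: nn_integral_count_space_finite)
    also have "\<dots> = (\<integral>\<^sup>+i. indicator (A x) i * f i x \<partial>count_space (A x))"
      by (intro nn_integral_cong) auto
    also have "\<dots> = (\<integral>\<^sup>+i. indicator (A x) i * f i x \<partial>count_space I)"
      using A(2)[OF that] by (intro nn_integral_count_space_eq) auto
    finally show ?thesis .
  qed
  then have "(\<integral>\<^sup>+x. (\<Sum>i\<in>A x. f i x) \<partial>M) = (\<integral>\<^sup>+x. (\<integral>\<^sup>+i. indicator (A x) i * f i x \<partial>count_space I) \<partial>M)"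
    by (intro nn_integral_cong) auto
  also have "\<dots> = (\<integral>\<^sup>+i. (\<integral>\<^sup>+x. indicator (A x) i * f i x \<partial>M) \<partial>count_space I)"
    using I meas by (rule nn_integral_count_space_nn_integral)
  finally show ?thesis .
qed

section \<open>The space of uniform variables\<close>

text \<open>Law of the driving variables: at the label \<open>i\<close>, coordinate
  \<open>Inl i\<close> plays the role of \<open>U\<close> and \<open>Inr i\<close> that of
  \<open>W\<close>.\<close>

definition label_space :: "(label + label \<Rightarrow> real) measure" where
  "label_space = Pi\<^sub>M (labels <+> labels) (\<lambda>_. unif)"

interpretation P: prob_space label_space
  unfolding label_space_def by (rule prob_space_PiM) (rule prob_space_unif)

lemma space_label_space: "space label_space = (labels <+> labels) \<rightarrow>\<^sub>E UNIV"
  by (simp add: label_space_def space_PiM)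

lemma measurable_coord:
  "i \<in> labels \<Longrightarrow> (\<lambda>X. X (Inl i)) \<in> borel_measurable label_space"
  "i \<in> labels \<Longrightarrow> (\<lambda>X. X (Inr i)) \<in> borel_measurable label_space"
proof -
  have "(\<lambda>X. X z) \<in> borel_measurable label_space" if "z \<in> labels <+> labels" for z
    using measurable_component_singleton[OF that, of "\<lambda>_. unif"]
    unfolding label_space_def by (simp only: measurable_cong_sets[OF refl sets_unif])
  then show "i \<in> labels \<Longrightarrow> (\<lambda>X. X (Inl i)) \<in> borel_measurable label_space"
    "i \<in> labels \<Longrightarrow> (\<lambda>X. X (Inr i)) \<in> borel_measurable label_space" by blast+
qed

lemma measurable_upd:
  assumes "z \<in> labels <+> labels"
  shows "(\<lambda>(x, X). X(z := x)) \<in> unif \<Otimes>\<^sub>M label_space \<rightarrow>\<^sub>M label_space"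
proof -
  have "(\<lambda>(X, x). X(z := x)) \<in> label_space \<Otimes>\<^sub>M unif \<rightarrow>\<^sub>M label_space"
    using measurable_add_dim[of z "labels <+> labels" "\<lambda>_. unif"] assms
    by (simp add: label_space_def insert_absorb)
  then show ?thesis
    by (subst measurable_pair_swap_iff) (simp add: case_prod_beta')
qed

text \<open>Overwriting a coordinate by an independent uniform variable preserves the product law.
  This is the fact about adjoining a coordinate to a product, applied to a coordinate already
  present; it stands in for conditional expectations throughout.\<close>

lemma nn_integral_resample:
  assumes z: "z \<in> labels <+> labels" and f: "f \<in> borel_measurable label_space"
  shows "(\<integral>\<^sup>+X. f X \<partial>label_space) = (\<integral>\<^sup>+X. (\<integral>\<^sup>+x. f (X(z := x)) \<partial>unif) \<partial>label_space)"
    and "(\<lambda>X. \<integral>\<^sup>+x. f (X(z := x)) \<partial>unif) \<in> borel_measurable label_space"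
proof -
  interpret pair_sigma_finite unif label_space
    by unfold_locales
  have "distr (unif \<Otimes>\<^sub>M label_space) label_space (\<lambda>(x, X). X(z := x)) = label_space"
    using distr_pair_PiM_eq_PiM[of "labels <+> labels" "\<lambda>_. unif" z] z prob_space_unif
    by (simp add: label_space_def insert_absorb)
  then have "(\<integral>\<^sup>+X. f X \<partial>label_space) = (\<integral>\<^sup>+X. f X \<partial>distr (unif \<Otimes>\<^sub>M label_space) label_space (\<lambda>(x, X). X(z := x)))"
    by simp
  also have "\<dots> = (\<integral>\<^sup>+p. f ((\<lambda>(x, X). X(z := x)) p) \<partial>(unif \<Otimes>\<^sub>M label_space))"
    by (rule nn_integral_distr[OF measurable_upd[OF z]]) (use f in simp)
  also have "\<dots> = (\<integral>\<^sup>+X. (\<integral>\<^sup>+x. f ((\<lambda>(x, X). X(z := x)) (x, X)) \<partial>unif) \<partial>label_space)"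
    by (rule nn_integral_snd[symmetric]) (rule measurable_compose[OF measurable_upd[OF z] f])
  finally show "(\<integral>\<^sup>+X. f X \<partial>label_space) = (\<integral>\<^sup>+X. (\<integral>\<^sup>+x. f (X(z := x)) \<partial>unif) \<partial>label_space)"
    by simp
  have "(\<lambda>(X, x). f (X(z := x))) \<in> borel_measurable (label_space \<Otimes>\<^sub>M unif)"
    using measurable_compose[OF measurable_upd[OF z] f]
    by (subst measurable_pair_swap_iff) (simp add: case_prod_beta')
  then show "(\<lambda>X. \<integral>\<^sup>+x. f (X(z := x)) \<partial>unif) \<in> borel_measurable label_space"
    by (rule unif.borel_measurable_nn_integral)
qed

lemma nn_integral_resample2:
  assumes i: "i \<in> labels" and f: "f \<in> borel_measurable label_space"
  shows "(\<integral>\<^sup>+X. f X \<partial>label_space)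
    = (\<integral>\<^sup>+X. (\<integral>\<^sup>+u. \<integral>\<^sup>+w. f (X(Inl i := u, Inr i := w)) \<partial>unif \<partial>unif) \<partial>label_space)"
proof -
  have z: "Inl i \<in> labels <+> labels" "Inr i \<in> labels <+> labels" using i by auto
  show ?thesis
    by (subst nn_integral_resample(1)[OF z(2) f])
       (rule nn_integral_resample(1)[OF z(1) nn_integral_resample(2)[OF z(2) f]])
qed

text \<open>If membership of \<open>i\<close> in the random set \<open>A\<close> does not depend on the variables at \<open>i\<close>, these may
  be integrated out first.\<close>

lemma nn_integral_random_sum_le:
  fixes f h :: "label \<Rightarrow> (label + label \<Rightarrow> real) \<Rightarrow> ennreal"
  assumes A: "discrete_rv label_space A" "\<And>X. X \<in> space label_space \<Longrightarrow> finite (A X) \<and> A X \<subseteq> labels"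
    and f: "\<And>i. i \<in> labels \<Longrightarrow> f i \<in> borel_measurable label_space"
    and h: "\<And>i. i \<in> labels \<Longrightarrow> h i \<in> borel_measurable label_space"
    and upd: "\<And>X i u w. X \<in> space label_space \<Longrightarrow> i \<in> labels \<Longrightarrow>
      i \<in> A (X(Inl i := u, Inr i := w)) \<longleftrightarrow> i \<in> A X"
    and le: "AE X in label_space. \<forall>i \<in> A X.
      (\<integral>\<^sup>+u. \<integral>\<^sup>+w. f i (X(Inl i := u, Inr i := w)) \<partial>unif \<partial>unif) \<le> h i X"
  shows "(\<integral>\<^sup>+X. (\<Sum>i\<in>A X. f i X) \<partial>label_space) \<le> (\<integral>\<^sup>+X. (\<Sum>i\<in>A X. h i X) \<partial>label_space)"
proof -
  have cl: "countable labels" by simp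
  have meas: "(\<lambda>X. indicator (A X) i * f i X) \<in> borel_measurable label_space" if "i \<in> labels" for i
  proof -
    have "(\<lambda>X. indicator (A X) i :: ennreal) \<in> borel_measurable label_space"
      by (rule measurable_discrete_ennreal) (rule discrete_rv_comp[OF A(1)])
    then show ?thesis using f[OF that] by simp
  qed
  have "(\<integral>\<^sup>+X. (\<Sum>i\<in>A X. f i X) \<partial>label_space)
      = (\<integral>\<^sup>+i. (\<integral>\<^sup>+X. indicator (A X) i * f i X \<partial>label_space) \<partial>count_space labels)"
    by (rule nn_integral_random_sum[OF A f cl])
  also have "\<dots> \<le> (\<integral>\<^sup>+i. (\<integral>\<^sup>+X. indicator (A X) i * h i X \<partial>label_space) \<partial>count_space labels)"
  proof (rule nn_integral_mono)
    fix i assume "i \<in> space (count_space labels)"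
    then have i: "i \<in> labels" by simp
    have "(\<integral>\<^sup>+X. indicator (A X) i * f i X \<partial>label_space) = (\<integral>\<^sup>+X. (\<integral>\<^sup>+u. \<integral>\<^sup>+w.
        indicator (A (X(Inl i := u, Inr i := w))) i * f i (X(Inl i := u, Inr i := w)) \<partial>unif \<partial>unif) \<partial>label_space)"
      by (rule nn_integral_resample2[OF i meas[OF i]])
    also have "\<dots> \<le> (\<integral>\<^sup>+X. indicator (A X) i * h i X \<partial>label_space)"
    proof (rule nn_integral_mono_AE)
      show "AE X in label_space. (\<integral>\<^sup>+u. \<integral>\<^sup>+w.
          indicator (A (X(Inl i := u, Inr i := w))) i * f i (X(Inl i := u, Inr i := w)) \<partial>unif \<partial>unif)
          \<le> indicator (A X) i * h i X"
        using le AE_space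
      proof eventually_elim
        case (elim X)
        have "indicator (A (X(Inl i := u, Inr i := w))) i = (indicator (A X) i :: ennreal)" for u w
          using upd[OF elim(2) i] by (simp add: indicator_def)
        then show ?case using elim(1) by (cases "i \<in> A X") simp_all
      qed
    qed
    finally show "(\<integral>\<^sup>+X. indicator (A X) i * f i X \<partial>label_space) \<le> (\<integral>\<^sup>+X. indicator (A X) i * h i X \<partial>label_space)" .
  qed
  also have "\<dots> = (\<integral>\<^sup>+X. (\<Sum>i\<in>A X. h i X) \<partial>label_space)"
    by (rule nn_integral_random_sum[OF A h cl, symmetric])
  finally show ?thesis .
qed

text \<open>The coordinates in \<open>b\<close> are integrated out one after the other; the
  invariance of \<open>g\<close> lets it pass through each of these integrals.\<close>

lemma nn_integral_indep_prod:
  fixes \<psi> :: "real \<Rightarrow> ennreal"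
  assumes "finite b" "b \<subseteq> labels" and \<psi>: "\<psi> \<in> borel_measurable borel"
    and g: "g \<in> borel_measurable label_space"
    and inv: "\<And>X i x. X \<in> space label_space \<Longrightarrow> i \<in> b \<Longrightarrow> g (X(Inl i := x)) = g X"
  shows "(\<integral>\<^sup>+X. g X * (\<Prod>i\<in>b. \<psi> (X (Inl i))) \<partial>label_space)
    = (\<integral>\<^sup>+x. \<psi> x \<partial>unif) ^ card b * (\<integral>\<^sup>+X. g X \<partial>label_space)"
  using assms(1,2) inv
proof (induction b rule: finite_induct)
  case (insert i b)
  have z: "Inl i \<in> labels <+> labels" using insert by auto
  have m: "(\<lambda>X. \<psi> (X (Inl j))) \<in> borel_measurable label_space" if "j \<in> labels" for j
    by (rule measurable_compose[OF measurable_coord(1)[OF that] \<psi>])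
  have mp: "(\<lambda>X. g X * (\<Prod>j\<in>b. \<psi> (X (Inl j)))) \<in> borel_measurable label_space"
    by (intro borel_measurable_times_ennreal borel_measurable_prod_ennreal g m) (use insert.prems in auto)
  have mi: "(\<lambda>X. g X * (\<Prod>j\<in>insert i b. \<psi> (X (Inl j)))) \<in> borel_measurable label_space"
    by (intro borel_measurable_times_ennreal borel_measurable_prod_ennreal g m) (use insert.prems in auto)
  have \<psi>': "\<psi> \<in> borel_measurable unif" using \<psi> by (simp cong: measurable_cong_sets add: sets_unif)
  have "(\<integral>\<^sup>+X. g X * (\<Prod>j\<in>insert i b. \<psi> (X (Inl j))) \<partial>label_space)
      = (\<integral>\<^sup>+X. (\<integral>\<^sup>+x. g (X(Inl i := x)) * (\<Prod>j\<in>insert i b. \<psi> ((X(Inl i := x)) (Inl j))) \<partial>unif) \<partial>label_space)"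
    by (rule nn_integral_resample(1)[OF z mi])
  also have "\<dots> = (\<integral>\<^sup>+X. (\<integral>\<^sup>+x. \<psi> x \<partial>unif) * (g X * (\<Prod>j\<in>b. \<psi> (X (Inl j)))) \<partial>label_space)"
  proof (rule nn_integral_cong)
    fix X assume X: "X \<in> space label_space"
    have "g (X(Inl i := x)) * (\<Prod>j\<in>insert i b. \<psi> ((X(Inl i := x)) (Inl j)))
        = \<psi> x * (g X * (\<Prod>j\<in>b. \<psi> (X (Inl j))))" for x
    proof -
      have "(\<Prod>j\<in>b. \<psi> ((X(Inl i := x)) (Inl j))) = (\<Prod>j\<in>b. \<psi> (X (Inl j)))"
        using insert.hyps by (intro prod.cong) auto
      then show ?thesis
        unfolding insert.prems(2)[OF X insertI1] prod.insert[OF insert.hyps] fun_upd_same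
        by (simp only: mult_ac)
    qed
    then show "(\<integral>\<^sup>+x. g (X(Inl i := x)) * (\<Prod>j\<in>insert i b. \<psi> ((X(Inl i := x)) (Inl j))) \<partial>unif)
        = (\<integral>\<^sup>+x. \<psi> x \<partial>unif) * (g X * (\<Prod>j\<in>b. \<psi> (X (Inl j))))"
      using \<psi>' by (simp add: nn_integral_multc)
  qed
  also have "\<dots> = (\<integral>\<^sup>+x. \<psi> x \<partial>unif) * (\<integral>\<^sup>+X. g X * (\<Prod>j\<in>b. \<psi> (X (Inl j))) \<partial>label_space)"
    by (rule nn_integral_cmult[OF mp])
  also have "\<dots> = (\<integral>\<^sup>+x. \<psi> x \<partial>unif) ^ card (insert i b) * (\<integral>\<^sup>+X. g X \<partial>label_space)"
    using insert by (simp add: mult.assoc)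
  finally show ?case .
qed simp

lemma AE_open_unit: "AE X in label_space. open_unit (X \<circ> Inl) (X \<circ> Inr)"
proof -
  have "AE X in label_space. \<forall>z \<in> labels <+> labels. 0 < X z \<and> X z < 1"
    unfolding label_space_def
  proof (rule iffD2[OF AE_ball_countable], simp, rule ballI)
    show "AE X in Pi\<^sub>M (labels <+> labels) (\<lambda>_. unif). 0 < X z \<and> X z < 1" if "z \<in> labels <+> labels" for z
      by (rule AE_PiM_component[OF _ that AE_unif]) (rule prob_space_unif)
  qed
  then show ?thesis
    by (rule eventually_mono) (auto simp: open_unit_def)
qed

section \<open>Measurability of the coupling\<close>

abbreviation expl :: "bidegree \<Rightarrow> (label + label \<Rightarrow> real) \<Rightarrow> nat \<Rightarrow> exploration" where
  "expl d X \<equiv> explore d (X \<circ> Inl) (X \<circ> Inr)"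

lemma discrete_quantile: "i \<in> labels \<Longrightarrow> discrete_rv label_space (\<lambda>X. quantile p (X (Inl i)))"
  by (intro discrete_rv_countable measurable_compose[OF measurable_coord(1) measurable_quantile])

lemma discrete_chi: "i \<in> labels \<Longrightarrow> discrete_rv label_space (\<lambda>X. chi d (X \<circ> Inl) s i)"
  unfolding chi_def o_def by (rule discrete_quantile)

lemma discrete_chi_hat: "i \<in> labels \<Longrightarrow> discrete_rv label_space (\<lambda>X. chi_hat g f (X \<circ> Inl) i)"
  unfolding chi_hat_def o_def by (rule discrete_quantile)

lemma discrete_pick: "i \<in> labels \<Longrightarrow> discrete_rv label_space (\<lambda>X. pick S (X (Inr i)))"
  for S :: "'b :: countable set"
  by (intro discrete_rv_countable measurable_compose[OF measurable_coord(2) measurable_pick])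

lemma discrete_hit: "i \<in> labels \<Longrightarrow> discrete_rv label_space (\<lambda>X. hit d (X \<circ> Inl) (X \<circ> Inr) s i)"
  unfolding hit_def o_def
  by (rule discrete_rv_bind[where f="\<lambda>c X. pick (candidates d s c) (X (Inr i))"])
     (auto intro: discrete_chi[unfolded o_def] discrete_pick)

lemma discrete_traverse:
  assumes "i \<in> labels"
  shows "discrete_rv label_space (\<lambda>X. traverse d (X \<circ> Inl) (X \<circ> Inr) i s)"
proof -
  have "traverse d (X \<circ> Inl) (X \<circ> Inr) i s =
      (\<lambda>c x. \<lparr>active = insert (fst x) (active s), paired = insert x (paired s),
          found = found s \<union> (if fst x \<in> active s then {} else children i c)\<rparr>)
        (chi d (X \<circ> Inl) s i) (hit d (X \<circ> Inl) (X \<circ> Inr) s i)" for X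
    by (simp add: traverse_def hit_def chi_def Let_def)
  then show ?thesis
    by (simp only:) (rule discrete_rv_comp2[OF discrete_chi[OF assms] discrete_hit[OF assms]])
qed

lemma discrete_explore: "discrete_rv label_space (\<lambda>X. expl d X m)"
proof (induction m)
  case (Suc m)
  show ?case
  proof (cases "m = 0")
    case True
    have nil: "[] \<in> labels" by (simp add: labels_def)
    have eq: "expl d X (Suc 0) = (\<lambda>c x. \<lparr>active = {x}, paired = {}, found = children [] c\<rparr>)
        (quantile (g_emp d) (X (Inl [])))
        (pick {r. r < length d \<and> outdeg d r = quantile (g_emp d) (X (Inl []))} (X (Inr [])))" for X
      by (simp add: Let_def)
    have "discrete_rv label_space (\<lambda>X. pick {r. r < length d \<and> outdeg d r = quantile (g_emp d) (X (Inl []))} (X (Inr [])))"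
      by (rule discrete_rv_bind[where f="\<lambda>c X. pick {r. r < length d \<and> outdeg d r = c} (X (Inr []))"])
         (rule discrete_quantile[OF nil] discrete_pick[OF nil])+
    note pick = this
    show ?thesis
      unfolding True eq by (rule discrete_rv_comp2[OF discrete_quantile[OF nil] pick])
  next
    case False
    have "expl d X (Suc m) = (\<lambda>s X. fold (traverse d (X \<circ> Inl) (X \<circ> Inr)) (sorted_list_of_set (found s)) (s\<lparr>found := {}\<rparr>))
        (expl d X m) X" for X
      using False by (simp add: explore_Suc A_set_def)
    moreover have "discrete_rv label_space (\<lambda>X. (\<lambda>s X. fold (traverse d (X \<circ> Inl) (X \<circ> Inr)) (sorted_list_of_set (found s)) (s\<lparr>found := {}\<rparr>))
        (expl d X m) X)"
    proof (rule discrete_rv_bind[OF Suc.IH], rule discrete_rv_fold_list)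
      \<comment> \<open>Only states in the range of the exploration matter; their found stubs lie in
        \<open>labels\<close>, where \<open>measurable_coord\<close> applies.\<close>
      fix s i t assume "s \<in> (\<lambda>X. expl d X m) ` space label_space" "i \<in> set (sorted_list_of_set (found s))"
      then obtain X where "found s = A_set d (X \<circ> Inl) (X \<circ> Inr) m" "i \<in> set (sorted_list_of_set (found s))"
        by (auto simp: A_set_def)
      then have "i \<in> A_set d (X \<circ> Inl) (X \<circ> Inr) m" by simp
      then have "i \<in> labels" using A_set_labels by blast
      then show "discrete_rv label_space (\<lambda>X. traverse d (X \<circ> Inl) (X \<circ> Inr) i t)"
        by (rule discrete_traverse)
    qed
    ultimately show ?thesis by (simp only:)
  qed
qed (simp add: discrete_rv_const)

lemma discrete_A_set: "discrete_rv label_space (\<lambda>X. A_set d (X \<circ> Inl) (X \<circ> Inr) m)"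
  unfolding A_set_def by (rule discrete_rv_comp[OF discrete_explore])

lemma discrete_before: "discrete_rv label_space (\<lambda>X. before d (X \<circ> Inl) (X \<circ> Inr) m i)"
proof -
  have "before d (X \<circ> Inl) (X \<circ> Inr) m i = (\<lambda>s X. fold (traverse d (X \<circ> Inl) (X \<circ> Inr))
      (takeWhile (\<lambda>j. j \<noteq> i) (sorted_list_of_set (found s))) (s\<lparr>found := {}\<rparr>)) (expl d X m) X" for X
    by (simp add: before_def state_before_def A_set_def)
  moreover have "discrete_rv label_space (\<lambda>X. (\<lambda>s X. fold (traverse d (X \<circ> Inl) (X \<circ> Inr))
      (takeWhile (\<lambda>j. j \<noteq> i) (sorted_list_of_set (found s))) (s\<lparr>found := {}\<rparr>)) (expl d X m) X)"
  proof (rule discrete_rv_bind[OF discrete_explore], rule discrete_rv_fold_list)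
    fix s j t
    assume s: "s \<in> (\<lambda>X. expl d X m) ` space label_space"
      and j: "j \<in> set (takeWhile (\<lambda>j. j \<noteq> i) (sorted_list_of_set (found s)))"
    from s obtain X where "found s = A_set d (X \<circ> Inl) (X \<circ> Inr) m"
      by (auto simp: A_set_def)
    then have "j \<in> A_set d (X \<circ> Inl) (X \<circ> Inr) m"
      using set_takeWhileD[OF j] by simp
    then have "j \<in> labels" using A_set_labels by blast
    then show "discrete_rv label_space (\<lambda>X. traverse d (X \<circ> Inl) (X \<circ> Inr) j t)"
      by (rule discrete_traverse)
  qed
  ultimately show ?thesis by (simp only:)
qed

lemma discrete_chi_before:
  "i \<in> labels \<Longrightarrow> discrete_rv label_space (\<lambda>X. chi d (X \<circ> Inl) (before d (X \<circ> Inl) (X \<circ> Inr) m i) i)"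
  by (rule discrete_rv_bind[OF discrete_before, where f="\<lambda>s X. chi d (X \<circ> Inl) s i"]) (rule discrete_chi)

lemma discrete_hit_before:
  "i \<in> labels \<Longrightarrow> discrete_rv label_space
     (\<lambda>X. hit d (X \<circ> Inl) (X \<circ> Inr) (before d (X \<circ> Inl) (X \<circ> Inr) m i) i)"
  by (rule discrete_rv_bind[OF discrete_before, where f="\<lambda>s X. hit d (X \<circ> Inl) (X \<circ> Inr) s i"])
     (rule discrete_hit)

lemma discrete_A_hat: "discrete_rv label_space (\<lambda>X. A_hat g f (X \<circ> Inl) m)"
proof (induction m)
  case (Suc m)
  have "discrete_rv label_space (\<lambda>X. (\<lambda>A X. \<Union>i\<in>A. children i (chi_hat g f (X \<circ> Inl) i)) (A_hat g f (X \<circ> Inl) m) X)"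
  proof (rule discrete_rv_bind[OF Suc.IH], rule discrete_rv_UN, goal_cases)
    case (1 A)
    then show ?case by auto
  next
    case (2 A i)
    then have "i \<in> labels" using A_hat_labels by blast
    then show ?case by (rule discrete_rv_comp[OF discrete_chi_hat])
  qed
  then show ?case by (simp only: A_hat.simps)
qed (simp add: discrete_rv_const)

lemma discrete_discrepancy:
  "discrete_rv label_space (\<lambda>X. discrepancy g f d (X \<circ> Inl) (X \<circ> Inr) m)"
  unfolding discrepancy_def
  by (rule discrete_rv_comp2[OF discrete_A_set discrete_A_hat])

lemma discrete_Z_hat: "discrete_rv label_space (\<lambda>X. Z_hat g f (X \<circ> Inl) m)"
  unfolding Z_hat_def by (rule discrete_rv_comp[OF discrete_A_hat])

section \<open>Resampling the variables at one label\<close>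

lemma comp_upd:
  "X(Inl i := u, Inr i := w) \<circ> Inl = (X \<circ> Inl)(i := u)"
  "X(Inl i := u, Inr i := w) \<circ> Inr = (X \<circ> Inr)(i := w)"
  "X(Inl i := u) \<circ> Inl = (X \<circ> Inl)(i := u)"
  by (auto simp: fun_eq_iff)

lemma A_set_upd:
  "m \<le> length i \<Longrightarrow> A_set d (X(Inl i := u, Inr i := w) \<circ> Inl) (X(Inl i := u, Inr i := w) \<circ> Inr) m
     = A_set d (X \<circ> Inl) (X \<circ> Inr) m"
  unfolding comp_upd by (rule A_set_cong) auto

lemma A_hat_upd:
  "m \<le> length i \<Longrightarrow> A_hat g f (X(Inl i := u, Inr i := w) \<circ> Inl) m = A_hat g f (X \<circ> Inl) m"
  "m \<le> length i \<Longrightarrow> A_hat g f (X(Inl i := u) \<circ> Inl) m = A_hat g f (X \<circ> Inl) m"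
  unfolding comp_upd by (rule A_hat_cong; auto)+

lemma before_upd:
  "length i = m \<Longrightarrow> before d (X(Inl i := u, Inr i := w) \<circ> Inl) (X(Inl i := u, Inr i := w) \<circ> Inr) m i
     = before d (X \<circ> Inl) (X \<circ> Inr) m i"
  unfolding comp_upd by (rule before_cong) auto

lemma nn_integral_coord:
  assumes "i \<in> labels" "\<psi> \<in> borel_measurable borel"
  shows "(\<integral>\<^sup>+X. \<psi> (X (Inl i)) \<partial>label_space) = (\<integral>\<^sup>+x. \<psi> x \<partial>unif)"
  using nn_integral_indep_prod[of "{i}" \<psi> "\<lambda>_. 1"] assms P.emeasure_space_1 by simp

section \<open>The delayed branching process\<close>

text \<open>Wald-type bound: membership of \<open>i\<close> in \<open>A\<close> does not depend on
  the variables at \<open>i\<close>, so each member contributes the mean \<open>\<mu>\<close>. The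
  root is excluded because its offspring number has law \<open>g\<close>.\<close>

lemma nn_integral_chi_hat_le:
  assumes mean: "(\<integral>\<^sup>+x. ennreal (real x) \<partial>measure_pmf f) = ennreal \<mu>"
    and A: "discrete_rv label_space A" "\<And>X. X \<in> space label_space \<Longrightarrow> finite (A X) \<and> A X \<subseteq> labels - {[]}"
    and upd: "\<And>X i u w. X \<in> space label_space \<Longrightarrow> i \<in> labels \<Longrightarrow>
      i \<in> A (X(Inl i := u, Inr i := w)) \<longleftrightarrow> i \<in> A X"
  shows "(\<integral>\<^sup>+X. (\<Sum>i\<in>A X. ennreal (real (chi_hat g f (X \<circ> Inl) i))) \<partial>label_space)
    \<le> ennreal \<mu> * (\<integral>\<^sup>+X. of_nat (card (A X)) \<partial>label_space)"
proof -
  have "(\<integral>\<^sup>+X. (\<Sum>i\<in>A X. ennreal (real (chi_hat g f (X \<circ> Inl) i))) \<partial>label_space)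
      \<le> (\<integral>\<^sup>+X. (\<Sum>i\<in>A X. ennreal \<mu>) \<partial>label_space)"
  proof (rule nn_integral_random_sum_le[OF A(1)])
    show "finite (A X) \<and> A X \<subseteq> labels" if "X \<in> space label_space" for X using A(2)[OF that] by auto
    show "(\<lambda>X. ennreal (real (chi_hat g f (X \<circ> Inl) i))) \<in> borel_measurable label_space" if "i \<in> labels" for i
      by (rule measurable_discrete_ennreal) (rule discrete_rv_comp[OF discrete_chi_hat[OF that]])
    show "AE X in label_space. \<forall>i\<in>A X.
        (\<integral>\<^sup>+u. \<integral>\<^sup>+w. ennreal (real (chi_hat g f (X(Inl i := u, Inr i := w) \<circ> Inl) i)) \<partial>unif \<partial>unif) \<le> ennreal \<mu>"
    proof (rule AE_I2, rule ballI)
      fix X i assume X: "X \<in> space label_space" "i \<in> A X"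
      then have i: "i \<noteq> []" using A(2) by auto
      have "(\<integral>\<^sup>+u. \<integral>\<^sup>+w. ennreal (real (chi_hat g f (X(Inl i := u, Inr i := w) \<circ> Inl) i)) \<partial>unif \<partial>unif)
          = (\<integral>\<^sup>+u. ennreal (real (quantile (pmf f) u)) \<partial>unif)"
        using i by (simp add: comp_upd chi_hat_def unif.emeasure_space_1[simplified])
      also have "\<dots> = ennreal \<mu>"
        using nn_integral_quantile_pmf[of "\<lambda>x. ennreal (real x)" f] mean by simp
      finally show "(\<integral>\<^sup>+u. \<integral>\<^sup>+w. ennreal (real (chi_hat g f (X(Inl i := u, Inr i := w) \<circ> Inl) i)) \<partial>unif \<partial>unif) \<le> ennreal \<mu>"
        by simp
    qed
  qed (use upd in auto)
  also have "\<dots> = (\<integral>\<^sup>+X. ennreal \<mu> * of_nat (card (A X)) \<partial>label_space)"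
    by (simp add: mult.commute)
  also have "\<dots> = ennreal \<mu> * (\<integral>\<^sup>+X. of_nat (card (A X)) \<partial>label_space)"
    by (intro nn_integral_cmult measurable_discrete_ennreal discrete_rv_comp[OF A(1)])
  finally show ?thesis .
qed

lemma nn_integral_Z_hat_le:
  assumes gm: "(\<integral>\<^sup>+x. ennreal (real x) \<partial>measure_pmf g) = ennreal \<nu>" and "0 \<le> \<nu>"
    and fm: "(\<integral>\<^sup>+x. ennreal (real x) \<partial>measure_pmf f) = ennreal \<mu>" and "0 \<le> \<mu>"
  shows "(\<integral>\<^sup>+X. of_nat (Z_hat g f (X \<circ> Inl) (Suc m)) \<partial>label_space) \<le> ennreal (\<nu> * \<mu> ^ m)"
proof (induction m)
  case 0
  have nil: "[] \<in> labels" by (simp add: labels_def)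
  have "(\<integral>\<^sup>+X. of_nat (Z_hat g f (X \<circ> Inl) (Suc 0)) \<partial>label_space)
      = (\<integral>\<^sup>+X. ennreal (real (quantile (pmf g) (X (Inl [])))) \<partial>label_space)"
    unfolding Z_hat_Suc by (simp add: chi_hat_def ennreal_of_nat_eq_real_of_nat)
  also have "\<dots> = (\<integral>\<^sup>+x. ennreal (real (quantile (pmf g) x)) \<partial>unif)"
    by (rule nn_integral_coord[OF nil]) measurable
  also have "\<dots> = ennreal \<nu>"
    using nn_integral_quantile_pmf[of "\<lambda>x. ennreal (real x)" g] gm by simp
  finally show ?case by (simp only: power_0 mult_1_right order_refl)
next
  case (Suc m)
  have "(\<integral>\<^sup>+X. of_nat (Z_hat g f (X \<circ> Inl) (Suc (Suc m))) \<partial>label_space)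
      = (\<integral>\<^sup>+X. (\<Sum>i\<in>A_hat g f (X \<circ> Inl) (Suc m). ennreal (real (chi_hat g f (X \<circ> Inl) i))) \<partial>label_space)"
    unfolding Z_hat_Suc[of g f _ "Suc m"] by (simp add: ennreal_of_nat_eq_real_of_nat del: A_hat.simps)
  also have "\<dots> \<le> ennreal \<mu> * (\<integral>\<^sup>+X. of_nat (card (A_hat g f (X \<circ> Inl) (Suc m))) \<partial>label_space)"
  proof (rule nn_integral_chi_hat_le[OF fm discrete_A_hat])
    fix X :: "label + label \<Rightarrow> real" and i u w
    show "finite (A_hat g f (X \<circ> Inl) (Suc m)) \<and> A_hat g f (X \<circ> Inl) (Suc m) \<subseteq> labels - {[]}"
      using A_hat_labels[of g f "X \<circ> Inl" "Suc m"] finite_A_hat by fastforce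
    show "i \<in> A_hat g f (X(Inl i := u, Inr i := w) \<circ> Inl) (Suc m) \<longleftrightarrow> i \<in> A_hat g f (X \<circ> Inl) (Suc m)"
    proof (cases "length i = Suc m")
      case True then show ?thesis by (simp only: A_hat_upd order_refl)
    next
      case False then show ?thesis using A_hat_labels by blast
    qed
  qed
  also have "\<dots> \<le> ennreal \<mu> * ennreal (\<nu> * \<mu> ^ m)"
    by (rule mult_left_mono[OF Suc.IH[unfolded Z_hat_def]]) simp
  also have "\<dots> = ennreal (\<nu> * \<mu> ^ Suc m)"
    using assms by (simp add: ennreal_mult[symmetric] mult_ac)
  finally show ?case .
qed

text \<open>Split according to the value of the \<open>m\<close>-th generation: given it, the offspring variables are
  independent.\<close>

lemma nn_integral_offspring_gf:
  fixes H :: "nat \<Rightarrow> ennreal" and s :: real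
  assumes "1 \<le> m" "0 \<le> s"
  shows "(\<integral>\<^sup>+X. H (Z_hat g f (X \<circ> Inl) m) * ennreal (s ^ Z_hat g f (X \<circ> Inl) (Suc m)) \<partial>label_space)
    = (\<integral>\<^sup>+X. H (Z_hat g f (X \<circ> Inl) m) * (\<integral>\<^sup>+x. ennreal (s ^ x) \<partial>measure_pmf f) ^ Z_hat g f (X \<circ> Inl) m \<partial>label_space)"
proof -
  define \<psi> where "\<psi> x = ennreal (s ^ quantile (pmf f) x)" for x
  define \<phi> where "\<phi> = (\<integral>\<^sup>+x. ennreal (s ^ x) \<partial>measure_pmf f)"
  have \<psi>: "\<psi> \<in> borel_measurable borel" unfolding \<psi>_def by measurable
  have \<psi>\<phi>: "(\<integral>\<^sup>+x. \<psi> x \<partial>unif) = \<phi>"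
    unfolding \<psi>_def \<phi>_def by (rule nn_integral_quantile_pmf)
  define I where "I = {a :: label set. finite a \<and> a \<subseteq> {i \<in> labels. length i = m}}"
  have "countable I"
    by (rule countable_subset[OF _ countable_Collect_finite]) (auto simp: I_def)
  let ?A = "\<lambda>X. A_hat g f (X \<circ> Inl) m"
  have AI: "?A X \<in> I" for X using A_hat_labels by (auto simp: I_def)
  \<comment> \<open>The generation is viewed as the only element of a random set, so that
    \<open>nn_integral_random_sum\<close> splits the integral over its countably many values
    \<open>a\<close>.\<close>
  have disc: "discrete_rv label_space (\<lambda>X. {?A X})"
    by (rule discrete_rv_comp[OF discrete_A_hat])
  have AI': "finite {?A X} \<and> {?A X} \<subseteq> I" for X using AI by simp
  define F1 where "F1 a X = H (card a) * (\<Prod>i\<in>a. \<psi> (X (Inl i)))" for a and X :: "label + label \<Rightarrow> real"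
  define F2 where "F2 a X = H (card a) * \<phi> ^ card a" for a :: "label set" and X :: "label + label \<Rightarrow> real"
  have F1: "F1 a \<in> borel_measurable label_space" if "a \<in> I" for a
    unfolding F1_def using that
    by (intro borel_measurable_times_ennreal borel_measurable_const borel_measurable_prod_ennreal
          measurable_compose[OF measurable_coord(1) \<psi>]) (auto simp: I_def)
  have F2: "F2 a \<in> borel_measurable label_space" for a
    unfolding F2_def by simp
  have eq: "(\<integral>\<^sup>+X. indicator {?A X} a * F1 a X \<partial>label_space) = (\<integral>\<^sup>+X. indicator {?A X} a * F2 a X \<partial>label_space)"
    if a: "a \<in> I" for a
  proof -
    \<comment> \<open>The event that the generation equals \<open>a\<close> is determined by labels
      shorter than \<open>m\<close>, hence invariant under resampling the coordinates in
      \<open>a\<close>.\<close>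
    let ?g = "\<lambda>X. indicator {?A X} a * H (card a)"
    have g: "?g \<in> borel_measurable label_space"
      by (rule measurable_discrete_ennreal) (rule discrete_rv_comp[OF discrete_A_hat])
    have "(\<integral>\<^sup>+X. ?g X * (\<Prod>i\<in>a. \<psi> (X (Inl i))) \<partial>label_space) = (\<integral>\<^sup>+x. \<psi> x \<partial>unif) ^ card a * (\<integral>\<^sup>+X. ?g X \<partial>label_space)"
      using a by (intro nn_integral_indep_prod \<psi> g) (auto simp: I_def A_hat_upd)
    also have "\<dots> = (\<integral>\<^sup>+X. \<phi> ^ card a * ?g X \<partial>label_space)"
      unfolding \<psi>\<phi> by (rule nn_integral_cmult[OF g, symmetric])
    finally show ?thesis by (simp add: F1_def F2_def mult_ac)
  qed
  have "(\<integral>\<^sup>+X. H (Z_hat g f (X \<circ> Inl) m) * ennreal (s ^ Z_hat g f (X \<circ> Inl) (Suc m)) \<partial>label_space)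
      = (\<integral>\<^sup>+X. (\<Sum>a\<in>{?A X}. F1 a X) \<partial>label_space)"
  proof (rule nn_integral_cong)
    fix X :: "label + label \<Rightarrow> real"
    have "chi_hat g f (X \<circ> Inl) i = quantile (pmf f) (X (Inl i))" if "i \<in> ?A X" for i
      using that A_hat_labels[of g f "X \<circ> Inl" m] assms(1) by (auto simp: chi_hat_def)
    then have "s ^ Z_hat g f (X \<circ> Inl) (Suc m) = (\<Prod>i\<in>?A X. s ^ quantile (pmf f) (X (Inl i)))"
      unfolding Z_hat_Suc power_sum by (intro prod.cong) auto
    then show "H (Z_hat g f (X \<circ> Inl) m) * ennreal (s ^ Z_hat g f (X \<circ> Inl) (Suc m)) = (\<Sum>a\<in>{?A X}. F1 a X)"
      using assms(2) by (simp add: F1_def \<psi>_def Z_hat_def prod_ennreal)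
  qed
  also have "\<dots> = (\<integral>\<^sup>+a. (\<integral>\<^sup>+X. indicator {?A X} a * F1 a X \<partial>label_space) \<partial>count_space I)"
    by (rule nn_integral_random_sum[OF disc AI' F1 \<open>countable I\<close>])
  also have "\<dots> = (\<integral>\<^sup>+a. (\<integral>\<^sup>+X. indicator {?A X} a * F2 a X \<partial>label_space) \<partial>count_space I)"
    by (rule nn_integral_cong) (simp only: space_count_space eq)
  also have "\<dots> = (\<integral>\<^sup>+X. (\<Sum>a\<in>{?A X}. F2 a X) \<partial>label_space)"
    by (rule nn_integral_random_sum[OF disc AI' F2 \<open>countable I\<close>, symmetric])
  also have "\<dots> = (\<integral>\<^sup>+X. H (Z_hat g f (X \<circ> Inl) m) * \<phi> ^ Z_hat g f (X \<circ> Inl) m \<partial>label_space)"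
    by (simp add: F2_def Z_hat_def)
  finally show ?thesis unfolding \<phi>_def .
qed

text \<open>Follows from \<open>1 + z + z\<^sup>2 / 2 \<le> exp z\<close>, because the two
  quadratics multiply to \<open>1 + z ^ 4 / 4\<close>, which is at least 1.\<close>

lemma exp_minus_le_quadratic:
  assumes "0 \<le> (z::real)"
  shows "exp (- z) \<le> 1 - z + z\<^sup>2 / 2"
proof -
  have p: "1 + z + z\<^sup>2 / 2 \<le> exp z"
    using exp_lower_Taylor_quadratic[OF assms] .
  have q: "0 \<le> 1 - z + z\<^sup>2 / 2"
    using sum_power2_ge_zero[of "z - 1" 1] by (simp add: power2_eq_square algebra_simps)
  have "1 \<le> 1 + z ^ 4 / 4" by simp
  also have "\<dots> = (1 - z + z\<^sup>2 / 2) * (1 + z + z\<^sup>2 / 2)"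
    by (simp add: power2_eq_square power4_eq_xxxx field_simps)
  also have "\<dots> \<le> (1 - z + z\<^sup>2 / 2) * exp z"
    by (rule mult_left_mono[OF p q])
  finally show ?thesis by (simp add: exp_minus field_simps)
qed

text \<open>Only truncated moments of \<open>f\<close> enter, so a finite mean suffices.\<close>

lemma exp_moment_bound:
  assumes fm: "(\<integral>\<^sup>+x. ennreal (real x) \<partial>measure_pmf f) = ennreal \<mu>" and "0 \<le> \<mu>'" "\<mu>' < \<mu>"
  obtains t0 :: real where "0 < t0"
    "\<And>t. 0 < t \<Longrightarrow> t \<le> t0 \<Longrightarrow> (\<integral>\<^sup>+x. ennreal (exp (- t) ^ x) \<partial>measure_pmf f) \<le> ennreal (exp (- t * \<mu>'))"
proof -
  \<comment> \<open>Monotone convergence: truncation at some \<open>N\<close> already leaves a mean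
    \<open>m\<close> above \<open>\<mu>'\<close>, and the truncated variable has second moment at
    most the square of \<open>N\<close>.\<close>
  have "(\<integral>\<^sup>+x. (SUP N. ennreal (real (min x N))) \<partial>measure_pmf f) = (SUP N. \<integral>\<^sup>+x. ennreal (real (min x N)) \<partial>measure_pmf f)"
    by (intro nn_integral_monotone_convergence_SUP) (auto simp: incseq_def le_fun_def intro!: ennreal_leI)
  also have "(\<lambda>x. SUP N. ennreal (real (min x N))) = (\<lambda>x. ennreal (real x))"
  proof
    fix x
    show "(SUP N. ennreal (real (min x N))) = ennreal (real x)"
    proof (rule antisym)
      show "(SUP N. ennreal (real (min x N))) \<le> ennreal (real x)" by (intro SUP_least ennreal_leI) simp
      show "ennreal (real x) \<le> (SUP N. ennreal (real (min x N)))"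
        by (rule SUP_upper2[of x]) simp_all
    qed
  qed
  finally have "ennreal \<mu>' < (SUP N. \<integral>\<^sup>+x. ennreal (real (min x N)) \<partial>measure_pmf f)"
    using assms(2,3) by (metis fm ennreal_less_iff)
  then obtain N where N: "ennreal \<mu>' < (\<integral>\<^sup>+x. ennreal (real (min x N)) \<partial>measure_pmf f)"
    by (auto simp: less_SUP_iff)
  have int: "integrable (measure_pmf f) (\<lambda>x. real (min x N))"
    by (rule measure_pmf.integrable_const_bound[where B="real N"]) auto
  define m where "m = (\<integral>x. real (min x N) \<partial>measure_pmf f)"
  have "(\<integral>\<^sup>+x. ennreal (real (min x N)) \<partial>measure_pmf f) = ennreal m"
    unfolding m_def by (rule nn_integral_eq_integral[OF int]) simp
  then have m: "\<mu>' < m" using N assms(2) by (simp add: ennreal_less_iff)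
  \<comment> \<open>For \<open>t \<le> t0\<close> the quadratic term of the exponential bound uses
    up only the gap between \<open>m\<close> and \<open>\<mu>'\<close>; the summand 1 keeps the
    denominator positive.\<close>
  define t0 where "t0 = 2 * (m - \<mu>') / ((real N)\<^sup>2 + 1)"
  have "0 < t0" using m by (simp add: t0_def add_nonneg_pos)
  moreover have "(\<integral>\<^sup>+x. ennreal (exp (- t) ^ x) \<partial>measure_pmf f) \<le> ennreal (exp (- t * \<mu>'))"
    if t: "0 < t" "t \<le> t0" for t
  proof -
    have b: "exp (- t) ^ x \<le> 1 - t * real (min x N) + t\<^sup>2 * (real N)\<^sup>2 / 2" for x
    proof -
      have "exp (- t) ^ x \<le> exp (- t) ^ min x N"
        using t by (intro power_decreasing) auto
      also have "\<dots> = exp (- (t * real (min x N)))"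
        by (simp add: exp_of_nat_mult[symmetric] mult.commute)
      also have "\<dots> \<le> 1 - t * real (min x N) + (t * real (min x N))\<^sup>2 / 2"
        using t by (intro exp_minus_le_quadratic) simp
      also have "(t * real (min x N))\<^sup>2 \<le> (t * real N)\<^sup>2"
        using t by (intro power_mono mult_left_mono) auto
      finally show ?thesis by (simp add: power_mult_distrib)
    qed
    have "(\<integral>\<^sup>+x. ennreal (exp (- t) ^ x) \<partial>measure_pmf f)
        \<le> (\<integral>\<^sup>+x. ennreal (1 - t * real (min x N) + t\<^sup>2 * (real N)\<^sup>2 / 2) \<partial>measure_pmf f)"
      using b by (intro nn_integral_mono ennreal_leI) auto
    also have "\<dots> = ennreal (\<integral>x. 1 - t * real (min x N) + t\<^sup>2 * (real N)\<^sup>2 / 2 \<partial>measure_pmf f)"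
    proof (rule nn_integral_eq_integral)
      show "AE x in measure_pmf f. 0 \<le> 1 - t * real (min x N) + t\<^sup>2 * (real N)\<^sup>2 / 2"
        by (intro AE_I2 order_trans[OF _ b]) simp
    qed (use int in simp)
    also have "(\<integral>x. 1 - t * real (min x N) + t\<^sup>2 * (real N)\<^sup>2 / 2 \<partial>measure_pmf f)
        = 1 - t * m + t\<^sup>2 * (real N)\<^sup>2 / 2"
      using int by (simp add: m_def measure_pmf.prob_space)
    also have "\<dots> \<le> exp (- t * m + t\<^sup>2 * (real N)\<^sup>2 / 2)"
      using exp_ge_add_one_self[of "- t * m + t\<^sup>2 * (real N)\<^sup>2 / 2"] by linarith
    also have "\<dots> \<le> exp (- t * \<mu>')"
    proof -
      have "t * (real N)\<^sup>2 \<le> t * ((real N)\<^sup>2 + 1)" using t by simp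
      also have "\<dots> \<le> t0 * ((real N)\<^sup>2 + 1)"
        using t by (intro mult_right_mono) auto
      also have "\<dots> = 2 * (m - \<mu>')" by (simp add: t0_def add_nonneg_eq_0_iff)
      finally have "t * (t * (real N)\<^sup>2) \<le> t * (2 * (m - \<mu>'))" using t by (intro mult_left_mono) auto
      then show ?thesis by (simp add: power2_eq_square algebra_simps)
    qed
    finally show ?thesis by (simp add: ennreal_leI)
  qed
  ultimately show ?thesis by (rule that)
qed

text \<open>\<open>E[\<sigma>\<^bsup>Z\<^esup>; Z > 0]\<close> contracts by the factor \<open>\<rho>\<close> at each generation, because the generating
  function satisfies \<open>\<phi>(\<sigma>) \<le> \<rho> \<sigma>\<close> for \<open>\<sigma>\<close> near \<open>1\<close>. This controls extinction and slow growth at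
  once.\<close>

lemma branching_slow_growth:
  assumes fm: "(\<integral>\<^sup>+x. ennreal (real x) \<partial>measure_pmf f) = ennreal \<mu>"
    and "1 < \<mu>'" "\<mu>' < \<mu>" "\<theta> < \<mu>'"
  obtains \<rho> :: real where "0 < \<rho>" "\<rho> < 1"
    "\<And>m. emeasure label_space {X \<in> space label_space.
        0 < Z_hat g f (X \<circ> Inl) (Suc m) \<and> real (Z_hat g f (X \<circ> Inl) (Suc (Suc m))) < \<theta> * real (Z_hat g f (X \<circ> Inl) (Suc m))}
      \<le> ennreal (\<rho> ^ m)"
proof -
  obtain t0 :: real where t0: "0 < t0"
    and gf: "\<And>t. 0 < t \<Longrightarrow> t \<le> t0 \<Longrightarrow> (\<integral>\<^sup>+x. ennreal (exp (- t) ^ x) \<partial>measure_pmf f) \<le> ennreal (exp (- t * \<mu>'))"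
    using exp_moment_bound[OF fm _ assms(3)] assms(2) by (metis less_imp_le less_trans zero_less_one)
  \<comment> \<open>Two parameters are needed: \<open>t\<close> for the exponential Markov
    inequality, and the exponent \<open>t'\<close> that remains once the growth factor
    \<open>\<theta>\<close> has been paid for. The minimum keeps both at most
    \<open>t0\<close>.\<close>
  define t where "t = min t0 (t0 / (\<mu>' - \<theta>))"
  define t' where "t' = t * (\<mu>' - \<theta>)"
  have t: "0 < t" "t \<le> t0" using t0 assms by (auto simp: t_def)
  have "t' \<le> t0 / (\<mu>' - \<theta>) * (\<mu>' - \<theta>)"
    unfolding t'_def using assms by (intro mult_right_mono) (auto simp: t_def)
  then have t': "0 < t'" "t' \<le> t0" using t assms by (auto simp: t'_def)
  \<comment> \<open>For \<open>z \<ge> 1\<close> individuals,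
    \<open>exp (- t' * \<mu>' * z) \<le> \<rho> * exp (- t' * z)\<close>; here
    \<open>\<mu>' > 1\<close> gives \<open>\<rho> < 1\<close>.\<close>
  define \<rho> where "\<rho> = exp (- t' * (\<mu>' - 1))"
  have \<rho>: "0 < \<rho>" "\<rho> < 1" using t' assms by (auto simp: \<rho>_def)
  let ?Z = "\<lambda>m X. Z_hat g f (X \<circ> Inl) m"
  define D where "D m = (\<integral>\<^sup>+X. of_bool (0 < ?Z m X) * ennreal (exp (- t') ^ ?Z m X) \<partial>label_space)" for m
  have pow: "ennreal (exp c) ^ k = ennreal (exp (c * real k))" for c k
    by (simp add: ennreal_power exp_of_nat_mult[symmetric] mult.commute)
  have step: "D (Suc m) \<le> ennreal \<rho> * D m" if "1 \<le> m" for m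
  proof -
    \<comment> \<open>Survival of generation \<open>m + 1\<close> is relaxed to that of generation
      \<open>m\<close>, after which the new offspring can be integrated out.\<close>
    have "D (Suc m) \<le> (\<integral>\<^sup>+X. of_bool (0 < ?Z m X) * ennreal (exp (- t') ^ ?Z (Suc m) X) \<partial>label_space)"
      unfolding D_def
    proof (intro nn_integral_mono mult_right_mono)
      fix X :: "label + label \<Rightarrow> real"
      have "?Z m X = 0 \<Longrightarrow> ?Z (Suc m) X = 0" by (simp add: Z_hat_def)
      then show "of_bool (0 < ?Z (Suc m) X) \<le> (of_bool (0 < ?Z m X) :: ennreal)"
        by (cases "?Z m X = 0") simp_all
    qed simp
    also have "\<dots> = (\<integral>\<^sup>+X. of_bool (0 < ?Z m X) * (\<integral>\<^sup>+x. ennreal (exp (- t') ^ x) \<partial>measure_pmf f) ^ ?Z m X \<partial>label_space)"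
      using nn_integral_offspring_gf[OF that, of "exp (- t')" "\<lambda>z. of_bool (0 < z)" g f] by simp
    also have "\<dots> \<le> (\<integral>\<^sup>+X. ennreal \<rho> * (of_bool (0 < ?Z m X) * ennreal (exp (- t') ^ ?Z m X)) \<partial>label_space)"
    proof (rule nn_integral_mono)
      fix X :: "label + label \<Rightarrow> real"
      show "of_bool (0 < ?Z m X) * (\<integral>\<^sup>+x. ennreal (exp (- t') ^ x) \<partial>measure_pmf f) ^ ?Z m X
          \<le> ennreal \<rho> * (of_bool (0 < ?Z m X) * ennreal (exp (- t') ^ ?Z m X))"
      proof (cases "0 < ?Z m X")
        case True
        let ?z = "?Z m X"
        have "(\<integral>\<^sup>+x. ennreal (exp (- t') ^ x) \<partial>measure_pmf f) ^ ?z \<le> ennreal (exp (- t' * \<mu>')) ^ ?z"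
          by (intro power_mono gf t') simp
        also have "\<dots> = ennreal (exp (- t' * \<mu>' * real ?z))" by (rule pow)
        also have "\<dots> \<le> ennreal (exp (- t' * (\<mu>' - 1) + - t' * real ?z))"
        proof (rule ennreal_leI, rule iffD2[OF exp_le_cancel_iff])
          have "1 * (\<mu>' - 1) \<le> real ?z * (\<mu>' - 1)" using True assms by (intro mult_right_mono) auto
          then have "t' * (\<mu>' - 1) \<le> t' * (real ?z * (\<mu>' - 1))" using t' by (intro mult_left_mono) auto
          then show "- t' * \<mu>' * real ?z \<le> - t' * (\<mu>' - 1) + - t' * real ?z"
            by (simp add: algebra_simps)
        qed
        also have "\<dots> = ennreal \<rho> * ennreal (exp (- t') ^ ?z)"
          by (simp only: exp_add \<rho>_def exp_of_nat_mult[symmetric] mult.commute[of "- t'" "real ?z"] ennreal_mult'[OF exp_ge_zero])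
        finally show ?thesis using True by simp
      qed simp
    qed
    also have "\<dots> = ennreal \<rho> * D m"
      unfolding D_def by (rule nn_integral_cmult) (rule measurable_discrete_ennreal, rule discrete_rv_comp[OF discrete_Z_hat])
    finally show ?thesis .
  qed
  have decay: "D (Suc m) \<le> ennreal (\<rho> ^ m)" for m
  proof (induction m)
    case 0
    have "D (Suc 0) \<le> (\<integral>\<^sup>+X. 1 \<partial>label_space)"
      unfolding D_def using t' by (intro nn_integral_mono) (auto simp: power_le_one)
    then show ?case by (simp add: P.emeasure_space_1)
  next
    case (Suc m)
    have "D (Suc (Suc m)) \<le> ennreal \<rho> * D (Suc m)" by (rule step) simp
    also have "\<dots> \<le> ennreal \<rho> * ennreal (\<rho> ^ m)" by (rule mult_left_mono[OF Suc.IH]) simp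
    finally show ?case using \<rho> by (simp add: ennreal_mult'[symmetric])
  qed
  show ?thesis
  proof (rule that[OF \<rho>])
    fix m0
    define m where "m = Suc m0"
    have m: "1 \<le> m" by (simp add: m_def)
    let ?B = "{X \<in> space label_space. 0 < ?Z m X \<and> real (?Z (Suc m) X) < \<theta> * real (?Z m X)}"
    have B: "?B \<in> sets label_space"
      using discrete_rv_comp2[OF discrete_Z_hat discrete_Z_hat, of "\<lambda>a b. 0 < a \<and> real b < \<theta> * real a" g f m g f "Suc m"]
      by (intro predE pred_discrete_rv)
    \<comment> \<open>Exponential Markov inequality: on the bad event
      \<open>exp (t * \<theta> * Z m - t * Z (m + 1)) \<ge> 1\<close>. Integrating out the offspring
      leaves at most \<open>exp (- t' * Z m)\<close> on survival, that is
      \<open>D m\<close>.\<close>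
    define H where "H z = of_bool (0 < z) * ennreal (exp (t * \<theta> * real z))" for z :: nat
    have "emeasure label_space ?B = (\<integral>\<^sup>+X. indicator ?B X \<partial>label_space)"
      using B by simp
    also have "\<dots> \<le> (\<integral>\<^sup>+X. H (?Z m X) * ennreal (exp (- t) ^ ?Z (Suc m) X) \<partial>label_space)"
    proof (rule nn_integral_mono)
      fix X :: "label + label \<Rightarrow> real"
      have "1 \<le> H (?Z m X) * ennreal (exp (- t) ^ ?Z (Suc m) X)"
        if "0 < ?Z m X" "real (?Z (Suc m) X) < \<theta> * real (?Z m X)"
      proof -
        have "H (?Z m X) * ennreal (exp (- t) ^ ?Z (Suc m) X)
            = ennreal (exp (t * \<theta> * real (?Z m X)) * exp (- t * real (?Z (Suc m) X)))"
          using that(1) by (simp add: H_def ennreal_mult' exp_of_nat_mult[symmetric] mult.commute)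
        also have "\<dots> = ennreal (exp (t * (\<theta> * real (?Z m X) - real (?Z (Suc m) X))))"
          by (simp add: exp_add[symmetric] algebra_simps)
        also have "\<dots> \<ge> 1" using that(2) t(1) by (simp add: ennreal_ge_1)
        finally show ?thesis .
      qed
      then show "indicator ?B X \<le> H (?Z m X) * ennreal (exp (- t) ^ ?Z (Suc m) X)"
        by (auto simp: indicator_def)
    qed
    also have "\<dots> = (\<integral>\<^sup>+X. H (?Z m X) * (\<integral>\<^sup>+x. ennreal (exp (- t) ^ x) \<partial>measure_pmf f) ^ ?Z m X \<partial>label_space)"
      by (rule nn_integral_offspring_gf[OF m]) simp
    also have "\<dots> \<le> D m"
      unfolding D_def
    proof (rule nn_integral_mono)
      fix X :: "label + label \<Rightarrow> real"
      let ?z = "?Z m X"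
      have "(\<integral>\<^sup>+x. ennreal (exp (- t) ^ x) \<partial>measure_pmf f) ^ ?z \<le> ennreal (exp (- t * \<mu>')) ^ ?z"
        by (intro power_mono gf t) simp
      also have "\<dots> = ennreal (exp (- t * \<mu>' * real ?z))" by (rule pow)
      finally have "H ?z * (\<integral>\<^sup>+x. ennreal (exp (- t) ^ x) \<partial>measure_pmf f) ^ ?z
          \<le> H ?z * ennreal (exp (- t * \<mu>' * real ?z))"
        by (intro mult_left_mono) auto
      also have "\<dots> = of_bool (0 < ?z) * ennreal (exp (t * \<theta> * real ?z) * exp (- t * \<mu>' * real ?z))"
        by (simp add: H_def ennreal_mult' mult.assoc)
      also have "exp (t * \<theta> * real ?z) * exp (- t * \<mu>' * real ?z) = exp (- t') ^ ?z"
        by (simp add: exp_add[symmetric] exp_of_nat_mult[symmetric] t'_def algebra_simps)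
      finally show "H ?z * (\<integral>\<^sup>+x. ennreal (exp (- t) ^ x) \<partial>measure_pmf f) ^ ?z
          \<le> of_bool (0 < ?z) * ennreal (exp (- t') ^ ?z)" .
    qed
    also have "\<dots> \<le> ennreal (\<rho> ^ m0)" unfolding m_def by (rule decay)
    finally show "emeasure label_space {X \<in> space label_space. 0 < ?Z (Suc m0) X \<and>
        real (?Z (Suc (Suc m0)) X) < \<theta> * real (?Z (Suc m0) X)} \<le> ennreal (\<rho> ^ m0)"
      unfolding m_def .
  qed
qed

section \<open>Expectation bounds for the coupled exploration\<close>

lemma ennreal_affine:
  "0 \<le> x \<Longrightarrow> 0 \<le> b \<Longrightarrow> 0 \<le> y \<Longrightarrow> ennreal (x + b * y) = ennreal x + ennreal b * ennreal y"
  by (simp add: ennreal_mult)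

lemma sum_ennreal_const: "0 \<le> c \<Longrightarrow> (\<Sum>i\<in>A. ennreal c) = ennreal (real (card A) * c)"
  by (simp add: ennreal_of_nat_eq_real_of_nat ennreal_mult)

lemma cancel_card: "0 < (a::nat) \<Longrightarrow> real a / b * (1 / real a) = 1 / b"
  by simp

text \<open>Drawing the class by the quantile and then a stub in its fibre is a uniform draw from
  all unpaired stubs, since \<open>card C / card U\<close> is multiplied by
  \<open>1 / card C\<close>. Node \<open>r\<close> owns at most \<open>indeg d r\<close> of
  them.\<close>

lemma hit_prob_le:
  assumes c: "consistent d s" "card (paired s) < stub_count d"
  shows "(\<integral>\<^sup>+u. \<integral>\<^sup>+w. of_bool (fst (pick (candidates d s (quantile (h_emp d s) u)) w) = r) \<partial>unif \<partial>unif)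
    \<le> ennreal (real (indeg d r) / (real (stub_count d) - real (card (paired s))))"
proof -
  let ?q = "quantile (h_emp d s)" and ?C = "candidates d s" and ?U = "unpaired d s" and ?k = "stub_class d s"
  define R where "R = {x \<in> ?U. fst x = r}"
  have finR: "finite R" by (simp add: R_def)
  have "R \<subseteq> Pair r ` {..<indeg d r}" by (auto simp: R_def unpaired_def)
  then have "card R \<le> card (Pair r ` {..<indeg d r})" by (intro card_mono) auto
  also have "\<dots> \<le> indeg d r" by (rule order_trans[OF card_image_le]) auto
  finally have cardR: "card R \<le> indeg d r" .
  have cU: "real (card ?U) = real (stub_count d) - real (card (paired s))"
    using c by (simp add: card_unpaired)
  have mf: "mass_function (h_emp d s)" by (rule mass_function_h_emp[OF c])
  \<comment> \<open>The candidate set depends on \<open>u\<close>, so the event is split over the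
    stubs \<open>x\<close> of \<open>r\<close>. For fixed \<open>x\<close> the class is known, and
    the event becomes a product of one event in \<open>u\<close> and one in
    \<open>w\<close>.\<close>
  have le: "AE u in unif. \<forall>w. of_bool (fst (pick (?C (?q u)) w) = r)
      \<le> (\<Sum>x\<in>R. indicator {u. ?q u = ?k x} u * indicator {w. pick (?C (?k x)) w = x} w :: ennreal)"
    using AE_unif
  proof eventually_elim
    case (elim u)
    have "0 < h_emp d s (?q u)" using elim by (intro quantile_mass_pos[OF mf]) auto
    then have "?C (?q u) \<noteq> {}" by (auto simp: h_emp_eq_card[OF c(1)])
    then have mem: "pick (?C (?q u)) w \<in> ?C (?q u)" for w unfolding pick_def by (rule from_nat_into)
    show ?case
    proof
      fix w
      show "of_bool (fst (pick (?C (?q u)) w) = r)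
        \<le> (\<Sum>x\<in>R. indicator {u. ?q u = ?k x} u * indicator {w. pick (?C (?k x)) w = x} w :: ennreal)"
      proof (cases "fst (pick (?C (?q u)) w) = r")
        case True
        let ?x = "pick (?C (?q u)) w"
        have "?x \<in> R" "?k ?x = ?q u" using mem[of w] True by (auto simp: R_def candidates_eq)
        then have "(1::ennreal) = indicator {u. ?q u = ?k ?x} u * indicator {w. pick (?C (?k ?x)) w = ?x} w"
          by simp
        also have "\<dots> \<le> (\<Sum>x\<in>R. indicator {u. ?q u = ?k x} u * indicator {w. pick (?C (?k x)) w = x} w)"
          using finR \<open>?x \<in> R\<close> by (intro member_le_sum) auto
        finally show ?thesis using True by simp
      qed simp
    qed
  qed
  have "(\<integral>\<^sup>+u. \<integral>\<^sup>+w. of_bool (fst (pick (?C (?q u)) w) = r) \<partial>unif \<partial>unif)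
      \<le> (\<integral>\<^sup>+u. \<integral>\<^sup>+w. (\<Sum>x\<in>R. indicator {u. ?q u = ?k x} u * indicator {w. pick (?C (?k x)) w = x} w) \<partial>unif \<partial>unif)"
    using le by (intro nn_integral_mono_AE) (auto elim!: eventually_mono intro!: nn_integral_mono)
  also have "\<dots> = (\<integral>\<^sup>+u. (\<Sum>x\<in>R. indicator {u. ?q u = ?k x} u * emeasure unif {w. pick (?C (?k x)) w = x}) \<partial>unif)"
    by (simp add: nn_integral_sum nn_integral_cmult)
  also have "\<dots> = (\<Sum>x\<in>R. emeasure unif {u. ?q u = ?k x} * emeasure unif {w. pick (?C (?k x)) w = x})"
    by (simp add: nn_integral_sum nn_integral_multc)
  also have "\<dots> = (\<Sum>x\<in>R. ennreal (1 / real (card ?U)))"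
  proof (rule sum.cong[OF refl])
    fix x assume "x \<in> R"
    then have x: "x \<in> ?C (?k x)" by (auto simp: R_def candidates_eq)
    then have pos: "0 < card (?C (?k x))" by (auto simp: card_gt_0_iff)
    have "emeasure unif {u. ?q u = ?k x} * emeasure unif {w. pick (?C (?k x)) w = x}
        = ennreal (h_emp d s (?k x)) * ennreal (1 / real (card (?C (?k x))))"
      by (simp only: emeasure_quantile_eq[OF mf] emeasure_pick_eq[OF finite_candidates x])
    also have "\<dots> = ennreal (h_emp d s (?k x) * (1 / real (card (?C (?k x)))))"
      using mf by (intro ennreal_mult[symmetric]) (auto simp: mass_function_def)
    also have "h_emp d s (?k x) * (1 / real (card (?C (?k x)))) = 1 / real (card ?U)"
      unfolding h_emp_eq_card[OF c(1)] by (rule cancel_card[OF pos])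
    finally show "emeasure unif {u. ?q u = ?k x} * emeasure unif {w. pick (?C (?k x)) w = x} = ennreal (1 / real (card ?U))" .
  qed
  also have "\<dots> = ennreal (real (card R) / real (card ?U))"
    by (simp add: ennreal_of_nat_eq_real_of_nat ennreal_mult[symmetric])
  also have "\<dots> \<le> ennreal (real (indeg d r) / real (card ?U))"
    using cardR by (intro ennreal_leI divide_right_mono) auto
  finally show ?thesis by (simp only: cU)
qed

text \<open>As in \<open>hit_prob_le\<close>, the two-stage choice is uniform, here over all
  nodes.\<close>

lemma root_prob_le:
  assumes "d \<noteq> []"
  shows "(\<integral>\<^sup>+X. of_bool (r \<in> active (expl d X (Suc 0))) \<partial>label_space) \<le> ennreal (1 / real (length d))"
proof -
  let ?q = "quantile (g_emp d)" and ?C = "\<lambda>c. {r. r < length d \<and> outdeg d r = c}"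
  have nil: "[] \<in> labels" by (simp add: labels_def)
  have mf: "mass_function (g_emp d)" by (rule mass_function_g_emp[OF assms])
  have meas: "(\<lambda>X. of_bool (r \<in> active (expl d X (Suc 0))) :: ennreal) \<in> borel_measurable label_space"
    by (rule measurable_discrete_ennreal) (rule discrete_rv_comp[OF discrete_explore])
  have "(\<integral>\<^sup>+X. of_bool (r \<in> active (expl d X (Suc 0))) \<partial>label_space)
      = (\<integral>\<^sup>+X. (\<integral>\<^sup>+u. \<integral>\<^sup>+w. of_bool (pick (?C (?q u)) w = r) \<partial>unif \<partial>unif) \<partial>label_space)"
    by (subst nn_integral_resample2[OF nil meas])
       (simp only: comp_upd explore_1_sel fun_upd_same singleton_iff eq_commute[of r])
  also have "\<dots> = (\<integral>\<^sup>+u. \<integral>\<^sup>+w. of_bool (pick (?C (?q u)) w = r) \<partial>unif \<partial>unif)"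
    by (simp add: P.emeasure_space_1)
  also have "\<dots> \<le> (\<integral>\<^sup>+u. \<integral>\<^sup>+w. indicator {u. ?q u = outdeg d r \<and> r < length d} u
      * indicator {w. pick (?C (outdeg d r)) w = r} w \<partial>unif \<partial>unif)"
  proof (rule nn_integral_mono_AE)
    show "AE u in unif. (\<integral>\<^sup>+w. of_bool (pick (?C (?q u)) w = r) \<partial>unif) \<le> (\<integral>\<^sup>+w. indicator {u. ?q u = outdeg d r \<and> r < length d} u
      * indicator {w. pick (?C (outdeg d r)) w = r} w \<partial>unif)"
      using AE_unif
    proof eventually_elim
      case (elim u)
      have "0 < g_emp d (?q u)" using elim by (intro quantile_mass_pos[OF mf]) auto
      then have "?C (?q u) \<noteq> {}" unfolding g_emp_eq_card by (metis card.empty divide_eq_0_iff of_nat_0 less_irrefl)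
      then have mem: "pick (?C (?q u)) w \<in> ?C (?q u)" for w unfolding pick_def by (rule from_nat_into)
      show ?case
      proof (rule nn_integral_mono)
        fix w
        show "of_bool (pick (?C (?q u)) w = r) \<le> (indicator {u. ?q u = outdeg d r \<and> r < length d} u
          * indicator {w. pick (?C (outdeg d r)) w = r} w :: ennreal)"
          using mem[of w] by (cases "pick (?C (?q u)) w = r") auto
      qed
    qed
  qed
  also have "\<dots> = emeasure unif {u. ?q u = outdeg d r \<and> r < length d} * emeasure unif {w. pick (?C (outdeg d r)) w = r}"
    by (simp add: nn_integral_cmult nn_integral_multc)
  also have "\<dots> \<le> ennreal (1 / real (length d))"
  proof (cases "r < length d")
    case True
    then have x: "r \<in> ?C (outdeg d r)" by simp
    then have pos: "0 < card (?C (outdeg d r))" by (auto simp: card_gt_0_iff)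
    have "emeasure unif {u. ?q u = outdeg d r \<and> r < length d} * emeasure unif {w. pick (?C (outdeg d r)) w = r}
        = ennreal (g_emp d (outdeg d r)) * ennreal (1 / real (card (?C (outdeg d r))))"
      using True emeasure_pick_eq[OF _ x] by (simp add: emeasure_quantile_eq[OF mf])
    also have "\<dots> = ennreal (g_emp d (outdeg d r) * (1 / real (card (?C (outdeg d r)))))"
      using mf by (intro ennreal_mult[symmetric]) (auto simp: mass_function_def)
    also have "g_emp d (outdeg d r) * (1 / real (card (?C (outdeg d r)))) = 1 / real (length d)"
      unfolding g_emp_eq_card by (rule cancel_card[OF pos])
    finally show ?thesis by simp
  qed simp
  finally show ?thesis .
qed

text \<open>Trades the cap 1 on a probability for the exponent \<open>\<kappa>\<close>, since
  \<open>min 1 y \<le> y powr \<kappa>\<close>. This is how the moment of order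
  \<open>\<kappa>\<close> enters.\<close>

lemma min_1_add_le_powr:
  fixes x y \<kappa> :: real
  assumes "0 \<le> x" "0 \<le> y" "0 < \<kappa>" "\<kappa> \<le> 1"
  shows "min 1 (x + y) \<le> x + y powr \<kappa>"
proof (cases "y < 1")
  case True
  have "y \<le> y powr \<kappa>"
  proof (cases "y = 0")
    case False
    then have "y powr 1 \<le> y powr \<kappa>" using assms True by (intro powr_mono') auto
    then show ?thesis using False assms by simp
  qed simp
  then show ?thesis by simp
next
  case False
  then have "1 \<le> y powr \<kappa>" using assms by (intro ge_one_powr_ge_zero) auto
  then show ?thesis using assms by simp
qed

text \<open>The deterministic thresholds \<open>\<tau> l\<close> keep the exploration on a scale where it has seen at most
  half of the stubs.\<close>

locale exploration_bounds =
  fixes d :: bidegree and g f :: "nat pmf" and \<tau> :: "nat \<Rightarrow> real" and e \<kappa> R \<nu> \<mu> :: real and k :: nat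
  assumes d_ne: "d \<noteq> []" and L_pos: "0 < stub_count d"
    and \<tau>_nonneg: "\<And>m. 0 \<le> \<tau> m" and \<tau>_mono: "\<And>m m'. m \<le> m' \<Longrightarrow> \<tau> m \<le> \<tau> m'"
    and \<tau>_small: "\<And>m. m \<le> k \<Longrightarrow> real m * \<tau> m \<le> real (stub_count d) / 2"
    and e_nonneg: "0 \<le> e"
    and g_close: "cdf_dist (g_emp d) (pmf g) \<le> ennreal e"
    and f_close: "cdf_dist (f_emp d) (pmf f) \<le> ennreal e"
    and \<kappa>: "0 < \<kappa>" "\<kappa> \<le> 1"
    and moment: "(\<Sum>r<length d. real (indeg d r) powr \<kappa> * real (outdeg d r) * real (indeg d r)) \<le> R"
    and g_mean: "(\<integral>\<^sup>+x. ennreal (real x) \<partial>measure_pmf g) = ennreal \<nu>" "0 \<le> \<nu>"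
    and f_mean: "(\<integral>\<^sup>+x. ennreal (real x) \<partial>measure_pmf f) = ennreal \<mu>" "1 < \<mu>"
begin

abbreviation "n \<equiv> real (length d)"
abbreviation "L \<equiv> real (stub_count d)"
abbreviation "A m X \<equiv> A_set d (X \<circ> Inl) (X \<circ> Inr) m"
abbreviation "bef m X i \<equiv> before d (X \<circ> Inl) (X \<circ> Inr) m i"
abbreviation "dis m X \<equiv> discrepancy g f d (X \<circ> Inl) (X \<circ> Inr) m"

text \<open>Determined by labels shorter than \<open>m\<close>, so restricting to it does not
  disturb resampling at generation \<open>m\<close>.\<close>

definition good :: "nat \<Rightarrow> (label + label \<Rightarrow> real) \<Rightarrow> bool" where
  "good m X \<longleftrightarrow> (\<forall>l\<in>{1..m}. real (card (A l X)) \<le> \<tau> l)"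

lemma good_Suc: "good (Suc m) X \<longleftrightarrow> good m X \<and> real (card (A (Suc m) X)) \<le> \<tau> (Suc m)"
  by (auto simp: good_def atLeastAtMostSuc_conv)

lemma good_mono: "m \<le> m' \<Longrightarrow> good m' X \<Longrightarrow> good m X"
  by (auto simp: good_def)

lemma discrete_good: "discrete_rv label_space (good m)"
proof (induction m)
  case 0
  have "good 0 = (\<lambda>X. True)" by (simp add: good_def fun_eq_iff)
  then show ?case by (simp add: discrete_rv_const)
next
  case (Suc m)
  have "discrete_rv label_space (\<lambda>X. (\<lambda>b a. b \<and> real (card a) \<le> \<tau> (Suc m)) (good m X) (A (Suc m) X))"
    by (rule discrete_rv_comp2[OF Suc discrete_A_set])
  then show ?case by (simp only: good_Suc[abs_def])
qed

lemma good_upd: "m \<le> length i \<Longrightarrow> good m (X(Inl i := u, Inr i := w)) = good m X"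
  unfolding good_def by (intro ball_cong refl) (simp only: A_set_upd atLeastAtMost_iff order_trans[of _ m "length i"])

lemma traversed_le:
  assumes "good m X"
  shows "real (traversed d (X \<circ> Inl) (X \<circ> Inr) m) \<le> real m * \<tau> m"
proof -
  have "real (traversed d (X \<circ> Inl) (X \<circ> Inr) m) \<le> (\<Sum>l\<in>{1..m}. \<tau> m)"
    unfolding traversed_def of_nat_sum
  proof (rule sum_mono)
    fix l assume l: "l \<in> {1..m}"
    have "real (card (A l X)) \<le> \<tau> l" using assms l unfolding good_def by (rule bspec)
    also have "\<tau> l \<le> \<tau> m" using l by (intro \<tau>_mono) simp
    finally show "real (card (A l X)) \<le> \<tau> m" .
  qed
  then show ?thesis by simp
qed

lemma traversed_le_half:
  assumes "good m X" "m \<le> k"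
  shows "real (traversed d (X \<circ> Inl) (X \<circ> Inr) m) \<le> L / 2"
    and "traversed d (X \<circ> Inl) (X \<circ> Inr) m \<le> stub_count d"
proof -
  show *: "real (traversed d (X \<circ> Inl) (X \<circ> Inr) m) \<le> L / 2"
    using traversed_le[OF assms(1)] \<tau>_small[OF assms(2)] by linarith
  then have "real (traversed d (X \<circ> Inl) (X \<circ> Inr) m) \<le> L" by linarith
  then show "traversed d (X \<circ> Inl) (X \<circ> Inr) m \<le> stub_count d" by simp
qed

lemma before_good:
  assumes "open_unit (X \<circ> Inl) (X \<circ> Inr)" "good m X" "1 \<le> m" "m \<le> k" "i \<in> A m X"
  shows "consistent d (bef m X i)" "real (card (paired (bef m X i))) \<le> real m * \<tau> m"
    "real (card (paired (bef m X i))) \<le> L / 2" "card (paired (bef m X i)) < stub_count d"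
proof -
  note b = before_bounds[OF assms(1) d_ne assms(3) traversed_le_half(2)[OF assms(2,4)] assms(5)]
  show "consistent d (bef m X i)" by (rule b(1))
  show "real (card (paired (bef m X i))) \<le> real m * \<tau> m"
    using b(2) traversed_le[OF assms(2)] by linarith
  then show "real (card (paired (bef m X i))) \<le> L / 2"
    using \<tau>_small[OF assms(4)] by linarith
  show "card (paired (bef m X i)) < stub_count d"
    using b(2) traversed_le_half(2)[OF assms(2,4)] by linarith
qed

text \<open>Emptying the set off the event \<open>good m\<close> turns truncated expectations into
  sums over a random set of deterministically bounded size.\<close>

definition good_A :: "nat \<Rightarrow> (label + label \<Rightarrow> real) \<Rightarrow> label set" where
  "good_A m X = (if good m X then A m X else {})"

lemma discrete_good_A: "discrete_rv label_space (good_A m)"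
  unfolding good_A_def[abs_def]
  by (rule discrete_rv_comp2[OF discrete_good discrete_A_set, where h="\<lambda>b a. if b then a else {}"])

lemma good_A_labels: "finite (good_A m X) \<and> good_A m X \<subseteq> labels"
  using A_set_labels[of d "X \<circ> Inl" "X \<circ> Inr" m] by (auto simp: good_A_def)

lemma good_A_upd: "i \<in> good_A m (X(Inl i := u, Inr i := w)) \<longleftrightarrow> i \<in> good_A m X"
proof (cases "length i = m")
  case True
  then show ?thesis unfolding good_A_def by (simp only: A_set_upd good_upd order_refl)
next
  case False
  then have "i \<notin> A m Y" for Y
    using A_set_labels[of d "Y \<circ> Inl" "Y \<circ> Inr" m] by auto
  then show ?thesis by (simp add: good_A_def)
qed

lemma good_A_card: "1 \<le> m \<Longrightarrow> real (card (good_A m X)) \<le> \<tau> m"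
  using \<tau>_nonneg by (auto simp: good_A_def good_def)

lemma nn_integral_good_A_const:
  assumes "1 \<le> m" "0 \<le> c"
  shows "(\<integral>\<^sup>+X. (\<Sum>i\<in>good_A m X. ennreal c) \<partial>label_space) \<le> ennreal (\<tau> m * c)"
proof -
  have "(\<integral>\<^sup>+X. (\<Sum>i\<in>good_A m X. ennreal c) \<partial>label_space) \<le> (\<integral>\<^sup>+X. ennreal (\<tau> m * c) \<partial>label_space)"
  proof (rule nn_integral_mono)
    fix X :: "label + label \<Rightarrow> real"
    have "(\<Sum>i\<in>good_A m X. ennreal c) = ennreal (real (card (good_A m X)) * c)"
      by (rule sum_ennreal_const[OF assms(2)])
    also have "\<dots> \<le> ennreal (\<tau> m * c)"
      using assms good_A_card by (intro ennreal_leI mult_right_mono) auto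
    finally show "(\<Sum>i\<in>good_A m X. ennreal c) \<le> ennreal (\<tau> m * c)" .
  qed
  then show ?thesis by (simp add: P.emeasure_space_1)
qed

text \<open>Given the past, a traversed stub reaches node \<open>r\<close> with probability at most \<open>D\<^sup>-\<^sub>r / (L - T)\<close>, and
  \<open>T \<le> L / 2\<close> on the event \<open>good m\<close>.\<close>

lemma nn_integral_hits_le:
  assumes m: "1 \<le> m" "m \<le> k"
  shows "(\<integral>\<^sup>+X. (\<Sum>i\<in>good_A m X. of_bool (fst (hit d (X \<circ> Inl) (X \<circ> Inr) (bef m X i) i) = r)) \<partial>label_space)
    \<le> ennreal (\<tau> m * (2 * real (indeg d r) / L))"
proof -
  have "(\<integral>\<^sup>+X. (\<Sum>i\<in>good_A m X. of_bool (fst (hit d (X \<circ> Inl) (X \<circ> Inr) (bef m X i) i) = r)) \<partial>label_space)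
      \<le> (\<integral>\<^sup>+X. (\<Sum>i\<in>good_A m X. ennreal (2 * real (indeg d r) / L)) \<partial>label_space)"
  proof (rule nn_integral_random_sum_le[OF discrete_good_A good_A_labels])
    show "(\<lambda>X. of_bool (fst (hit d (X \<circ> Inl) (X \<circ> Inr) (bef m X i) i) = r) :: ennreal) \<in> borel_measurable label_space"
      if "i \<in> labels" for i
      by (rule measurable_discrete_ennreal) (rule discrete_rv_comp[OF discrete_hit_before[OF that]])
    show "AE X in label_space. \<forall>i\<in>good_A m X. (\<integral>\<^sup>+u. \<integral>\<^sup>+w.
        of_bool (fst (hit d (X(Inl i := u, Inr i := w) \<circ> Inl) (X(Inl i := u, Inr i := w) \<circ> Inr)
          (bef m (X(Inl i := u, Inr i := w)) i) i) = r) \<partial>unif \<partial>unif) \<le> ennreal (2 * real (indeg d r) / L)"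
      using AE_open_unit
    proof eventually_elim
      case (elim X)
      show ?case
      proof
        fix i assume i: "i \<in> good_A m X"
        then have gi: "good m X" "i \<in> A m X" by (auto simp: good_A_def split: if_splits)
        have len: "length i = m" using gi(2) A_set_labels by blast
        let ?s = "bef m X i"
        note b = before_good[OF elim gi(1) m gi(2)]
        have "(\<integral>\<^sup>+u. \<integral>\<^sup>+w. of_bool (fst (hit d (X(Inl i := u, Inr i := w) \<circ> Inl) (X(Inl i := u, Inr i := w) \<circ> Inr)
            (bef m (X(Inl i := u, Inr i := w)) i) i) = r) \<partial>unif \<partial>unif)
          = (\<integral>\<^sup>+u. \<integral>\<^sup>+w. of_bool (fst (pick (candidates d ?s (quantile (h_emp d ?s) u)) w) = r) \<partial>unif \<partial>unif)"
          by (simp only: before_upd[OF len]) (simp add: comp_upd hit_def chi_def)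
        also have "\<dots> \<le> ennreal (real (indeg d r) / (L - real (card (paired ?s))))"
          by (rule hit_prob_le[OF b(1,4)])
        also have "\<dots> \<le> ennreal (2 * real (indeg d r) / L)"
        proof (rule ennreal_leI)
          have "L / 2 \<le> L - real (card (paired ?s))" using b(3) by linarith
          then have "real (indeg d r) / (L - real (card (paired ?s))) \<le> real (indeg d r) / (L / 2)"
            using L_pos by (intro divide_left_mono) auto
          then show "real (indeg d r) / (L - real (card (paired ?s))) \<le> 2 * real (indeg d r) / L"
            by (simp add: mult.commute)
        qed
        finally show "(\<integral>\<^sup>+u. \<integral>\<^sup>+w. of_bool (fst (hit d (X(Inl i := u, Inr i := w) \<circ> Inl) (X(Inl i := u, Inr i := w) \<circ> Inr)
            (bef m (X(Inl i := u, Inr i := w)) i) i) = r) \<partial>unif \<partial>unif) \<le> ennreal (2 * real (indeg d r) / L)" .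
      qed
    qed
  qed (use good_A_upd in auto)
  also have "\<dots> \<le> ennreal (\<tau> m * (2 * real (indeg d r) / L))"
    by (rule nn_integral_good_A_const[OF m(1)]) simp
  finally show ?thesis .
qed

text \<open>Union bound: a node active after step \<open>m + 2\<close> was active before or is hit
  from generation \<open>m + 1\<close>. The root contributes \<open>1 / n\<close>.\<close>

lemma nn_integral_active_le:
  "m \<le> k \<Longrightarrow> (\<integral>\<^sup>+X. of_bool (good m X \<and> r \<in> active (expl d X (Suc m))) \<partial>label_space)
    \<le> ennreal (1 / n + 2 * real m * \<tau> m * real (indeg d r) / L)"
proof (induction m)
  case 0
  then show ?case using root_prob_le[OF d_ne, of r] by (simp add: good_def)
next
  case (Suc m)
  let ?h = "\<lambda>X i. fst (hit d (X \<circ> Inl) (X \<circ> Inr) (bef (Suc m) X i) i)"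
  have meas1: "(\<lambda>X. of_bool (good m X \<and> r \<in> active (expl d X (Suc m))) :: ennreal) \<in> borel_measurable label_space"
    by (rule measurable_discrete_ennreal)
       (rule discrete_rv_comp2[OF discrete_good discrete_explore, where h="\<lambda>b s. of_bool (b \<and> r \<in> active s)"])
  have meas2: "(\<lambda>X. \<Sum>i\<in>good_A (Suc m) X. of_bool (?h X i = r) :: ennreal) \<in> borel_measurable label_space"
  proof (rule measurable_random_sum[OF discrete_good_A])
    show "good_A (Suc m) X \<subseteq> labels" for X using good_A_labels by blast
    show "(\<lambda>X. of_bool (?h X i = r) :: ennreal) \<in> borel_measurable label_space" if "i \<in> labels" for i
      by (rule measurable_discrete_ennreal) (rule discrete_rv_comp[OF discrete_hit_before[OF that]])
  qed
  have "(\<integral>\<^sup>+X. of_bool (good (Suc m) X \<and> r \<in> active (expl d X (Suc (Suc m)))) \<partial>label_space)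
      \<le> (\<integral>\<^sup>+X. of_bool (good m X \<and> r \<in> active (expl d X (Suc m)))
          + (\<Sum>i\<in>good_A (Suc m) X. of_bool (?h X i = r)) \<partial>label_space)"
  proof (rule nn_integral_mono)
    fix X :: "label + label \<Rightarrow> real"
    show "of_bool (good (Suc m) X \<and> r \<in> active (expl d X (Suc (Suc m))))
      \<le> of_bool (good m X \<and> r \<in> active (expl d X (Suc m))) + (\<Sum>i\<in>good_A (Suc m) X. of_bool (?h X i = r) :: ennreal)"
    proof (cases "good (Suc m) X \<and> r \<in> active (expl d X (Suc (Suc m)))")
      case True
      then have gm: "good m X" by (simp add: good_Suc)
      have "active (expl d X (Suc (Suc m))) = active (expl d X (Suc m)) \<union> ?h X ` A (Suc m) X"
        by (rule active_explore_Suc) simp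
      then consider "r \<in> active (expl d X (Suc m))" | i where "i \<in> A (Suc m) X" "?h X i = r"
        using True by auto
      then show ?thesis
      proof cases
        case 1
        then show ?thesis using True gm by simp
      next
        case 2
        then have "i \<in> good_A (Suc m) X" using True by (simp add: good_A_def)
        then have "of_bool (?h X i = r) \<le> (\<Sum>i\<in>good_A (Suc m) X. of_bool (?h X i = r) :: ennreal)"
          using good_A_labels by (intro member_le_sum) auto
        then have "1 \<le> (\<Sum>i\<in>good_A (Suc m) X. of_bool (?h X i = r) :: ennreal)" using 2 by simp
        then show ?thesis using True by (auto intro: add_increasing)
      qed
    next
      case False
      then have "of_bool (good (Suc m) X \<and> r \<in> active (expl d X (Suc (Suc m)))) = (0::ennreal)"
        by (simp only: of_bool_def if_False)
      then show ?thesis by (simp only: zero_le)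
    qed
  qed
  also have "\<dots> = (\<integral>\<^sup>+X. of_bool (good m X \<and> r \<in> active (expl d X (Suc m))) \<partial>label_space)
      + (\<integral>\<^sup>+X. (\<Sum>i\<in>good_A (Suc m) X. of_bool (?h X i = r)) \<partial>label_space)"
    by (rule nn_integral_add[OF meas1 meas2])
  also have "\<dots> \<le> ennreal (1 / n + 2 * real m * \<tau> m * real (indeg d r) / L)
      + ennreal (\<tau> (Suc m) * (2 * real (indeg d r) / L))"
    by (rule add_mono[OF Suc.IH nn_integral_hits_le]) (use Suc.prems in auto)
  also have "\<dots> = ennreal (1 / n + 2 * real m * \<tau> m * real (indeg d r) / L + \<tau> (Suc m) * (2 * real (indeg d r) / L))"
    using \<tau>_nonneg by (intro ennreal_plus[symmetric]) (auto intro!: add_nonneg_nonneg divide_nonneg_nonneg mult_nonneg_nonneg)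
  also have "\<dots> \<le> ennreal (1 / n + 2 * real (Suc m) * \<tau> (Suc m) * real (indeg d r) / L)"
  proof (rule ennreal_leI)
    \<comment> \<open>Monotonicity of \<open>\<tau>\<close> replaces the sum of the thresholds by
      \<open>m\<close> times the last one.\<close>
    have "2 * real m * \<tau> m * real (indeg d r) / L \<le> 2 * real m * \<tau> (Suc m) * real (indeg d r) / L"
      using \<tau>_mono[of m "Suc m"] by (intro divide_right_mono mult_right_mono mult_left_mono) auto
    then show "1 / n + 2 * real m * \<tau> m * real (indeg d r) / L + \<tau> (Suc m) * (2 * real (indeg d r) / L)
        \<le> 1 / n + 2 * real (Suc m) * \<tau> (Suc m) * real (indeg d r) / L"
      by (simp add: algebra_simps add_divide_distrib)
  qed
  finally show ?case .
qed

text \<open>Nodes without inbound stubs contribute nothing, and for all others the factor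
  \<open>indeg d r powr \<kappa>\<close> is at least 1; so the moment bound also bounds the plain
  product sum.\<close>

lemma degree_product_le: "degree_product d \<le> R" "0 \<le> degree_product d" "0 \<le> R"
proof -
  have "degree_product d \<le> (\<Sum>r<length d. real (indeg d r) powr \<kappa> * real (outdeg d r) * real (indeg d r))"
    unfolding degree_product_def
  proof (rule sum_mono)
    fix r
    show "real (outdeg d r) * real (indeg d r) \<le> real (indeg d r) powr \<kappa> * real (outdeg d r) * real (indeg d r)"
    proof (cases "indeg d r = 0")
      case False
      then have "1 \<le> real (indeg d r) powr \<kappa>" using \<kappa> by (intro ge_one_powr_ge_zero) auto
      then have "1 * (real (outdeg d r) * real (indeg d r)) \<le> real (indeg d r) powr \<kappa> * (real (outdeg d r) * real (indeg d r))"
        by (intro mult_right_mono) auto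
      then show ?thesis by (simp add: mult.assoc)
    qed simp
  qed
  then show *: "degree_product d \<le> R" using moment by linarith
  show **: "0 \<le> degree_product d" unfolding degree_product_def by (intro sum_nonneg) auto
  show "0 \<le> R" using * ** by linarith
qed

text \<open>Bounds the expected \<open>active_product\<close> after step \<open>m + 1\<close> on
  \<open>good m\<close>: the root gives \<open>R / n\<close>, the hits give the other term.\<close>

definition act_bound :: "nat \<Rightarrow> real" where
  "act_bound m = R / n + (2 * real m * \<tau> m / L) powr \<kappa> * R"

lemma act_bound_nonneg: "0 \<le> act_bound m"
  using degree_product_le by (simp add: act_bound_def)

lemma nn_integral_active_product_le:
  assumes "m \<le> k"
  shows "(\<integral>\<^sup>+X. of_bool (good m X) * ennreal (active_product d (active (expl d X (Suc m)))) \<partial>label_space)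
    \<le> ennreal (act_bound m)"
proof -
  let ?c = "\<lambda>r. real (outdeg d r) * real (indeg d r)"
  \<comment> \<open>The cap 1 allows the factor \<open>indeg d r\<close> to be replaced by its power
    \<open>\<kappa>\<close>, which is what the moment bound controls.\<close>
  let ?p = "\<lambda>r. min 1 (1 / n + 2 * real m * \<tau> m * real (indeg d r) / L)"
  have y0: "0 \<le> 2 * real m * \<tau> m / L" using \<tau>_nonneg by simp
  have p0: "0 \<le> ?p r" for r
  proof -
    have "0 \<le> 2 * real m * \<tau> m / L * real (indeg d r)" using y0 by (rule mult_nonneg_nonneg) simp
    then show ?thesis by simp
  qed
  have meas: "(\<lambda>X. of_bool (good m X \<and> r \<in> active (expl d X (Suc m))) :: ennreal) \<in> borel_measurable label_space" for r
    by (rule measurable_discrete_ennreal)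
       (rule discrete_rv_comp2[OF discrete_good discrete_explore, where h="\<lambda>b s. of_bool (b \<and> r \<in> active s)"])
  have one: "(\<integral>\<^sup>+X. of_bool (good m X \<and> r \<in> active (expl d X (Suc m))) \<partial>label_space) \<le> ennreal (?p r)" for r
  proof -
    have "(\<integral>\<^sup>+X. of_bool (good m X \<and> r \<in> active (expl d X (Suc m))) \<partial>label_space) \<le> (\<integral>\<^sup>+X. 1 \<partial>label_space)"
      by (intro nn_integral_mono) auto
    then have "(\<integral>\<^sup>+X. of_bool (good m X \<and> r \<in> active (expl d X (Suc m))) \<partial>label_space) \<le> 1"
      by (simp add: P.emeasure_space_1)
    then show ?thesis using nn_integral_active_le[OF assms, of r] by (simp add: min_def)
  qed
  have "(\<integral>\<^sup>+X. of_bool (good m X) * ennreal (active_product d (active (expl d X (Suc m)))) \<partial>label_space)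
      = (\<integral>\<^sup>+X. (\<Sum>r<length d. ennreal (?c r) * of_bool (good m X \<and> r \<in> active (expl d X (Suc m)))) \<partial>label_space)"
  proof (rule nn_integral_cong)
    fix X :: "label + label \<Rightarrow> real"
    have "ennreal (active_product d (active (expl d X (Suc m))))
        = (\<Sum>r<length d. ennreal (?c r * of_bool (r \<in> active (expl d X (Suc m)))))"
      unfolding active_product_def by (rule sum_ennreal[symmetric]) auto
    also have "\<dots> = (\<Sum>r<length d. ennreal (?c r) * of_bool (r \<in> active (expl d X (Suc m))))"
      by (intro sum.cong) auto
    finally show "of_bool (good m X) * ennreal (active_product d (active (expl d X (Suc m))))
        = (\<Sum>r<length d. ennreal (?c r) * of_bool (good m X \<and> r \<in> active (expl d X (Suc m))))"
      by (cases "good m X") simp_all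
  qed
  also have "\<dots> = (\<Sum>r<length d. ennreal (?c r) * (\<integral>\<^sup>+X. of_bool (good m X \<and> r \<in> active (expl d X (Suc m))) \<partial>label_space))"
    using meas by (subst nn_integral_sum) (auto intro!: sum.cong nn_integral_cmult)
  also have "\<dots> \<le> (\<Sum>r<length d. ennreal (?c r) * ennreal (?p r))"
    by (intro sum_mono mult_left_mono one) simp
  also have "\<dots> = (\<Sum>r<length d. ennreal (?c r * ?p r))"
    by (intro sum.cong refl ennreal_mult[symmetric] p0) simp
  also have "\<dots> = ennreal (\<Sum>r<length d. ?c r * ?p r)"
    by (intro sum_ennreal mult_nonneg_nonneg p0) auto
  also have "\<dots> \<le> ennreal (act_bound m)"
  proof (rule ennreal_leI)
    let ?y = "2 * real m * \<tau> m / L"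
    have "(\<Sum>r<length d. ?c r * ?p r) \<le> (\<Sum>r<length d. ?c r * (1 / n + ?y powr \<kappa> * real (indeg d r) powr \<kappa>))"
    proof (intro sum_mono mult_left_mono)
      fix r
      have yr: "0 \<le> ?y * real (indeg d r)" by (rule mult_nonneg_nonneg[OF y0]) simp
      have "?p r = min 1 (1 / n + ?y * real (indeg d r))" by simp
      also have "\<dots> \<le> 1 / n + (?y * real (indeg d r)) powr \<kappa>"
        by (rule min_1_add_le_powr[OF _ yr \<kappa>]) simp
      also have "(?y * real (indeg d r)) powr \<kappa> = ?y powr \<kappa> * real (indeg d r) powr \<kappa>"
        by (rule powr_mult)
      finally show "?p r \<le> 1 / n + ?y powr \<kappa> * real (indeg d r) powr \<kappa>" .
    qed simp
    also have "\<dots> = degree_product d / n + ?y powr \<kappa> * (\<Sum>r<length d. real (indeg d r) powr \<kappa> * real (outdeg d r) * real (indeg d r))"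
      by (simp add: degree_product_def sum_distrib_left sum_divide_distrib sum.distrib[symmetric] algebra_simps)
    also have "\<dots> \<le> act_bound m"
      unfolding act_bound_def using degree_product_le moment
      by (intro add_mono divide_right_mono mult_left_mono) auto
    finally show "(\<Sum>r<length d. ?c r * ?p r) \<le> act_bound m" .
  qed
  finally show ?thesis .
qed

text \<open>At most \<open>\<tau> m\<close> stubs, each costing three parts of the Wasserstein
  distance to \<open>f\<close>: from \<open>f_emp\<close> to the limit, the changed normalization
  after \<open>T \<le> m * \<tau> m \<le> L / 2\<close> pairings, and the active nodes.\<close>

definition step_error :: "nat \<Rightarrow> real" where
  "step_error m = \<tau> m * (e + 2 * real m * \<tau> m * R / L\<^sup>2 + act_bound m / L)"

lemma step_error_nonneg: "0 \<le> step_error m"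
  unfolding step_error_def using \<tau>_nonneg e_nonneg degree_product_le act_bound_nonneg
  by (intro mult_nonneg_nonneg add_nonneg_nonneg divide_nonneg_nonneg) auto

lemma nn_integral_step_error_le:
  assumes m: "1 \<le> m" "m \<le> k"
  shows "(\<integral>\<^sup>+X. (\<Sum>i\<in>good_A m X. ennreal \<bar>real (chi d (X \<circ> Inl) (bef m X i) i)
      - real (chi_hat g f (X \<circ> Inl) i)\<bar>) \<partial>label_space) \<le> ennreal (step_error m)"
proof -
  let ?D = "\<lambda>X i. ennreal \<bar>real (chi d (X \<circ> Inl) (bef m X i) i) - real (chi_hat g f (X \<circ> Inl) i)\<bar>"
  let ?a = "\<lambda>X. active_product d (active (expl d X (Suc m)))"
  let ?c = "e + 2 * real m * \<tau> m * R / L\<^sup>2"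
  have c0: "0 \<le> ?c"
    using \<tau>_nonneg e_nonneg degree_product_le
    by (intro add_nonneg_nonneg divide_nonneg_nonneg mult_nonneg_nonneg) auto
  have a0: "0 \<le> active_product d a" for a
    unfolding active_product_def by (intro sum_nonneg) auto
  have meas_a: "(\<lambda>X. ennreal (?c + ?a X / L)) \<in> borel_measurable label_space"
    by (rule measurable_discrete_ennreal)
       (rule discrete_rv_comp[OF discrete_explore, where h="\<lambda>s. ennreal (?c + active_product d (active s) / L)"])
  have "(\<integral>\<^sup>+X. (\<Sum>i\<in>good_A m X. ?D X i) \<partial>label_space)
      \<le> (\<integral>\<^sup>+X. (\<Sum>i\<in>good_A m X. ennreal (?c + ?a X / L)) \<partial>label_space)"
  proof (rule nn_integral_random_sum_le[OF discrete_good_A good_A_labels])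
    show "(\<lambda>X. ?D X i) \<in> borel_measurable label_space" if "i \<in> labels" for i
      by (rule measurable_discrete_ennreal)
         (rule discrete_rv_comp2[OF discrete_chi_before[OF that] discrete_chi_hat[OF that], where h="\<lambda>a b. ennreal \<bar>real a - real b\<bar>"])
    show "AE X in label_space. \<forall>i\<in>good_A m X.
        (\<integral>\<^sup>+u. \<integral>\<^sup>+w. ?D (X(Inl i := u, Inr i := w)) i \<partial>unif \<partial>unif) \<le> ennreal (?c + ?a X / L)"
      using AE_open_unit
    proof eventually_elim
      case (elim X)
      show ?case
      proof
        fix i assume i: "i \<in> good_A m X"
        then have gi: "good m X" "i \<in> A m X" by (auto simp: good_A_def split: if_splits)
        have len: "length i = m" using gi(2) A_set_labels by blast
        then have ne: "i \<noteq> []" using m by auto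
        let ?s = "bef m X i"
        let ?T = "real (card (paired ?s))"
        note b = before_good[OF elim gi(1) m gi(2)]
        have TL: "?T < L" using b(4) by simp
        have "(\<integral>\<^sup>+u. \<integral>\<^sup>+w. ?D (X(Inl i := u, Inr i := w)) i \<partial>unif \<partial>unif)
            = (\<integral>\<^sup>+u. ennreal \<bar>real (quantile (h_emp d ?s) u) - real (quantile (pmf f) u)\<bar> \<partial>unif)"
          by (simp only: before_upd[OF len])
             (simp add: comp_upd chi_def chi_hat_def ne unif.emeasure_space_1[simplified])
        also have "\<dots> = cdf_dist (h_emp d ?s) (pmf f)"
          by (rule nn_integral_quantile_dist[OF mass_function_h_emp[OF b(1,4)] mass_function_pmf])
        also have "\<dots> \<le> cdf_dist (h_emp d ?s) (f_emp d) + cdf_dist (f_emp d) (pmf f)"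
          by (rule cdf_dist_triangle)
        also have "\<dots> \<le> ennreal (active_product d (active ?s) / L + ?T / (L * (L - ?T)) * degree_product d) + ennreal e"
          by (intro add_mono f_close cdf_dist_h_f refl TL)
        also have "\<dots> = ennreal (active_product d (active ?s) / L + ?T / (L * (L - ?T)) * degree_product d + e)"
          using a0 TL e_nonneg degree_product_le
          by (intro ennreal_plus[symmetric] add_nonneg_nonneg mult_nonneg_nonneg divide_nonneg_nonneg) auto
        also have "\<dots> \<le> ennreal (?c + ?a X / L)"
        proof (rule ennreal_leI)
          \<comment> \<open>Passing to the nodes active at the end of the step gives a bound common
            to all \<open>i\<close>. It may depend on the variables at \<open>i\<close>, because
            \<open>nn_integral_random_sum_le\<close> resamples only the left-hand side.\<close>
          have "active_product d (active ?s) \<le> ?a X"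
            unfolding active_product_def
            using active_before_subset[OF m(1), of d "X \<circ> Inl" "X \<circ> Inr" i]
            by (intro sum_mono mult_left_mono) auto
          then have 1: "active_product d (active ?s) / L \<le> ?a X / L" by (rule divide_right_mono) simp
          have "L / 2 \<le> L - ?T" using b(3) by linarith
          then have "L * (L / 2) \<le> L * (L - ?T)" by (intro mult_left_mono) auto
          then have "?T / (L * (L - ?T)) \<le> ?T / (L * (L / 2))"
            using L_pos TL by (intro divide_left_mono) (auto intro!: mult_pos_pos)
          also have "\<dots> \<le> real m * \<tau> m / (L * (L / 2))"
            using b(2) by (intro divide_right_mono) auto
          finally have "?T / (L * (L - ?T)) * degree_product d \<le> real m * \<tau> m / (L * (L / 2)) * R"
            using degree_product_le \<tau>_nonneg by (intro mult_mono) auto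
          also have "\<dots> = 2 * real m * \<tau> m * R / L\<^sup>2"
            by (simp add: power2_eq_square)
          finally show "active_product d (active ?s) / L + ?T / (L * (L - ?T)) * degree_product d + e \<le> ?c + ?a X / L"
            using 1 by linarith
        qed
        finally show "(\<integral>\<^sup>+u. \<integral>\<^sup>+w. ?D (X(Inl i := u, Inr i := w)) i \<partial>unif \<partial>unif) \<le> ennreal (?c + ?a X / L)" .
      qed
    qed
  qed (use good_A_upd meas_a in auto)
  also have "\<dots> \<le> (\<integral>\<^sup>+X. ennreal (\<tau> m * ?c) + ennreal (\<tau> m / L) * (of_bool (good m X) * ennreal (?a X)) \<partial>label_space)"
  proof (rule nn_integral_mono)
    fix X :: "label + label \<Rightarrow> real"
    show "(\<Sum>i\<in>good_A m X. ennreal (?c + ?a X / L))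
        \<le> ennreal (\<tau> m * ?c) + ennreal (\<tau> m / L) * (of_bool (good m X) * ennreal (?a X))"
    proof (cases "good m X")
      case True
      have ca: "0 \<le> ?c + ?a X / L" by (rule add_nonneg_nonneg[OF c0 divide_nonneg_nonneg[OF a0]]) simp
      have "(\<Sum>i\<in>good_A m X. ennreal (?c + ?a X / L)) = ennreal (real (card (good_A m X)) * (?c + ?a X / L))"
        by (rule sum_ennreal_const[OF ca])
      also have "\<dots> \<le> ennreal (\<tau> m * (?c + ?a X / L))"
        by (intro ennreal_leI mult_right_mono ca good_A_card m(1))
      also have "\<tau> m * (?c + ?a X / L) = \<tau> m * ?c + \<tau> m / L * ?a X" by (simp add: algebra_simps)
      also have "ennreal \<dots> = ennreal (\<tau> m * ?c) + ennreal (\<tau> m / L) * ennreal (?a X)"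
        by (intro ennreal_affine mult_nonneg_nonneg divide_nonneg_nonneg c0 a0 \<tau>_nonneg) simp
      finally show ?thesis by (simp only: True of_bool_eq mult_1)
    qed (simp add: good_A_def)
  qed
  also have "\<dots> = ennreal (\<tau> m * ?c) + ennreal (\<tau> m / L) * (\<integral>\<^sup>+X. of_bool (good m X) * ennreal (?a X) \<partial>label_space)"
  proof -
    have meas: "(\<lambda>X. of_bool (good m X) * ennreal (?a X)) \<in> borel_measurable label_space"
      by (rule measurable_discrete_ennreal)
         (rule discrete_rv_comp2[OF discrete_good discrete_explore, where h="\<lambda>b s. of_bool b * ennreal (active_product d (active s))"])
    then show ?thesis
      by (subst nn_integral_add) (auto simp: nn_integral_cmult P.emeasure_space_1)
  qed
  also have "\<dots> \<le> ennreal (\<tau> m * ?c) + ennreal (\<tau> m / L) * ennreal (act_bound m)"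
    by (intro add_left_mono mult_left_mono nn_integral_active_product_le m) simp
  also have "\<dots> = ennreal (\<tau> m * ?c + \<tau> m / L * act_bound m)"
    by (intro ennreal_affine[symmetric] mult_nonneg_nonneg divide_nonneg_nonneg c0 act_bound_nonneg \<tau>_nonneg) simp
  also have "\<tau> m * ?c + \<tau> m / L * act_bound m = step_error m"
    by (simp add: step_error_def algebra_simps)
  finally show ?thesis .
qed

text \<open>Solution of the recursion in \<open>disc_bound_Suc\<close>. The index is shifted: this
  bounds generation \<open>m + 1\<close>, and the value at 0 comes from the root alone.\<close>

definition disc_bound :: "nat \<Rightarrow> real" where
  "disc_bound m = \<mu> ^ m * e + (\<Sum>l\<in>{1..m}. \<mu> ^ (m - l) * step_error l)"

lemma disc_bound_nonneg: "0 \<le> disc_bound m"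
  unfolding disc_bound_def using f_mean e_nonneg step_error_nonneg
  by (intro add_nonneg_nonneg sum_nonneg mult_nonneg_nonneg) auto

lemma disc_bound_Suc: "disc_bound (Suc m) = \<mu> * disc_bound m + step_error (Suc m)"
proof -
  have "(\<Sum>l\<in>{1..Suc m}. \<mu> ^ (Suc m - l) * step_error l)
      = (\<Sum>l\<in>{1..m}. \<mu> ^ (Suc m - l) * step_error l) + step_error (Suc m)"
    by simp
  also have "(\<Sum>l\<in>{1..m}. \<mu> ^ (Suc m - l) * step_error l) = \<mu> * (\<Sum>l\<in>{1..m}. \<mu> ^ (m - l) * step_error l)"
    unfolding sum_distrib_left by (intro sum.cong) (auto simp: Suc_diff_le mult.assoc)
  finally show ?thesis by (simp add: disc_bound_def algebra_simps)
qed

text \<open>Expectations in \<open>card_discrepancy_Suc\<close>: members of the discrepancy multiply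
  by \<open>\<mu>\<close> on average, and the stubs of \<open>A_set\<close> add
  \<open>step_error\<close>. Both sets are cut to \<open>good\<close>, which supplies the bound on
  \<open>traversed\<close> behind the recursion.\<close>

lemma nn_integral_discrepancy_le:
  "m \<le> k \<Longrightarrow> (\<integral>\<^sup>+X. of_bool (good m X) * of_nat (card (dis (Suc m) X)) \<partial>label_space) \<le> ennreal (disc_bound m)"
proof (induction m)
  case 0
  have nil: "[] \<in> labels" by (simp add: labels_def)
  have "(\<integral>\<^sup>+X. of_bool (good 0 X) * of_nat (card (dis (Suc 0) X)) \<partial>label_space)
      \<le> (\<integral>\<^sup>+X. ennreal \<bar>real (quantile (g_emp d) (X (Inl []))) - real (quantile (pmf g) (X (Inl [])))\<bar> \<partial>label_space)"
  proof (rule nn_integral_mono)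
    fix X :: "label + label \<Rightarrow> real"
    have "real (card (dis (Suc 0) X)) \<le> \<bar>real (quantile (g_emp d) (X (Inl []))) - real (quantile (pmf g) (X (Inl [])))\<bar>"
      using card_discrepancy_1[of g f d "X \<circ> Inl" "X \<circ> Inr"] by simp
    then have "of_nat (card (dis (Suc 0) X)) \<le> ennreal \<bar>real (quantile (g_emp d) (X (Inl []))) - real (quantile (pmf g) (X (Inl [])))\<bar>"
      unfolding ennreal_of_nat_eq_real_of_nat by (rule ennreal_leI)
    then show "of_bool (good 0 X) * of_nat (card (dis (Suc 0) X))
        \<le> ennreal \<bar>real (quantile (g_emp d) (X (Inl []))) - real (quantile (pmf g) (X (Inl [])))\<bar>"
      by (simp add: good_def)
  qed
  also have "\<dots> = (\<integral>\<^sup>+x. ennreal \<bar>real (quantile (g_emp d) x) - real (quantile (pmf g) x)\<bar> \<partial>unif)"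
    by (rule nn_integral_coord[OF nil]) measurable
  also have "\<dots> = cdf_dist (g_emp d) (pmf g)"
    by (rule nn_integral_quantile_dist[OF mass_function_g_emp[OF d_ne] mass_function_pmf])
  also have "\<dots> \<le> ennreal (disc_bound 0)" using g_close by (simp add: disc_bound_def)
  finally show ?case .
next
  case (Suc m)
  let ?S = "Suc m"
  define B where "B X = (if good ?S X then dis ?S X else {})" for X
  let ?D = "\<lambda>X i. ennreal \<bar>real (chi d (X \<circ> Inl) (bef ?S X i) i) - real (chi_hat g f (X \<circ> Inl) i)\<bar>"
  have B_disc: "discrete_rv label_space B"
    unfolding B_def[abs_def]
    by (rule discrete_rv_comp2[OF discrete_good discrete_discrepancy, where h="\<lambda>b a. if b then a else {}"])
  have dis_labels: "dis ?S X \<subseteq> {i \<in> labels. length i = ?S}" for X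
    using A_set_labels A_hat_labels unfolding discrepancy_def by blast
  have B_labels: "finite (B X) \<and> B X \<subseteq> labels - {[]}" for X
    using dis_labels[of X] by (auto simp: B_def)
  have B_upd: "i \<in> B (X(Inl i := u, Inr i := w)) \<longleftrightarrow> i \<in> B X" for X i u w
  proof (cases "length i = ?S")
    case True
    then show ?thesis
      unfolding B_def discrepancy_def by (simp only: A_set_upd A_hat_upd good_upd order_refl)
  next
    case False
    then have "i \<notin> dis ?S Y" for Y
    using dis_labels[of Y] by auto
  then show ?thesis by (simp add: B_def)
  qed
  have meas1: "(\<lambda>X. \<Sum>i\<in>B X. ennreal (real (chi_hat g f (X \<circ> Inl) i))) \<in> borel_measurable label_space"
  proof (rule measurable_random_sum[OF B_disc])
    show "B X \<subseteq> labels" for X using B_labels by blast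
    show "(\<lambda>X. ennreal (real (chi_hat g f (X \<circ> Inl) i))) \<in> borel_measurable label_space" if "i \<in> labels" for i
      by (rule measurable_discrete_ennreal) (rule discrete_rv_comp[OF discrete_chi_hat[OF that]])
  qed
  have meas2: "(\<lambda>X. \<Sum>i\<in>good_A ?S X. ?D X i) \<in> borel_measurable label_space"
  proof (rule measurable_random_sum[OF discrete_good_A])
    show "good_A ?S X \<subseteq> labels" for X using good_A_labels by blast
    show "(\<lambda>X. ?D X i) \<in> borel_measurable label_space" if "i \<in> labels" for i
      by (rule measurable_discrete_ennreal)
         (rule discrete_rv_comp2[OF discrete_chi_before[OF that] discrete_chi_hat[OF that], where h="\<lambda>a b. ennreal \<bar>real a - real b\<bar>"])
  qed
  have "(\<integral>\<^sup>+X. of_nat (card (B X)) \<partial>label_space)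
      \<le> (\<integral>\<^sup>+X. of_bool (good m X) * of_nat (card (dis (Suc m) X)) \<partial>label_space)"
    by (intro nn_integral_mono) (auto simp: B_def good_Suc)
  also have "\<dots> \<le> ennreal (disc_bound m)" by (rule Suc.IH) (use Suc.prems in simp)
  finally have card_B: "(\<integral>\<^sup>+X. of_nat (card (B X)) \<partial>label_space) \<le> ennreal (disc_bound m)" .
  have "(\<integral>\<^sup>+X. of_bool (good ?S X) * of_nat (card (dis (Suc ?S) X)) \<partial>label_space)
      \<le> (\<integral>\<^sup>+X. (\<Sum>i\<in>B X. ennreal (real (chi_hat g f (X \<circ> Inl) i))) + (\<Sum>i\<in>good_A ?S X. ?D X i) \<partial>label_space)"
  proof (rule nn_integral_mono_AE)
    show "AE X in label_space. of_bool (good ?S X) * of_nat (card (dis (Suc ?S) X))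
        \<le> (\<Sum>i\<in>B X. ennreal (real (chi_hat g f (X \<circ> Inl) i))) + (\<Sum>i\<in>good_A ?S X. ?D X i)"
      using AE_open_unit
    proof eventually_elim
      case (elim X)
      show ?case
      proof (cases "good ?S X")
        case True
        have "real (card (dis (Suc ?S) X)) \<le> (\<Sum>i\<in>dis ?S X. real (chi_hat g f (X \<circ> Inl) i))
            + (\<Sum>i\<in>A ?S X. \<bar>real (chi d (X \<circ> Inl) (bef ?S X i) i) - real (chi_hat g f (X \<circ> Inl) i)\<bar>)"
          by (rule card_discrepancy_Suc[OF elim d_ne _ traversed_le_half(2)[OF True Suc.prems]]) simp
        then have "of_nat (card (dis (Suc ?S) X)) \<le> ennreal ((\<Sum>i\<in>dis ?S X. real (chi_hat g f (X \<circ> Inl) i))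
            + (\<Sum>i\<in>A ?S X. \<bar>real (chi d (X \<circ> Inl) (bef ?S X i) i) - real (chi_hat g f (X \<circ> Inl) i)\<bar>))"
          unfolding ennreal_of_nat_eq_real_of_nat by (rule ennreal_leI)
        also have "\<dots> = (\<Sum>i\<in>B X. ennreal (real (chi_hat g f (X \<circ> Inl) i))) + (\<Sum>i\<in>good_A ?S X. ?D X i)"
          using True by (subst ennreal_plus) (auto simp: B_def good_A_def sum_nonneg sum_ennreal simp del: of_nat_sum)
        finally show ?thesis using True by simp
      qed simp
    qed
  qed
  also have "\<dots> = (\<integral>\<^sup>+X. (\<Sum>i\<in>B X. ennreal (real (chi_hat g f (X \<circ> Inl) i))) \<partial>label_space)
      + (\<integral>\<^sup>+X. (\<Sum>i\<in>good_A ?S X. ?D X i) \<partial>label_space)"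
    by (rule nn_integral_add[OF meas1 meas2])
  also have "\<dots> \<le> ennreal \<mu> * (\<integral>\<^sup>+X. of_nat (card (B X)) \<partial>label_space) + ennreal (step_error ?S)"
    by (intro add_mono nn_integral_chi_hat_le[OF f_mean(1) B_disc B_labels B_upd] nn_integral_step_error_le)
       (use Suc.prems in auto)
  also have "\<dots> \<le> ennreal \<mu> * ennreal (disc_bound m) + ennreal (step_error ?S)"
    by (rule add_right_mono, rule mult_left_mono[OF card_B]) simp
  also have "ennreal \<mu> * ennreal (disc_bound m) + ennreal (step_error ?S) = ennreal (disc_bound (Suc m))"
    using f_mean disc_bound_nonneg step_error_nonneg
    by (simp add: disc_bound_Suc ennreal_mult[symmetric] ennreal_plus[symmetric] del: ennreal_plus)
  finally show ?case .
qed

end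

section \<open>From expectations to the coupling event\<close>

lemma A_set_empty_mono:
  assumes "A_set d u w j = {}" "1 \<le> j" "j \<le> m"
  shows "A_set d u w m = {}"
  using assms(3) by (induction m rule: dec_induct) (use assms A_set_empty_Suc in auto)

lemma A_hat_empty_mono:
  assumes "A_hat g f u j = {}" "j \<le> m"
  shows "A_hat g f u m = {}"
  using assms(2) by (induction m rule: dec_induct) (use assms in auto)

lemma coupled_uptoI:
  assumes disc: "\<And>m. m \<in> {1..k} \<Longrightarrow> real (card (discrepancy g f d u w m)) \<le> c m"
    and growth: "\<And>m. j \<le> m \<Longrightarrow> m < k \<Longrightarrow> 0 < Z_hat g f u m \<Longrightarrow> \<theta> * real (Z_hat g f u m) \<le> real (Z_hat g f u (Suc m))"
    and j: "1 \<le> j" and \<theta>: "0 < \<theta>"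
    and c_lt: "\<And>m. m \<le> j \<Longrightarrow> c m < 1"
    and c_le: "\<And>m. j \<le> m \<Longrightarrow> m \<le> k \<Longrightarrow> c m \<le> \<theta> ^ (m - j) * real (length d) powr (- \<gamma>)"
  shows "coupled_upto g f d u w \<gamma> k"
proof -
  \<comment> \<open>A cardinality below 1 is 0.\<close>
  have empty: "discrepancy g f d u w m = {}" if "m \<in> {1..k}" "m \<le> j" for m
    using disc[OF that(1)] c_lt[OF that(2)] by (auto simp: card_eq_0_iff dest: order_le_less_trans)
  \<comment> \<open>Growth is only given for positive sizes, so the induction carries positivity
    along, starting from at least one individual in generation \<open>j\<close>.\<close>
  have growth': "\<theta> ^ (m - j) \<le> real (Z_hat g f u m)" if "j \<le> m" "m \<le> k" "0 < Z_hat g f u j" for m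
    using that
  proof (induction m rule: dec_induct)
    case (step m)
    have IH: "\<theta> ^ (m - j) \<le> real (Z_hat g f u m)" using step by simp
    moreover have "0 < \<theta> ^ (m - j)" using \<theta> by simp
    ultimately have "0 < Z_hat g f u m" by linarith
    then have "\<theta> * real (Z_hat g f u m) \<le> real (Z_hat g f u (Suc m))" using step by (intro growth) auto
    moreover have "\<theta> * \<theta> ^ (m - j) \<le> \<theta> * real (Z_hat g f u m)" using IH \<theta> by (intro mult_left_mono) auto
    ultimately show ?case using step by (simp add: Suc_diff_le)
  qed auto
  have bound: "real (card (discrepancy g f d u w m)) \<le> real (Z_hat g f u m) * real (length d) powr (- \<gamma>)"
    if m: "m \<in> {1..k}" for m
  proof (cases "m \<le> j")
    case True
    then show ?thesis using empty[OF m] by simp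
  next
    case False
    show ?thesis
    proof (cases "Z_hat g f u j = 0")
      case True
      \<comment> \<open>Exact coupling in generation \<open>j\<close> makes both processes extinct
        together, and they stay so.\<close>
      then have h: "A_hat g f u j = {}" by (simp add: Z_hat_def)
      moreover have "discrepancy g f d u w j = {}" using empty[of j] m False j by auto
      ultimately have "A_set d u w j = {}" by (simp add: discrepancy_def)
      then have "A_set d u w m = {}" using j False by (intro A_set_empty_mono[of d u w j m]) auto
      moreover have "A_hat g f u m = {}" using h False by (intro A_hat_empty_mono[of g f u j m]) auto
      ultimately show ?thesis by (simp add: discrepancy_def)
    next
      case nz: False
      have "real (card (discrepancy g f d u w m)) \<le> \<theta> ^ (m - j) * real (length d) powr (- \<gamma>)"
        using disc[OF m] c_le[of m] m False by auto
      also have "\<dots> \<le> real (Z_hat g f u m) * real (length d) powr (- \<gamma>)"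
        using growth'[of m] m False nz by (intro mult_right_mono) auto
      finally show ?thesis .
    qed
  qed
  have sub: "card (A_hat g f u m - A_set d u w m) \<le> card (discrepancy g f d u w m)"
    "card (A_set d u w m - A_hat g f u m) \<le> card (discrepancy g f d u w m)" for m
    by (intro card_mono finite_discrepancy; auto simp: discrepancy_def)+
  show ?thesis
    unfolding coupled_upto_def
  proof (intro ballI conjI)
    fix m assume m: "m \<in> {1..k}"
    show "real (card (A_hat g f u m - A_set d u w m)) \<le> real (Z_hat g f u m) * real (length d) powr (- \<gamma>)"
      using bound[OF m] sub(1)[of m] by linarith
    show "real (card (A_set d u w m - A_hat g f u m)) \<le> real (Z_hat g f u m) * real (length d) powr (- \<gamma>)"
      using bound[OF m] sub(2)[of m] by linarith
  qed
qed

section \<open>Measurability, Markov's inequality and the union bound\<close>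

lemma sets_coupled_upto:
  "{X \<in> space label_space. coupled_upto g f d (X \<circ> Inl) (X \<circ> Inr) \<gamma> k} \<in> sets label_space"
  unfolding coupled_upto_def Z_hat_def
proof (intro sets.sets_Collect_finite_All)
  fix m
  show "{X \<in> space label_space.
      real (card (A_hat g f (X \<circ> Inl) m - A_set d (X \<circ> Inl) (X \<circ> Inr) m))
        \<le> real (card (A_hat g f (X \<circ> Inl) m)) * real (length d) powr - \<gamma> \<and>
      real (card (A_set d (X \<circ> Inl) (X \<circ> Inr) m - A_hat g f (X \<circ> Inl) m))
        \<le> real (card (A_hat g f (X \<circ> Inl) m)) * real (length d) powr - \<gamma>} \<in> sets label_space"
    by (rule predE, rule pred_discrete_rv,
        rule discrete_rv_comp2[OF discrete_A_hat discrete_A_set, where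
          h="\<lambda>a b. real (card (a - b)) \<le> real (card a) * real (length d) powr - \<gamma> \<and>
            real (card (b - a)) \<le> real (card a) * real (length d) powr - \<gamma>"])
qed auto

context exploration_bounds
begin

text \<open>The exploration is at most the branching generation plus the discrepancy. This is used
  to bound the probability that \<open>good\<close> is lost at the next generation.\<close>

lemma nn_integral_card_A_le:
  assumes "m \<le> k"
  shows "(\<integral>\<^sup>+X. of_bool (good m X) * of_nat (card (A (Suc m) X)) \<partial>label_space) \<le> ennreal (\<nu> * \<mu> ^ m + disc_bound m)"
proof -
  have meas: "(\<lambda>X. of_bool (good m X) * of_nat (card (dis (Suc m) X)) :: ennreal) \<in> borel_measurable label_space"
    by (rule measurable_discrete_ennreal)
       (rule discrete_rv_comp2[OF discrete_good discrete_discrepancy, where h="\<lambda>b a. of_bool b * of_nat (card a)"])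
  have measZ: "(\<lambda>X. of_nat (Z_hat g f (X \<circ> Inl) (Suc m)) :: ennreal) \<in> borel_measurable label_space"
    by (rule measurable_discrete_ennreal) (rule discrete_rv_comp[OF discrete_Z_hat])
  have "(\<integral>\<^sup>+X. of_bool (good m X) * of_nat (card (A (Suc m) X)) \<partial>label_space)
      \<le> (\<integral>\<^sup>+X. of_nat (Z_hat g f (X \<circ> Inl) (Suc m)) + of_bool (good m X) * of_nat (card (dis (Suc m) X)) \<partial>label_space)"
  proof (rule nn_integral_mono)
    fix X :: "label + label \<Rightarrow> real"
    have "card (A (Suc m) X) \<le> card (A_hat g f (X \<circ> Inl) (Suc m) \<union> dis (Suc m) X)"
      by (intro card_mono) (auto simp: discrepancy_def simp del: A_hat.simps)
    also have "\<dots> \<le> Z_hat g f (X \<circ> Inl) (Suc m) + card (dis (Suc m) X)"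
      unfolding Z_hat_def by (rule card_Un_le)
    finally have "(of_nat (card (A (Suc m) X)) :: ennreal) \<le> of_nat (Z_hat g f (X \<circ> Inl) (Suc m) + card (dis (Suc m) X))"
      by (rule of_nat_mono)
    then show "of_bool (good m X) * of_nat (card (A (Suc m) X))
        \<le> of_nat (Z_hat g f (X \<circ> Inl) (Suc m)) + of_bool (good m X) * (of_nat (card (dis (Suc m) X)) :: ennreal)"
      by (cases "good m X") (simp_all only: of_bool_eq mult_1 mult_zero_left zero_le of_nat_add)
  qed
  also have "\<dots> = (\<integral>\<^sup>+X. of_nat (Z_hat g f (X \<circ> Inl) (Suc m)) \<partial>label_space)
      + (\<integral>\<^sup>+X. of_bool (good m X) * of_nat (card (dis (Suc m) X)) \<partial>label_space)"
    by (rule nn_integral_add[OF measZ meas])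
  also have "\<dots> \<le> ennreal (\<nu> * \<mu> ^ m) + ennreal (disc_bound m)"
    using f_mean by (intro add_mono nn_integral_Z_hat_le nn_integral_discrepancy_le g_mean assms) auto
  also have "\<dots> = ennreal (\<nu> * \<mu> ^ m + disc_bound m)"
    using g_mean f_mean disc_bound_nonneg by (intro ennreal_plus[symmetric]) auto
  finally show ?thesis .
qed

lemma sets_discrepancy_exceeds:
  "{X \<in> space label_space. \<not> (\<forall>m<k. real (card (dis (Suc m) X)) \<le> c (Suc m))} \<in> sets label_space"
proof -
  have "{X \<in> space label_space. \<forall>m\<in>{..<k}. real (card (dis (Suc m) X)) \<le> c (Suc m)} \<in> sets label_space"
  proof (rule sets.sets_Collect_finite_All)
    show "{X \<in> space label_space. real (card (dis (Suc m) X)) \<le> c (Suc m)} \<in> sets label_space" for m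
      by (rule predE, rule pred_discrete_rv, rule discrete_rv_comp[OF discrete_discrepancy])
  qed auto
  then have "space label_space - {X \<in> space label_space. \<forall>m\<in>{..<k}. real (card (dis (Suc m) X)) \<le> c (Suc m)} \<in> sets label_space"
    by (rule sets.compl_sets)
  also have "space label_space - {X \<in> space label_space. \<forall>m\<in>{..<k}. real (card (dis (Suc m) X)) \<le> c (Suc m)}
      = {X \<in> space label_space. \<not> (\<forall>m<k. real (card (dis (Suc m) X)) \<le> c (Suc m))}"
    by auto
  finally show ?thesis .
qed

text \<open>The expectation bounds hold only on \<open>good m\<close>, so two cases are separated:
  either \<open>good k\<close> holds and some discrepancy is too large, or \<open>good\<close> is
  lost between some \<open>m\<close> and \<open>m + 1\<close>. Each case is one term of Markov's
  inequality.\<close>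

lemma emeasure_discrepancy_le:
  assumes \<tau>_pos: "\<And>m. 0 < \<tau> m" and c_pos: "\<And>m. 0 < c m"
  shows "emeasure label_space {X \<in> space label_space. \<not> (\<forall>m<k. real (card (dis (Suc m) X)) \<le> c (Suc m))}
    \<le> ennreal (\<Sum>m<k. (\<nu> * \<mu> ^ m + disc_bound m) / \<tau> (Suc m) + disc_bound m / c (Suc m))"
proof -
  let ?B = "{X \<in> space label_space. \<not> (\<forall>m<k. real (card (dis (Suc m) X)) \<le> c (Suc m))}"
  let ?a = "\<lambda>m X. ennreal (1 / \<tau> (Suc m)) * (of_bool (good m X) * of_nat (card (A (Suc m) X)))"
  let ?b = "\<lambda>m X. ennreal (1 / c (Suc m)) * (of_bool (good m X) * of_nat (card (dis (Suc m) X)))"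
  have ma: "(\<lambda>X. of_bool (good m X) * of_nat (card (A (Suc m) X)) :: ennreal) \<in> borel_measurable label_space" for m
    by (rule measurable_discrete_ennreal)
       (rule discrete_rv_comp2[OF discrete_good discrete_A_set, where h="\<lambda>b a. of_bool b * of_nat (card a)"])
  have mb: "(\<lambda>X. of_bool (good m X) * of_nat (card (dis (Suc m) X)) :: ennreal) \<in> borel_measurable label_space" for m
    by (rule measurable_discrete_ennreal)
       (rule discrete_rv_comp2[OF discrete_good discrete_discrepancy, where h="\<lambda>b a. of_bool b * of_nat (card a)"])
  have ge1: "1 \<le> ennreal (1 / x) * (of_bool True * of_nat y)" if "0 < x" "x < real y" for x y
  proof -
    have "1 \<le> 1 / x * real y" using that by (simp add: field_simps)
    then have "1 \<le> ennreal (1 / x * real y)" by simp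
    also have "\<dots> = ennreal (1 / x) * (of_bool True * of_nat y)"
      using that unfolding ennreal_of_nat_eq_real_of_nat of_bool_eq mult_1
      by (intro ennreal_mult) auto
    finally show ?thesis .
  qed
  note B = sets_discrepancy_exceeds[of c]
  have "emeasure label_space ?B = (\<integral>\<^sup>+X. indicator ?B X \<partial>label_space)" by (rule nn_integral_indicator[OF B, symmetric])
  also have "\<dots> \<le> (\<integral>\<^sup>+X. (\<Sum>m<k. ?a m X + ?b m X) \<partial>label_space)"
  proof (rule nn_integral_mono)
    fix X :: "label + label \<Rightarrow> real"
    show "indicator ?B X \<le> (\<Sum>m<k. ?a m X + ?b m X)"
    proof (cases "X \<in> ?B")
      case True
      have "\<exists>m<k. 1 \<le> ?a m X + ?b m X"
      proof (cases "good k X")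
        case g: True
        from True obtain m where m: "m < k" "c (Suc m) < real (card (dis (Suc m) X))" by auto
        then have "good m X" using g good_mono[of m k X] by simp
        then have "1 \<le> ?b m X" using ge1[OF c_pos m(2)] by simp
        then show ?thesis using m(1) by (meson add_increasing zero_le)
      next
        case False
        moreover have "good 0 X" by (simp add: good_def)
        ultimately obtain m where m: "m < k" "good m X" "\<not> good (Suc m) X"
          using dec_induct[of 0 k "\<lambda>m. good m X"] by auto
        then have "\<tau> (Suc m) < real (card (A (Suc m) X))" by (simp add: good_Suc)
        then have "1 \<le> ?a m X" using ge1[OF \<tau>_pos] m(2) by simp
        then show ?thesis using m(1) by (meson add_increasing2 zero_le)
      qed
      then obtain m where "m < k" "1 \<le> ?a m X + ?b m X" by blast
      moreover have "?a m X + ?b m X \<le> (\<Sum>m<k. ?a m X + ?b m X)"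
        using \<open>m < k\<close> by (intro member_le_sum) auto
      ultimately show ?thesis using True by (simp only: indicator_simps)
    qed simp
  qed
  also have "\<dots> = (\<Sum>m<k. (\<integral>\<^sup>+X. ?a m X + ?b m X \<partial>label_space))"
    using ma mb by (intro nn_integral_sum) simp
  also have "\<dots> \<le> (\<Sum>m<k. ennreal ((\<nu> * \<mu> ^ m + disc_bound m) / \<tau> (Suc m) + disc_bound m / c (Suc m)))"
  proof (rule sum_mono)
    fix m assume m: "m \<in> {..<k}"
    have nn: "0 \<le> \<nu> * \<mu> ^ m + disc_bound m"
      using g_mean f_mean disc_bound_nonneg by (intro add_nonneg_nonneg mult_nonneg_nonneg) auto
    have "(\<integral>\<^sup>+X. ?a m X + ?b m X \<partial>label_space) = (\<integral>\<^sup>+X. ?a m X \<partial>label_space) + (\<integral>\<^sup>+X. ?b m X \<partial>label_space)"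
      using ma mb by (intro nn_integral_add) auto
    also have "\<dots> = ennreal (1 / \<tau> (Suc m)) * (\<integral>\<^sup>+X. of_bool (good m X) * of_nat (card (A (Suc m) X)) \<partial>label_space)
        + ennreal (1 / c (Suc m)) * (\<integral>\<^sup>+X. of_bool (good m X) * of_nat (card (dis (Suc m) X)) \<partial>label_space)"
      by (simp only: nn_integral_cmult[OF ma] nn_integral_cmult[OF mb])
    also have "\<dots> \<le> ennreal (1 / \<tau> (Suc m)) * ennreal (\<nu> * \<mu> ^ m + disc_bound m) + ennreal (1 / c (Suc m)) * ennreal (disc_bound m)"
      using m by (intro add_mono mult_left_mono nn_integral_card_A_le nn_integral_discrepancy_le) auto
    also have "\<dots> = ennreal ((\<nu> * \<mu> ^ m + disc_bound m) / \<tau> (Suc m) + disc_bound m / c (Suc m))"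
      using nn disc_bound_nonneg[of m] \<tau>_pos[of "Suc m"] c_pos[of "Suc m"]
      by (simp only: ennreal_mult[symmetric] ennreal_plus[symmetric] divide_nonneg_nonneg less_imp_le zero_le_one mult_nonneg_nonneg)
         (simp add: mult.commute)
    finally show "(\<integral>\<^sup>+X. ?a m X + ?b m X \<partial>label_space) \<le> ennreal ((\<nu> * \<mu> ^ m + disc_bound m) / \<tau> (Suc m) + disc_bound m / c (Suc m))" .
  qed
  also have "\<dots> = ennreal (\<Sum>m<k. (\<nu> * \<mu> ^ m + disc_bound m) / \<tau> (Suc m) + disc_bound m / c (Suc m))"
    using g_mean f_mean disc_bound_nonneg \<tau>_pos c_pos
    by (intro sum_ennreal add_nonneg_nonneg divide_nonneg_nonneg mult_nonneg_nonneg) (auto intro: less_imp_le)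
  finally show ?thesis .
qed

text \<open>The complement is covered by an excessive discrepancy or a slow step in some generation
  from \<open>j\<close> to \<open>k - 1\<close>. The exponent \<open>j - 1\<close> appears because
  \<open>slow\<close> counts generations from 1.\<close>

lemma measure_coupled_ge:
  assumes \<tau>_pos: "\<And>m. 0 < \<tau> m" and c_pos: "\<And>m. 0 < c m"
    and slow: "\<And>m. emeasure label_space {X \<in> space label_space. 0 < Z_hat g f (X \<circ> Inl) (Suc m) \<and>
        real (Z_hat g f (X \<circ> Inl) (Suc (Suc m))) < \<theta> * real (Z_hat g f (X \<circ> Inl) (Suc m))} \<le> ennreal (\<rho> ^ m)"
    and \<rho>: "0 < \<rho>" "\<rho> < 1"
    and j: "1 \<le> j" and \<theta>: "0 < \<theta>"
    and c_lt: "\<And>m. m \<le> j \<Longrightarrow> c m < 1"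
    and c_le: "\<And>m. j \<le> m \<Longrightarrow> m \<le> k \<Longrightarrow> c m \<le> \<theta> ^ (m - j) * n powr (- \<gamma>)"
  shows "1 - ((\<Sum>m<k. (\<nu> * \<mu> ^ m + disc_bound m) / \<tau> (Suc m) + disc_bound m / c (Suc m)) + real k * \<rho> ^ (j - 1))
    \<le> measure label_space {X \<in> space label_space. coupled_upto g f d (X \<circ> Inl) (X \<circ> Inr) \<gamma> k}"
proof -
  let ?C = "{X \<in> space label_space. coupled_upto g f d (X \<circ> Inl) (X \<circ> Inr) \<gamma> k}"
  let ?B = "{X \<in> space label_space. \<not> (\<forall>m<k. real (card (dis (Suc m) X)) \<le> c (Suc m))}"
  let ?S = "\<lambda>m. {X \<in> space label_space. 0 < Z_hat g f (X \<circ> Inl) m \<and>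
        real (Z_hat g f (X \<circ> Inl) (Suc m)) < \<theta> * real (Z_hat g f (X \<circ> Inl) m)}"
  let ?s = "\<Sum>m<k. (\<nu> * \<mu> ^ m + disc_bound m) / \<tau> (Suc m) + disc_bound m / c (Suc m)"
  have s0: "0 \<le> ?s"
    using g_mean f_mean disc_bound_nonneg \<tau>_pos c_pos
    by (intro sum_nonneg add_nonneg_nonneg divide_nonneg_nonneg mult_nonneg_nonneg) (auto intro: less_imp_le)
  have S: "?S m \<in> sets label_space" for m
    by (rule predE, rule pred_discrete_rv,
        rule discrete_rv_comp2[OF discrete_Z_hat discrete_Z_hat, where h="\<lambda>a b. 0 < a \<and> real b < \<theta> * real a"])
  have "space label_space - ?C \<subseteq> ?B \<union> (\<Union>m\<in>{j..<k}. ?S m)"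
  proof
    fix X assume X: "X \<in> space label_space - ?C"
    show "X \<in> ?B \<union> (\<Union>m\<in>{j..<k}. ?S m)"
    proof (rule ccontr)
      assume H: "X \<notin> ?B \<union> (\<Union>m\<in>{j..<k}. ?S m)"
      have "coupled_upto g f d (X \<circ> Inl) (X \<circ> Inr) \<gamma> k"
      proof (rule coupled_uptoI[OF _ _ j \<theta> c_lt c_le])
        fix m assume m: "m \<in> {1..k}"
        then obtain m' where m': "m = Suc m'" "m' < k" by (cases m) auto
        then show "real (card (dis m X)) \<le> c m" using H X by auto
      next
        fix m assume "j \<le> m" "m < k" "0 < Z_hat g f (X \<circ> Inl) m"
        then show "\<theta> * real (Z_hat g f (X \<circ> Inl) m) \<le> real (Z_hat g f (X \<circ> Inl) (Suc m))"
          using H X by (auto simp: not_less dest!: bspec[of _ _ m])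
      qed
      then show False using X by simp
    qed
  qed
  moreover have "?B \<union> (\<Union>m\<in>{j..<k}. ?S m) \<in> sets label_space"
    by (rule sets.Un[OF sets_discrepancy_exceeds sets.finite_UN[OF finite_atLeastLessThan S]])
  ultimately have "emeasure label_space (space label_space - ?C) \<le> emeasure label_space (?B \<union> (\<Union>m\<in>{j..<k}. ?S m))"
    by (rule emeasure_mono)
  also have "\<dots> \<le> emeasure label_space ?B + emeasure label_space (\<Union>m\<in>{j..<k}. ?S m)"
    by (rule emeasure_subadditive[OF sets_discrepancy_exceeds sets.finite_UN[OF finite_atLeastLessThan S]])
  also have "\<dots> \<le> ennreal ?s + ennreal (real k * \<rho> ^ (j - 1))"
  proof (rule add_mono)
    show "emeasure label_space ?B \<le> ennreal ?s" by (rule emeasure_discrepancy_le[OF \<tau>_pos c_pos])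
    have "emeasure label_space (\<Union>m\<in>{j..<k}. ?S m) \<le> (\<Sum>m\<in>{j..<k}. emeasure label_space (?S m))"
      by (rule emeasure_subadditive_finite[OF finite_atLeastLessThan]) (use S in blast)
    also have "\<dots> \<le> (\<Sum>m\<in>{j..<k}. ennreal (\<rho> ^ (j - 1)))"
    proof (rule sum_mono)
      fix m assume m: "m \<in> {j..<k}"
      then obtain m' where m': "m = Suc m'" using j by (cases m) auto
      have "emeasure label_space (?S m) \<le> ennreal (\<rho> ^ m')" unfolding m' by (rule slow)
      also have "\<dots> \<le> ennreal (\<rho> ^ (j - 1))"
        using m m' \<rho> by (intro ennreal_leI power_decreasing) auto
      finally show "emeasure label_space (?S m) \<le> ennreal (\<rho> ^ (j - 1))" .
    qed
    also have "\<dots> = ennreal (real (card {j..<k}) * \<rho> ^ (j - 1))"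
      using \<rho> by (intro sum_ennreal_const) simp
    also have "\<dots> \<le> ennreal (real k * \<rho> ^ (j - 1))"
      using \<rho> by (intro ennreal_leI mult_right_mono) auto
    finally show "emeasure label_space (\<Union>m\<in>{j..<k}. ?S m) \<le> ennreal (real k * \<rho> ^ (j - 1))" .
  qed
  also have "\<dots> = ennreal (?s + real k * \<rho> ^ (j - 1))"
    using s0 \<rho> by (intro ennreal_plus[symmetric]) auto
  finally have "ennreal (measure label_space (space label_space - ?C)) \<le> ennreal (?s + real k * \<rho> ^ (j - 1))"
    by (simp only: P.emeasure_eq_measure)
  then have "measure label_space (space label_space - ?C) \<le> ?s + real k * \<rho> ^ (j - 1)"
    using s0 \<rho> by (subst (asm) ennreal_le_iff) (auto intro!: add_nonneg_nonneg)
  moreover have "measure label_space (space label_space - ?C) = 1 - measure label_space ?C"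
    by (rule P.prob_compl[OF sets_coupled_upto])
  ultimately show ?thesis by linarith
qed

end

section \<open>Asymptotics\<close>

lemma stub_count_outdeg: "bidegree_seq n d \<Longrightarrow> stub_count d = (\<Sum>r<n. outdeg d r)"
  by (simp add: bidegree_seq_def stub_count_def)

text \<open>The term \<open>k = 0\<close> of the distance bounds the fraction of nodes without outbound stubs.\<close>

lemma stub_count_ge:
  assumes d: "bidegree_seq n d" "1 \<le> n"
    and close: "cdf_dist (g_emp d) (pmf g) \<le> ennreal e" and e: "0 \<le> e" "e \<le> (1 - pmf g 0) / 2"
  shows "(1 - pmf g 0) / 2 * real n \<le> real (stub_count d)"
proof -
  have len: "length d = n" using d by (simp add: bidegree_seq_def)
  have "ennreal \<bar>\<Sum>i\<le>0. g_emp d i - pmf g i\<bar> = (\<Sum>k\<in>{0}. ennreal \<bar>\<Sum>i\<le>k. g_emp d i - pmf g i\<bar>)"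
    by simp
  also have "\<dots> \<le> cdf_dist (g_emp d) (pmf g)"
    unfolding cdf_dist_def by (rule sum_le_suminf) auto
  also have "\<dots> \<le> ennreal e" by (rule close)
  finally have "\<bar>g_emp d 0 - pmf g 0\<bar> \<le> e" using e by simp
  then have "g_emp d 0 - pmf g 0 \<le> (1 - pmf g 0) / 2" using e(2) by (metis abs_ge_self order_trans)
  then have g0: "g_emp d 0 \<le> (1 + pmf g 0) / 2" by (simp add: field_simps)
  have "real n - real n * g_emp d 0 = (\<Sum>r<n. 1 - of_bool (outdeg d r = 0))"
    using d by (simp add: g_emp_def len sum_subtractf)
  also have "\<dots> \<le> (\<Sum>r<n. real (outdeg d r))"
    by (intro sum_mono) auto
  also have "\<dots> = real (stub_count d)"
    by (simp add: stub_count_outdeg[OF d(1)])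
  finally have "real n - real n * g_emp d 0 \<le> real (stub_count d)" .
  moreover have "real n * g_emp d 0 \<le> real n * ((1 + pmf g 0) / 2)"
    using g0 by (intro mult_left_mono) auto
  ultimately show ?thesis by (simp add: field_simps)
qed

text \<open>Lets the number of generations, of order \<open>log n\<close>, be absorbed by an
  arbitrarily small power of \<open>n\<close>.\<close>

lemma log_le_powr:
  assumes "1 < \<mu>" "1 \<le> N" "0 < z"
  shows "log \<mu> N \<le> 1 / (z * ln \<mu>) * N powr z"
proof -
  have "ln N \<le> N powr z / z" using assms by (intro ln_powr_bound)
  then have "ln N / ln \<mu> \<le> N powr z / z / ln \<mu>" using assms by (intro divide_right_mono) auto
  then show ?thesis by (simp add: log_def)
qed

lemma powr_mult_le:
  assumes "a \<le> A * N powr x" "b \<le> B * N powr y" "0 \<le> b" "0 \<le> A"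
  shows "a * b \<le> A * B * N powr (x + y :: real)"
proof -
  have "a * b \<le> (A * N powr x) * (B * N powr y)"
    using assms by (intro mult_mono) auto
  then show ?thesis by (simp add: powr_add mult_ac)
qed

text \<open>A budget of exponents in multiples of \<open>\<zeta>\<close>: one for the number of
  generations, two for the room in \<open>\<tau>\<close>. The constants \<open>C0\<close>,
  \<open>C2\<close>, \<open>C3\<close> belong to the bounds for \<open>2 * m * \<tau> m / L\<close>,
  for the error of one stub and for the discrepancy.\<close>

lemma (in exploration_bounds) coupled_rate:
  fixes \<zeta> \<omega> \<delta> \<gamma> K B cc \<rho> \<theta> a1 B1 :: real
  defines "C0 \<equiv> 2 * B / cc"
  defines "C2 \<equiv> 1 + C0 * (K / cc) + K / cc * (1 + C0 powr \<kappa>)"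
  defines "C3 \<equiv> 1 + B * C2"
  assumes n2: "2 \<le> n"
    and \<tau>: "\<tau> = (\<lambda>m. \<mu> ^ m * n powr (2 * \<zeta>))"
    and R: "R = K * n" "0 \<le> K"
    and e: "e \<le> n powr (- \<omega>)"
    and L: "cc * n \<le> L" "0 < cc"
    and pars: "0 < \<zeta>" "\<zeta> < 1 / 2" "0 < \<gamma>" "\<gamma> + 12 * \<zeta> \<le> \<omega>" "\<omega> \<le> \<delta> * \<kappa>" "\<delta> \<le> 1" "0 < \<delta>"
    and k: "real k \<le> (1 - \<delta>) * log \<mu> n" "real k \<le> B * n powr \<zeta>" "real k \<le> B1 * n powr a1" "0 \<le> B"
    and \<theta>: "\<theta> = \<mu> powr (1 - 2 * \<zeta>)"
    and \<rho>: "0 < \<rho>" "\<rho> < 1"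
    and slow: "\<And>m. emeasure label_space {X \<in> space label_space. 0 < Z_hat g f (X \<circ> Inl) (Suc m) \<and>
        real (Z_hat g f (X \<circ> Inl) (Suc (Suc m))) < \<theta> * real (Z_hat g f (X \<circ> Inl) (Suc m))} \<le> ennreal (\<rho> ^ m)"
    and a1: "2 * a1 = - (2 * \<zeta> * log \<mu> \<rho>)"
    and large: "1 \<le> 2 * \<zeta> * log \<mu> n"
  shows "1 - (B * (\<nu> + 2 * C3) * n powr (- \<zeta>) + B1 * \<rho> powr (-2) * n powr (- a1))
    \<le> measure label_space {X \<in> space label_space. coupled_upto g f d (X \<circ> Inl) (X \<circ> Inr) \<gamma> k}"
proof -
  let ?l = "log \<mu> n"
  \<comment> \<open>Order of the error per stub. The share \<open>m * \<tau> m / L\<close> of used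
    stubs is of order \<open>n powr (- \<delta> + 3 * \<zeta>)\<close>, and its power
    \<open>\<kappa>\<close> still stays below a multiple of \<open>x\<close> because
    \<open>\<omega> \<le> \<delta> * \<kappa>\<close> and \<open>\<kappa> \<le> 1\<close>.\<close>
  define x where "x = n powr (- \<omega> + 3 * \<zeta>)"
  have n0: "0 < n" "1 \<le> n" using n2 by auto
  have \<mu>0: "0 < \<mu>" "1 \<le> \<mu>" using f_mean by auto
  have npow: "n powr s = \<mu> powr (s * ?l)" for s
    using \<mu>0 f_mean n0 by (simp add: mult.commute[of s] powr_powr[symmetric])
  have \<mu>pow: "\<mu> ^ m = \<mu> powr real m" for m using \<mu>0 by (simp add: powr_realpow)
  have mono_n: "s \<le> t \<Longrightarrow> n powr s \<le> n powr t" for s t using n0 by (intro powr_mono) auto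
  have \<omega>\<delta>: "\<omega> \<le> \<delta>"
  proof -
    have "\<delta> * \<kappa> \<le> \<delta> * 1" using \<kappa> pars by (intro mult_left_mono) auto
    then show ?thesis using pars by linarith
  qed
  have C0: "0 \<le> C0" unfolding C0_def using k(4) L(2) by simp
  have C2: "0 \<le> C2" unfolding C2_def using C0 R(2) L(2) by (intro add_nonneg_nonneg mult_nonneg_nonneg divide_nonneg_nonneg) auto
  have C3: "0 \<le> C3" unfolding C3_def using C2 k(4) by simp
  have x0: "0 < x" unfolding x_def using n0 by simp
  have L0: "0 < L" using L n0 by (meson less_le_trans mult_pos_pos)
  have \<mu>m: "\<mu> ^ m \<le> n powr (1 - \<delta>)" if "m \<le> k" for m
    unfolding \<mu>pow npow using k(1) that f_mean by (intro powr_mono) auto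
  have \<tau>0: "0 < \<tau> m" for m unfolding \<tau> using \<mu>0 n0 by simp
  have mk: "real m \<le> B * n powr \<zeta>" if "m \<le> k" for m
    using k(2) that by linarith
  have M: "2 * real m * \<tau> m / L \<le> C0 * n powr (- \<delta> + 3 * \<zeta>)" if m: "m \<le> k" for m
  proof -
    have "\<tau> m \<le> 1 * n powr ((1 - \<delta>) + 2 * \<zeta>)"
      unfolding \<tau> powr_add using \<mu>m[OF m] by (simp add: mult_right_mono)
    then have "real m * \<tau> m \<le> B * 1 * n powr (\<zeta> + ((1 - \<delta>) + 2 * \<zeta>))"
      by (intro powr_mult_le mk[OF m] less_imp_le[OF \<tau>0] k(4))
    also have "\<zeta> + ((1 - \<delta>) + 2 * \<zeta>) = 1 + (- \<delta> + 3 * \<zeta>)" by simp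
    also have "n powr \<dots> = n * n powr (- \<delta> + 3 * \<zeta>)" using n0 by (subst powr_add) simp
    finally have 1: "real m * \<tau> m \<le> B * n powr (- \<delta> + 3 * \<zeta>) * n" by (simp add: mult_ac)
    have "2 * real m * \<tau> m / L \<le> 2 * (B * n powr (- \<delta> + 3 * \<zeta>) * n) / (cc * n)"
      using 1 L n0 L0 k(4) by (intro frac_le) auto
    also have "\<dots> = C0 * n powr (- \<delta> + 3 * \<zeta>)"
      unfolding C0_def using n0 L(2) by (simp add: field_simps)
    finally show ?thesis .
  qed
  have Mx: "2 * real m * \<tau> m / L \<le> C0 * x" if "m \<le> k" for m
  proof -
    have "C0 * n powr (- \<delta> + 3 * \<zeta>) \<le> C0 * x"
      unfolding x_def using \<omega>\<delta> C0 by (intro mult_left_mono mono_n) auto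
    then show ?thesis using M[OF that] by linarith
  qed
  have M\<kappa>: "(2 * real m * \<tau> m / L) powr \<kappa> \<le> C0 powr \<kappa> * x" if "m \<le> k" for m
  proof -
    have "(2 * real m * \<tau> m / L) powr \<kappa> \<le> (C0 * n powr (- \<delta> + 3 * \<zeta>)) powr \<kappa>"
      using M[OF that] \<kappa> L0 less_imp_le[OF \<tau>0] by (intro powr_mono2) auto
    also have "\<dots> = C0 powr \<kappa> * n powr ((- \<delta> + 3 * \<zeta>) * \<kappa>)"
      by (simp add: powr_mult powr_powr)
    also have "\<dots> \<le> C0 powr \<kappa> * x"
    proof -
      have "3 * \<zeta> * \<kappa> \<le> 3 * \<zeta> * 1" using \<kappa> pars by (intro mult_left_mono) auto
      moreover have "(- \<delta> + 3 * \<zeta>) * \<kappa> = - (\<delta> * \<kappa>) + 3 * \<zeta> * \<kappa>" by (simp add: algebra_simps)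
      ultimately have "(- \<delta> + 3 * \<zeta>) * \<kappa> \<le> - \<omega> + 3 * \<zeta>" using pars by linarith
      then show ?thesis unfolding x_def by (intro mult_left_mono mono_n) auto
    qed
    finally show ?thesis .
  qed
  have RL: "R / L \<le> K / cc"
  proof -
    have "R / L \<le> K * n / (cc * n)" unfolding R(1) using L n0 R(2) by (intro divide_left_mono mult_nonneg_nonneg mult_pos_pos L0) auto
    then show ?thesis using n0 by simp
  qed
  have RL0: "0 \<le> R / L" using R n0 L0 by simp
  have inv_n: "1 / n \<le> x"
  proof -
    have "n powr (- 1) \<le> x" unfolding x_def using \<omega>\<delta> pars by (intro mono_n) auto
    then show ?thesis using n0 by (simp add: powr_minus_divide)
  qed
  have ex: "e \<le> x"
  proof -
    have "n powr (- \<omega>) \<le> x" unfolding x_def using pars by (intro mono_n) auto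
    then show ?thesis using e by linarith
  qed
  have step: "step_error m \<le> \<tau> m * (C2 * x)" if m: "m \<le> k" for m
    unfolding step_error_def
  proof (intro mult_left_mono less_imp_le[OF \<tau>0])
    have "2 * real m * \<tau> m * R / L\<^sup>2 = (2 * real m * \<tau> m / L) * (R / L)"
      by (simp add: power2_eq_square)
    also have "\<dots> \<le> (C0 * x) * (K / cc)"
      using Mx[OF m] RL RL0 C0 x0 by (intro mult_mono) auto
    finally have 1: "2 * real m * \<tau> m * R / L\<^sup>2 \<le> C0 * (K / cc) * x" by (simp add: mult_ac)
    have "act_bound m / L = (R / L) * (1 / n + (2 * real m * \<tau> m / L) powr \<kappa>)"
      by (simp add: act_bound_def field_simps)
    also have "\<dots> \<le> (K / cc) * (x + C0 powr \<kappa> * x)"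
      using RL RL0 inv_n M\<kappa>[OF m] n0 R(2) L(2) by (intro mult_mono add_mono add_nonneg_nonneg) auto
    finally have 2: "act_bound m / L \<le> K / cc * (1 + C0 powr \<kappa>) * x" by (simp add: algebra_simps)
    have "e + 2 * real m * \<tau> m * R / L\<^sup>2 + act_bound m / L
        \<le> x + C0 * (K / cc) * x + K / cc * (1 + C0 powr \<kappa>) * x"
      using 1 2 ex by linarith
    then show "e + 2 * real m * \<tau> m * R / L\<^sup>2 + act_bound m / L \<le> C2 * x"
      unfolding C2_def by (simp only: distrib_right mult_1)
  qed
  \<comment> \<open>Compared with \<open>x\<close>, the discrepancy loses \<open>2 * \<zeta>\<close>
    through the factor \<open>n powr (2 * \<zeta>)\<close> in \<open>\<tau>\<close> and
    \<open>\<zeta>\<close> through the sum over the generations.\<close>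
  define y where "y = n powr (- \<omega> + 6 * \<zeta>)"
  have y1: "y \<le> 1" unfolding y_def using mono_n[of "- \<omega> + 6 * \<zeta>" 0] pars n0 by simp
  have y0: "0 < y" unfolding y_def using n0 by simp
  have disc: "disc_bound m \<le> \<mu> ^ m * (C3 * y)" if m: "m \<le> k" for m
  proof -
    have "(\<Sum>l\<in>{1..m}. \<mu> ^ (m - l) * step_error l) \<le> (\<Sum>l\<in>{1..m}. \<mu> ^ m * (n powr (2 * \<zeta>) * (C2 * x)))"
    proof (rule sum_mono)
      fix l assume l: "l \<in> {1..m}"
      have "\<mu> ^ (m - l) * step_error l \<le> \<mu> ^ (m - l) * (\<tau> l * (C2 * x))"
        using l m \<mu>0 by (intro mult_left_mono step) auto
      also have "\<dots> = \<mu> ^ (m - l + l) * (n powr (2 * \<zeta>) * (C2 * x))"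
        by (simp only: \<tau> power_add mult_ac)
      also have "m - l + l = m" using l by simp
      finally show "\<mu> ^ (m - l) * step_error l \<le> \<mu> ^ m * (n powr (2 * \<zeta>) * (C2 * x))" .
    qed
    also have "\<dots> = \<mu> ^ m * (C2 * (real m * (n powr (2 * \<zeta>) * x)))" by simp
    also have "\<dots> \<le> \<mu> ^ m * (C2 * (B * n powr \<zeta> * (n powr (2 * \<zeta>) * x)))"
      using \<mu>0 C2 x0 mk[OF m] by (intro mult_left_mono mult_right_mono) auto
    also have "B * n powr \<zeta> * (n powr (2 * \<zeta>) * x) = B * y"
    proof -
      have "n powr \<zeta> * (n powr (2 * \<zeta>) * x) = y"
        unfolding x_def y_def powr_add[symmetric] by (simp add: algebra_simps)
      then show ?thesis by (simp only: mult.assoc)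
    qed
    finally have 1: "(\<Sum>l\<in>{1..m}. \<mu> ^ (m - l) * step_error l) \<le> \<mu> ^ m * (C2 * (B * y))" .
    have "x \<le> y" unfolding x_def y_def using pars by (intro mono_n) auto
    then have "\<mu> ^ m * e \<le> \<mu> ^ m * y" using ex \<mu>0 by (intro mult_left_mono) auto
    then have "disc_bound m \<le> \<mu> ^ m * y + \<mu> ^ m * (C2 * (B * y))"
      unfolding disc_bound_def using 1 by linarith
    then show ?thesis by (simp add: C3_def algebra_simps)
  qed
  \<comment> \<open>With \<open>\<gamma> + 12 * \<zeta> \<le> \<omega>\<close> this exponent makes
    \<open>y / n powr (- \<gamma> - 4 * \<zeta>)\<close> at most
    \<open>n powr (- (2 * \<zeta>))\<close>. The margin \<open>4 * \<zeta>\<close> pays for the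
    start at generation \<open>j\<close> and for growth by \<open>\<theta>\<close> instead of
    \<open>\<mu>\<close>, \<open>2 * \<zeta>\<close> each.\<close>
  define c where "c m = \<mu> ^ m * n powr (- \<gamma> - 4 * \<zeta>)" for m
  have c0: "0 < c m" for m unfolding c_def using \<mu>0 n0 by simp
  \<comment> \<open>The last generation with
    \<open>\<mu> ^ j \<le> n powr (2 * \<zeta>)\<close>.\<close>
  define j where "j = nat \<lfloor>2 * \<zeta> * ?l\<rfloor>"
  have l0: "0 < ?l"
  proof (rule ccontr)
    assume "\<not> 0 < ?l"
    then have "2 * \<zeta> * ?l \<le> 0" using pars by (intro mult_nonneg_nonpos) auto
    then show False using large by linarith
  qed
  have j: "1 \<le> j" "real j \<le> 2 * \<zeta> * ?l" "2 * \<zeta> * ?l - 1 \<le> real j"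
    unfolding j_def using large by linarith+
  have c_lt: "c m < 1" if "m \<le> j" for m
  proof -
    have "\<mu> ^ m \<le> n powr (2 * \<zeta>)"
      unfolding \<mu>pow npow using that j f_mean by (intro powr_mono) auto
    then have "c m \<le> n powr (2 * \<zeta>) * n powr (- \<gamma> - 4 * \<zeta>)"
      unfolding c_def by (intro mult_right_mono) auto
    also have "\<dots> = n powr (- \<gamma> - 2 * \<zeta>)" by (simp add: powr_add[symmetric] add.commute)
    also have "\<dots> < n powr 0" using pars n2 by (intro powr_less_mono) auto
    finally show ?thesis using n0 by simp
  qed
  have c_le: "c m \<le> \<theta> ^ (m - j) * n powr (- \<gamma>)" if m: "j \<le> m" "m \<le> k" for m
  proof -
    have ml: "real m \<le> ?l"
    proof -
      have "(1 - \<delta>) * ?l \<le> 1 * ?l" using pars l0 by (intro mult_right_mono) auto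
      then show ?thesis using k(1) m(2) by linarith
    qed
    have "2 * \<zeta> * (real m - real j) \<le> 2 * \<zeta> * ?l" using ml pars by (intro mult_left_mono) auto
    then have le: "real m + - (4 * \<zeta>) * ?l \<le> (1 - 2 * \<zeta>) * real (m - j)"
      using j(2) m(1) by (simp add: of_nat_diff algebra_simps)
    have split: "- \<gamma> - 4 * \<zeta> = - (4 * \<zeta>) + - \<gamma>" by simp
    have "c m = (\<mu> ^ m * n powr (- (4 * \<zeta>))) * n powr (- \<gamma>)"
      unfolding c_def split powr_add by (simp only: mult.assoc)
    also have "\<mu> ^ m * n powr (- (4 * \<zeta>)) = \<mu> powr (real m + - (4 * \<zeta>) * ?l)"
      unfolding \<mu>pow npow by (rule powr_add[symmetric])
    also have "\<dots> \<le> \<mu> powr ((1 - 2 * \<zeta>) * real (m - j))"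
      using le f_mean by (intro powr_mono) auto
    also have "\<dots> = \<theta> ^ (m - j)"
      unfolding \<theta> using \<mu>0 by (simp add: powr_powr[symmetric] powr_realpow)
    finally show ?thesis by (simp add: mult_right_mono)
  qed
  have \<theta>0: "0 < \<theta>" using \<theta> \<mu>0 by simp
  \<comment> \<open>Both thresholds grow like \<open>\<mu> ^ m\<close>, so the powers of
    \<open>\<mu>\<close> cancel and every generation has the same bound; summing over
    \<open>k \<le> B * n powr \<zeta>\<close> generations then costs one
    \<open>\<zeta>\<close>.\<close>
  have term1: "(\<nu> * \<mu> ^ m + disc_bound m) / \<tau> (Suc m) + disc_bound m / c (Suc m)
      \<le> (\<nu> + 2 * C3) * n powr (- (2 * \<zeta>))" if m: "m \<in> {..<k}" for m
  proof -
    have mk': "m \<le> k" using m by simp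
    have \<mu>S: "0 < \<mu> ^ m" "\<mu> ^ m \<le> \<mu> ^ Suc m" using \<mu>0 by (auto intro: power_increasing)
    have P: "0 < n powr s" for s using n0 by simp
    have "C3 * y \<le> C3 * 1" using y1 C3 by (intro mult_left_mono) auto
    then have "\<mu> ^ m * (C3 * y) \<le> \<mu> ^ m * C3" using \<mu>S by (intro mult_left_mono) auto
    then have "disc_bound m \<le> \<mu> ^ m * C3" using disc[OF mk'] by linarith
    then have "\<nu> * \<mu> ^ m + disc_bound m \<le> \<mu> ^ m * (\<nu> + C3)" by (simp add: algebra_simps)
    also have "\<dots> \<le> \<mu> ^ Suc m * (\<nu> + C3)" using \<mu>S g_mean C3 by (intro mult_right_mono) auto
    finally have "(\<nu> * \<mu> ^ m + disc_bound m) / \<tau> (Suc m) \<le> \<mu> ^ Suc m * (\<nu> + C3) / \<tau> (Suc m)"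
      by (intro divide_right_mono less_imp_le[OF \<tau>0])
    also have "\<dots> = (\<nu> + C3) / n powr (2 * \<zeta>)"
      unfolding \<tau> by (rule mult_divide_mult_cancel_left) (use \<mu>0 in simp)
    also have "\<dots> = (\<nu> + C3) * n powr (- (2 * \<zeta>))"
      by (simp add: powr_minus divide_inverse)
    finally have 1: "(\<nu> * \<mu> ^ m + disc_bound m) / \<tau> (Suc m) \<le> (\<nu> + C3) * n powr (- (2 * \<zeta>))" .
    have "\<mu> ^ m * (C3 * y) \<le> \<mu> ^ Suc m * (C3 * y)"
      using C3 y0 by (intro mult_right_mono[OF \<mu>S(2)]) auto
    then have "disc_bound m \<le> \<mu> ^ Suc m * (C3 * y)"
      using disc[OF mk'] by linarith
    then have "disc_bound m / c (Suc m) \<le> \<mu> ^ Suc m * (C3 * y) / c (Suc m)"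
      by (intro divide_right_mono less_imp_le[OF c0])
    also have "\<dots> = C3 * (y / n powr (- \<gamma> - 4 * \<zeta>))"
      unfolding c_def using \<mu>S by simp
    also have "y / n powr (- \<gamma> - 4 * \<zeta>) = n powr (- \<omega> + 6 * \<zeta> - (- \<gamma> - 4 * \<zeta>))"
      unfolding y_def by (rule powr_diff[symmetric])
    also have "C3 * \<dots> \<le> C3 * n powr (- (2 * \<zeta>))"
      using pars C3 by (intro mult_left_mono mono_n) auto
    finally show ?thesis using 1 by (simp add: algebra_simps)
  qed
  have "(\<Sum>m<k. (\<nu> * \<mu> ^ m + disc_bound m) / \<tau> (Suc m) + disc_bound m / c (Suc m))
      \<le> (\<Sum>m<k. (\<nu> + 2 * C3) * n powr (- (2 * \<zeta>)))"
    by (rule sum_mono[OF term1])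
  also have "\<dots> = real k * ((\<nu> + 2 * C3) * n powr (- (2 * \<zeta>)))" by simp
  also have "\<dots> \<le> B * (\<nu> + 2 * C3) * n powr (\<zeta> + - (2 * \<zeta>))"
    using g_mean C3 k by (intro powr_mult_le) auto
  finally have S1: "(\<Sum>m<k. (\<nu> * \<mu> ^ m + disc_bound m) / \<tau> (Suc m) + disc_bound m / c (Suc m))
      \<le> B * (\<nu> + 2 * C3) * n powr (- \<zeta>)" by simp
  \<comment> \<open>Rounding in \<open>j\<close> and the shift by one cost the factor
    \<open>\<rho> powr (-2)\<close>. What remains is \<open>n powr (- (2 * a1))\<close>, half of
    which absorbs the factor \<open>k\<close>.\<close>
  have S2: "real k * \<rho> ^ (j - 1) \<le> B1 * \<rho> powr (-2) * n powr (- a1)"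
  proof -
    have "\<rho> ^ (j - 1) = \<rho> powr real (j - 1)" using \<rho> by (simp add: powr_realpow)
    also have "\<dots> \<le> \<rho> powr (2 * \<zeta> * ?l - 2)"
      using \<rho> j by (intro powr_mono') auto
    also have "\<dots> = \<rho> powr (-2) * \<rho> powr (2 * \<zeta> * ?l)" by (simp add: powr_add[symmetric])
    also have "\<rho> powr (2 * \<zeta> * ?l) = n powr (- (2 * a1))"
    proof -
      have "\<rho> powr (2 * \<zeta> * ?l) = (\<mu> powr (log \<mu> \<rho>)) powr (2 * \<zeta> * ?l)"
        using \<rho> f_mean by simp
      also have "\<dots> = \<mu> powr (- (2 * a1) * ?l)"
        unfolding powr_powr a1 by (simp add: mult_ac)
      finally show ?thesis unfolding npow .
    qed
    finally have "real k * \<rho> ^ (j - 1) \<le> (B1 * n powr a1) * (\<rho> powr (-2) * n powr (- (2 * a1)))"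
      using k(3) \<rho> by (intro mult_mono) auto
    also have "\<dots> = B1 * \<rho> powr (-2) * (n powr a1 * n powr (- (2 * a1)))" by simp
    also have "n powr a1 * n powr (- (2 * a1)) = n powr (- a1)" by (simp add: powr_add[symmetric])
    finally show ?thesis .
  qed
  show ?thesis
    using measure_coupled_ge[OF \<tau>0 c0 slow \<rho> j(1) \<theta>0 c_lt c_le] S1 S2 by linarith
qed

section \<open>Choice of the parameters and the bound for fixed sequences\<close>

lemma pmf_0_less_1:
  fixes g :: "nat pmf"
  assumes "(\<integral>\<^sup>+x. ennreal (real x) \<partial>measure_pmf g) = ennreal \<nu>" "0 < \<nu>"
  shows "pmf g 0 < 1"
proof (rule ccontr)
  assume "\<not> pmf g 0 < 1"
  then have g0: "pmf g 0 = 1" using pmf_le_1[of g 0] by linarith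
  have "pmf g x = 0" if "x \<noteq> 0" for x
  proof -
    have "measure (measure_pmf g) {0, x} \<le> 1" by (rule measure_pmf.prob_le_1)
    moreover have "measure (measure_pmf g) {0, x} = pmf g 0 + pmf g x"
      using that by (simp add: measure_measure_pmf_finite)
    ultimately show ?thesis using g0 pmf_nonneg[of g x] by linarith
  qed
  then have "set_pmf g \<subseteq> {0}" by (metis insertI1 set_pmf_iff subsetI)
  then have "AE x in measure_pmf g. ennreal (real x) = 0"
    by (auto simp: AE_measure_pmf_iff)
  then have "(\<integral>\<^sup>+x. ennreal (real x) \<partial>measure_pmf g) = 0"
    by (subst nn_integral_0_iff_AE) auto
  then show False using assms by simp
qed

text \<open>One direction of exploration for a fixed sequence; the other direction is the same
  statement for \<open>flip_dir d\<close>. The constants are chosen before \<open>n\<close>,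
  \<open>d\<close> and \<open>k\<close>.\<close>

lemma coupling_asymptotics:
  fixes g f :: "nat pmf" and \<nu> \<mu> \<epsilon> \<kappa> K0 \<delta> \<gamma> :: real
  assumes gm: "(\<integral>\<^sup>+x. ennreal (real x) \<partial>measure_pmf g) = ennreal \<nu>" "0 < \<nu>"
    and fm: "(\<integral>\<^sup>+x. ennreal (real x) \<partial>measure_pmf f) = ennreal \<mu>" "1 < \<mu>"
    and params: "0 < \<epsilon>" "0 < \<kappa>" "\<kappa> \<le> 1"
    and \<delta>: "0 < \<delta>" "\<delta> < 1"
    and \<gamma>: "0 < \<gamma>" "\<gamma> < min (\<delta> * \<kappa>) \<epsilon>"
  shows "\<exists>K>0. \<exists>a>0. \<forall>n\<ge>1. \<forall>d. bidegree_seq n d \<longrightarrow>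
    cdf_dist (g_emp d) (pmf g) \<le> ennreal (real n powr (- \<epsilon>)) \<longrightarrow>
    cdf_dist (f_emp d) (pmf f) \<le> ennreal (real n powr (- \<epsilon>)) \<longrightarrow>
    (\<Sum>r<n. real (indeg d r) powr \<kappa> * real (outdeg d r) * real (indeg d r)) \<le> K0 * real n \<longrightarrow>
    (\<forall>k. real k \<le> (1 - \<delta>) * log \<mu> (real n) \<longrightarrow>
      1 - K * real n powr (- a)
        \<le> measure label_space {X \<in> space label_space. coupled_upto g f d (X \<circ> Inl) (X \<circ> Inr) \<gamma> k})"
proof -
  define \<omega> where "\<omega> = min (\<delta> * \<kappa>) \<epsilon>"
  \<comment> \<open>The divisor 12 is the exponent budget of \<open>coupled_rate\<close>; the bound
    \<open>1 / 4\<close> keeps \<open>1 - 2 * \<zeta>\<close> positive.\<close>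
  define \<zeta> where "\<zeta> = min ((\<omega> - \<gamma>) / 12) (1 / 4)"
  \<comment> \<open>Half of the limiting proportion of nodes with outbound stubs; for large
    \<open>n\<close> it bounds \<open>L / n\<close> from below.\<close>
  define cc where "cc = (1 - pmf g 0) / 2"
  \<comment> \<open>The maximum makes the constant nonnegative whatever the sign of
    \<open>K0\<close>.\<close>
  define K where "K = max K0 1"
  define \<theta> where "\<theta> = \<mu> powr (1 - 2 * \<zeta>)"
  \<comment> \<open>Strictly between \<open>\<theta>\<close> and \<open>\<mu>\<close> and above 1,
    as \<open>branching_slow_growth\<close> requires.\<close>
  define \<mu>' where "\<mu>' = \<mu> powr (1 - \<zeta>)"
  have \<zeta>: "0 < \<zeta>" "\<zeta> < 1 / 2" "\<gamma> + 12 * \<zeta> \<le> \<omega>"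
    using \<gamma> by (auto simp: \<zeta>_def \<omega>_def min_def field_simps)
  have \<omega>: "\<omega> \<le> \<delta> * \<kappa>" "\<omega> \<le> \<epsilon>" by (auto simp: \<omega>_def)
  have "\<delta> * \<kappa> \<le> \<delta> * 1" using params \<delta> by (intro mult_left_mono) auto
  then have \<zeta>\<delta>: "3 * \<zeta> < \<delta>" using \<zeta> \<omega> \<gamma> by linarith
  have cc: "0 < cc" using pmf_0_less_1[OF gm] by (simp add: cc_def)
  have \<theta>\<mu>': "\<theta> < \<mu>'" "1 < \<mu>'" "\<mu>' < \<mu>"
  proof -
    show "\<theta> < \<mu>'" unfolding \<theta>_def \<mu>'_def using \<zeta> fm by (intro powr_less_mono) auto
    have "\<mu> powr 0 < \<mu>'" unfolding \<mu>'_def using \<zeta> fm by (intro powr_less_mono) auto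
    then show "1 < \<mu>'" using fm by simp
    have "\<mu>' < \<mu> powr 1" unfolding \<mu>'_def using \<zeta> fm by (intro powr_less_mono) auto
    then show "\<mu>' < \<mu>" using fm by simp
  qed
  obtain \<rho> :: real where \<rho>: "0 < \<rho>" "\<rho> < 1"
    and slow: "\<And>m. emeasure label_space {X \<in> space label_space. 0 < Z_hat g f (X \<circ> Inl) (Suc m) \<and>
        real (Z_hat g f (X \<circ> Inl) (Suc (Suc m))) < \<theta> * real (Z_hat g f (X \<circ> Inl) (Suc m))} \<le> ennreal (\<rho> ^ m)"
    using branching_slow_growth[OF fm(1) \<theta>\<mu>'(2,3,1), of g] by blast
  \<comment> \<open>Chosen so that \<open>\<rho> powr (2 * \<zeta> * log \<mu> n) = n powr (- (2 *
    a1))\<close>.\<close>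
  define a1 where "a1 = - (\<zeta> * log \<mu> \<rho>)"
  have "log \<mu> \<rho> < 0" using \<rho> fm by simp
  then have a1: "0 < a1" using \<zeta> by (simp add: a1_def mult_pos_neg)
  define B where "B = 1 / (\<zeta> * ln \<mu>)"
  define B1 where "B1 = 1 / (a1 * ln \<mu>)"
  have B0: "0 \<le> B" "0 \<le> B1" using \<zeta> a1 fm by (auto simp: B_def B1_def)
  define C3 where "C3 = 1 + B * (1 + 2 * B / cc * (K / cc) + K / cc * (1 + (2 * B / cc) powr \<kappa>))"
  define a where "a = min \<zeta> a1"
  have a0: "0 < a" using \<zeta> a1 by (simp add: a_def)
  \<comment> \<open>The second condition gives \<open>L \<ge> cc * n\<close>, the third
    \<open>\<tau>_small\<close>, the fourth \<open>j \<ge> 1\<close>.\<close>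
  have "\<forall>\<^sub>F n in sequentially. 2 \<le> real n \<and> real n powr (- \<epsilon>) \<le> cc
      \<and> 2 * B / cc * real n powr (- (\<delta> - 3 * \<zeta>)) \<le> 1 \<and> 1 / (2 * \<zeta>) \<le> log \<mu> (real n)"
  proof (intro eventually_conj)
    show "\<forall>\<^sub>F n in sequentially. 2 \<le> real n"
      using filterlim_real_sequentially by (simp add: filterlim_at_top)
    have lim: "((\<lambda>n. real n powr (- s)) \<longlongrightarrow> 0) sequentially" if "0 < s" for s
      by (rule tendsto_neg_powr[OF _ filterlim_real_sequentially]) (use that in simp)
    have "\<forall>\<^sub>F n in sequentially. real n powr (- \<epsilon>) < cc"
      using lim[OF params(1)] cc by (rule order_tendstoD)
    then show "\<forall>\<^sub>F n in sequentially. real n powr (- \<epsilon>) \<le> cc"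
      by eventually_elim simp
    have "((\<lambda>n. 2 * B / cc * real n powr (- (\<delta> - 3 * \<zeta>))) \<longlongrightarrow> 2 * B / cc * 0) sequentially"
      using \<zeta>\<delta> by (intro tendsto_mult tendsto_const lim) simp
    then have "\<forall>\<^sub>F n in sequentially. 2 * B / cc * real n powr (- (\<delta> - 3 * \<zeta>)) < 1"
      by (rule order_tendstoD) simp
    then show "\<forall>\<^sub>F n in sequentially. 2 * B / cc * real n powr (- (\<delta> - 3 * \<zeta>)) \<le> 1"
      by eventually_elim simp
    have "filterlim (\<lambda>n. log \<mu> (real n)) at_top sequentially"
    proof -
      have "filterlim (\<lambda>n. 1 / ln \<mu> * ln (real n)) at_top sequentially"
        using fm by (intro filterlim_tendsto_pos_mult_at_top[OF tendsto_const]
            filterlim_compose[OF ln_at_top filterlim_real_sequentially]) simp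
      then show ?thesis by (simp add: log_def)
    qed
    then show "\<forall>\<^sub>F n in sequentially. 1 / (2 * \<zeta>) \<le> log \<mu> (real n)"
      by (simp add: filterlim_at_top)
  qed
  then obtain n0 where n0: "\<And>n. n0 \<le> n \<Longrightarrow> 2 \<le> real n \<and> real n powr (- \<epsilon>) \<le> cc
      \<and> 2 * B / cc * real n powr (- (\<delta> - 3 * \<zeta>)) \<le> 1 \<and> 1 / (2 * \<zeta>) \<le> log \<mu> (real n)"
    unfolding eventually_sequentially by blast
  \<comment> \<open>The term \<open>n0 powr a\<close> makes the bound trivial for
    \<open>n < n0\<close>.\<close>
  define K' where "K' = max (B * (\<nu> + 2 * C3) + B1 * \<rho> powr (-2)) (max 1 (real n0 powr a))"
  have "0 < K'" by (simp add: K'_def)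
  moreover have "1 - K' * real n powr (- a)
      \<le> measure label_space {X \<in> space label_space. coupled_upto g f d (X \<circ> Inl) (X \<circ> Inr) \<gamma> k}"
    if n: "1 \<le> n" and d: "bidegree_seq n d"
      and gc: "cdf_dist (g_emp d) (pmf g) \<le> ennreal (real n powr (- \<epsilon>))"
      and fc: "cdf_dist (f_emp d) (pmf f) \<le> ennreal (real n powr (- \<epsilon>))"
      and mom: "(\<Sum>r<n. real (indeg d r) powr \<kappa> * real (outdeg d r) * real (indeg d r)) \<le> K0 * real n"
      and k: "real k \<le> (1 - \<delta>) * log \<mu> (real n)"
    for n d k
  proof (cases "n0 \<le> n")
    case False
    have "1 = real n powr a * real n powr (- a)" using n by (simp add: powr_add[symmetric])
    also have "\<dots> \<le> real n0 powr a * real n powr (- a)"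
      using False n a0 by (intro mult_right_mono powr_mono2) auto
    also have "\<dots> \<le> K' * real n powr (- a)"
      by (intro mult_right_mono) (auto simp: K'_def)
    finally have "1 - K' * real n powr (- a) \<le> 0" by simp
    then show ?thesis by (rule order_trans) simp
  next
    case True
    let ?N = "real n" and ?L = "real (stub_count d)"
    have big: "2 \<le> ?N" "?N powr (- \<epsilon>) \<le> cc" "2 * B / cc * ?N powr (- (\<delta> - 3 * \<zeta>)) \<le> 1" "1 / (2 * \<zeta>) \<le> log \<mu> ?N"
      using n0[OF True] by auto
    have len: "length d = n" using d by (simp add: bidegree_seq_def)
    have L: "cc * ?N \<le> ?L"
      unfolding cc_def using big(2) by (intro stub_count_ge[OF d n gc]) (auto simp: cc_def)
    have l0: "0 \<le> log \<mu> ?N" using n fm by simp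
    have kl: "real k \<le> log \<mu> ?N"
    proof -
      have "(1 - \<delta>) * log \<mu> ?N \<le> 1 * log \<mu> ?N" using \<delta> l0 by (intro mult_right_mono) auto
      then show ?thesis using k by linarith
    qed
    have kB: "real k \<le> B * ?N powr \<zeta>" "real k \<le> B1 * ?N powr a1"
      using kl log_le_powr[OF fm(2) _ \<zeta>(1), of ?N] log_le_powr[OF fm(2) _ a1, of ?N] n
      unfolding B_def B1_def by auto
    define \<tau> where "\<tau> = (\<lambda>m. \<mu> ^ m * ?N powr (2 * \<zeta>))"
    have \<tau>_mono: "\<tau> m \<le> \<tau> m'" if "m \<le> m'" for m m'
      unfolding \<tau>_def using that fm by (intro mult_right_mono power_increasing) auto
    have \<tau>_small: "real m * \<tau> m \<le> ?L / 2" if m: "m \<le> k" for m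
    proof -
      have "real m \<le> (1 - \<delta>) * log \<mu> ?N" using m k by linarith
      then have "\<mu> powr real m \<le> \<mu> powr ((1 - \<delta>) * log \<mu> ?N)" using fm by (intro powr_mono) auto
      also have "\<dots> = ?N powr (1 - \<delta>)"
        using fm n by (simp add: mult.commute[of "1 - \<delta>"] powr_powr[symmetric])
      finally have "\<mu> ^ m \<le> ?N powr (1 - \<delta>)" using fm by (simp add: powr_realpow)
      then have "\<tau> m \<le> 1 * ?N powr ((1 - \<delta>) + 2 * \<zeta>)"
        unfolding \<tau>_def powr_add by (simp add: mult_right_mono)
      moreover have "real m \<le> B * ?N powr \<zeta>" using m kB(1) by linarith
      moreover have "0 \<le> \<tau> m" unfolding \<tau>_def using fm by simp
      ultimately have "real m * \<tau> m \<le> B * 1 * ?N powr (\<zeta> + ((1 - \<delta>) + 2 * \<zeta>))"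
        by (intro powr_mult_le B0)
      also have "\<zeta> + ((1 - \<delta>) + 2 * \<zeta>) = 1 + - (\<delta> - 3 * \<zeta>)" by simp
      also have "B * 1 * ?N powr \<dots> = (2 * B / cc * ?N powr (- (\<delta> - 3 * \<zeta>))) * (cc * ?N / 2)"
        unfolding powr_add using cc n by (simp add: field_simps)
      also have "\<dots> \<le> 1 * (cc * ?N / 2)"
        using big(3) cc by (intro mult_right_mono) auto
      finally show ?thesis using L by linarith
    qed
    have L0: "0 < ?L" using L cc n by (meson less_le_trans mult_pos_pos of_nat_0_less_iff zero_less_one)
    interpret E: exploration_bounds d g f \<tau> "?N powr (- \<epsilon>)" \<kappa> "K * ?N" \<nu> \<mu> k
    proof
      show "d \<noteq> []" using len n by auto
      show "0 < stub_count d" using L0 by simp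
      show "0 \<le> \<tau> m" for m unfolding \<tau>_def using fm by simp
      have "K0 * ?N \<le> K * ?N" by (intro mult_right_mono) (auto simp: K_def)
      then show "(\<Sum>r<length d. real (indeg d r) powr \<kappa> * real (outdeg d r) * real (indeg d r)) \<le> K * ?N"
        using mom unfolding len by linarith
    qed (use gc fc gm fm params \<tau>_mono \<tau>_small in auto)
    have "1 - (B * (\<nu> + 2 * C3) * E.n powr (- \<zeta>) + B1 * \<rho> powr (-2) * E.n powr (- a1))
      \<le> measure label_space {X \<in> space label_space. coupled_upto g f d (X \<circ> Inl) (X \<circ> Inr) \<gamma> k}"
      unfolding C3_def
    proof (rule E.coupled_rate[where \<omega>=\<omega> and \<delta>=\<delta> and \<theta>=\<theta>])
      show "2 \<le> E.n" "\<tau> = (\<lambda>m. \<mu> ^ m * E.n powr (2 * \<zeta>))" "K * ?N = K * E.n" "cc * E.n \<le> E.L"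
        "real k \<le> (1 - \<delta>) * log \<mu> E.n" "real k \<le> B * E.n powr \<zeta>" "real k \<le> B1 * E.n powr a1"
        using big L k kB by (simp_all add: len \<tau>_def)
      show "?N powr (- \<epsilon>) \<le> E.n powr (- \<omega>)"
        unfolding len using n \<omega> by (intro powr_mono) auto
      have "1 / (2 * \<zeta>) * (2 * \<zeta>) \<le> log \<mu> ?N * (2 * \<zeta>)" using big(4) \<zeta> by (intro mult_right_mono) auto
      then show "1 \<le> 2 * \<zeta> * log \<mu> E.n" unfolding len using \<zeta> by (simp add: mult_ac)
      show "2 * a1 = - (2 * \<zeta> * log \<mu> \<rho>)" by (simp add: a1_def)
    qed (use cc \<zeta> \<gamma> \<delta> \<omega> B0 \<rho> slow in \<open>auto simp: K_def \<theta>_def\<close>)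
    moreover have "B * (\<nu> + 2 * C3) * ?N powr (- \<zeta>) + B1 * \<rho> powr (-2) * ?N powr (- a1) \<le> K' * ?N powr (- a)"
    proof -
      have C30: "0 \<le> C3" unfolding C3_def using B0 cc by (intro add_nonneg_nonneg mult_nonneg_nonneg divide_nonneg_nonneg) (auto simp: K_def)
      have "B * (\<nu> + 2 * C3) * ?N powr (- \<zeta>) \<le> B * (\<nu> + 2 * C3) * ?N powr (- a)"
        using B0 gm C30 n by (intro mult_left_mono powr_mono mult_nonneg_nonneg) (auto simp: a_def)
      moreover have "B1 * \<rho> powr (-2) * ?N powr (- a1) \<le> B1 * \<rho> powr (-2) * ?N powr (- a)"
        using B0 n by (intro mult_left_mono powr_mono mult_nonneg_nonneg) (auto simp: a_def)
      moreover have "(B * (\<nu> + 2 * C3) + B1 * \<rho> powr (-2)) * ?N powr (- a) \<le> K' * ?N powr (- a)"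
        by (intro mult_right_mono) (auto simp: K'_def)
      ultimately show ?thesis unfolding distrib_right by linarith
    qed
    ultimately show ?thesis unfolding len by linarith
  qed
  ultimately show ?thesis using a0 by blast
qed

section \<open>Conditioning on the bi-degree sequence\<close>

text \<open>Both processes read the variables at \<open>labels\<close> only, which is where
  \<open>coupling_space\<close> fixes their law.\<close>

lemma coupled_upto_cong:
  assumes "\<And>i. i \<in> labels \<Longrightarrow> u i = u' i \<and> w i = w' i"
  shows "coupled_upto g f d u w \<gamma> k = coupled_upto g f d u' w' \<gamma> k"
proof -
  have "A_set d u w m = A_set d u' w' m" for m using assms by (intro A_set_cong) auto
  moreover have "A_hat g f u m = A_hat g f u' m" for m using assms by (intro A_hat_cong) auto
  ultimately show ?thesis by (simp add: coupled_upto_def Z_hat_def)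
qed

text \<open>The family of all \<open>U\<close> and \<open>W\<close> is independent of
  \<open>D\<close> and has law \<open>label_space\<close>, so conditioning on \<open>D = d\<close>
  merely freezes the sequence. The map \<open>h\<close> stands for the identity or for
  \<open>flip_dir\<close>.\<close>

lemma (in coupling_space) cond_prob_coupled_upto:
  assumes pos: "0 < measure M {\<omega> \<in> space M. D \<omega> = d}"
  shows "\<P>(\<omega> in M. coupled_upto g f (h (D \<omega>)) (\<lambda>i. U i \<omega>) (\<lambda>i. W i \<omega>) \<gamma> k \<bar> D \<omega> = d)
    = measure label_space {X \<in> space label_space. coupled_upto g f (h d) (X \<circ> Inl) (X \<circ> Inr) \<gamma> k}"
proof -
  let ?I = "labels <+> labels" and ?X = "case_sum U W"
  define V where "V = (\<lambda>\<omega>. \<lambda>x\<in>?I. ?X x \<omega>)"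
  define E where "E = {X \<in> space label_space. coupled_upto g f (h d) (X \<circ> Inl) (X \<circ> Inr) \<gamma> k}"
  let ?B = "Pi\<^sub>M ?I (\<lambda>_. borel) :: (label + label \<Rightarrow> real) measure"
  have rv: "?X x \<in> borel_measurable M" if "x \<in> ?I" for x
    using UW_indep that unfolding indep_vars_def by auto
  have sets_eq: "sets label_space = sets ?B"
    unfolding label_space_def by (rule sets_PiM_cong) (simp_all add: sets_unif)
  have E: "E \<in> sets ?B" unfolding E_def using sets_coupled_upto sets_eq by blast
  have V: "V \<in> M \<rightarrow>\<^sub>M ?B"
    unfolding V_def by (rule measurable_restrict[OF rv])
  have "[] \<in> labels" by (simp add: labels_def)
  then have "?I \<noteq> {}" by blast
  then have "distr M ?B V = Pi\<^sub>M ?I (\<lambda>x. distr M borel (?X x))"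
    unfolding V_def using indep_vars_iff_distr_eq_PiM'[of ?I ?X "\<lambda>_. borel"] rv UW_indep by blast
  also have "\<dots> = label_space"
    unfolding label_space_def unif_def by (rule PiM_cong[OF refl UW_uniform])
  finally have distr: "distr M ?B V = label_space" .
  have space_V: "V \<omega> \<in> space label_space" for \<omega>
    by (auto simp: V_def space_label_space)
  let ?D = "D -` {d} \<inter> space M" and ?V = "V -` E \<inter> space M"
  have "{\<omega> \<in> space M. coupled_upto g f (h (D \<omega>)) (\<lambda>i. U i \<omega>) (\<lambda>i. W i \<omega>) \<gamma> k \<and> D \<omega> = d} = ?D \<inter> ?V"
  proof -
    \<comment> \<open>Outside the labels \<open>V\<close> takes the value \<open>undefined\<close>,
      which \<open>coupled_upto_cong\<close> disregards.\<close>
    have "coupled_upto g f (h d) (V \<omega> \<circ> Inl) (V \<omega> \<circ> Inr) \<gamma> k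
        = coupled_upto g f (h d) (\<lambda>i. U i \<omega>) (\<lambda>i. W i \<omega>) \<gamma> k" for \<omega>
      by (rule coupled_upto_cong) (auto simp: V_def)
    then show ?thesis using space_V by (auto simp: E_def)
  qed
  moreover have "prob (?D \<inter> ?V) = prob ?D * prob ?V"
  proof (rule indep_setD[OF D_indep])
    show "?D \<in> sets (vimage_algebra (space M) D (count_space UNIV))"
      by (rule in_vimage_algebra) simp
    show "?V \<in> sets (vimage_algebra (space M) (\<lambda>\<omega>. \<lambda>x\<in>?I. ?X x \<omega>) ?B)"
      unfolding V_def by (rule in_vimage_algebra[OF E])
  qed
  moreover have "prob ?V = measure label_space E"
    using measure_distr[OF V E] by (simp add: distr)
  moreover have "{\<omega> \<in> space M. D \<omega> = d} = ?D" by auto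
  ultimately show ?thesis
    using pos unfolding cond_prob_def E_def by simp
qed

section \<open>The coupling theorem\<close>

lemma flip_dir_simps:
  "length (flip_dir d) = length d"
  "r < length d \<Longrightarrow> indeg (flip_dir d) r = outdeg d r"
  "r < length d \<Longrightarrow> outdeg (flip_dir d) r = indeg d r"
  by (simp_all add: flip_dir_def indeg_def outdeg_def)

lemma bidegree_seq_flip: "bidegree_seq n d \<Longrightarrow> bidegree_seq n (flip_dir d)"
  by (auto simp: bidegree_seq_def flip_dir_simps)

text \<open>The hypothesis bounds the sum of the two one-sided moments, and both are
  nonnegative.\<close>

lemma moment_bounds:
  fixes \<kappa> K :: real
  assumes "length d = n"
    and "(\<Sum>r<n. (real (indeg d r) powr \<kappa> + real (outdeg d r) powr \<kappa>)
            * real (outdeg d r) * real (indeg d r)) \<le> K * real n"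
  shows "(\<Sum>r<n. real (indeg d r) powr \<kappa> * real (outdeg d r) * real (indeg d r)) \<le> K * real n"
    and "(\<Sum>r<n. real (indeg (flip_dir d) r) powr \<kappa> * real (outdeg (flip_dir d) r)
            * real (indeg (flip_dir d) r)) \<le> K * real n"
proof -
  let ?a = "\<Sum>r<n. real (indeg d r) powr \<kappa> * real (outdeg d r) * real (indeg d r)"
  let ?b = "\<Sum>r<n. real (indeg (flip_dir d) r) powr \<kappa> * real (outdeg (flip_dir d) r) * real (indeg (flip_dir d) r)"
  have "?b = (\<Sum>r<n. real (outdeg d r) powr \<kappa> * real (indeg d r) * real (outdeg d r))"
    using assms(1) by (intro sum.cong) (auto simp: flip_dir_simps)
  then have "?a + ?b \<le> K * real n"
    using assms(2) by (simp add: sum.distrib[symmetric] algebra_simps)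
  moreover have "0 \<le> ?a" "0 \<le> ?b" by (auto intro: sum_nonneg)
  ultimately show "?a \<le> K * real n" "?b \<le> K * real n" by linarith+
qed

text \<open>Bi-degree sequences form a countable type, so conditioning on the sequence is elementary
  conditioning on the values \<open>d\<close> of positive probability.\<close>

theorem theorem4p1:
  fixes gp gm fp fm :: "nat pmf"
    and \<nu> \<mu> \<epsilon> \<kappa> K\<^sub>\<kappa> \<delta> \<gamma> :: real
    and M :: "nat \<Rightarrow> 'w measure"
    and D :: "nat \<Rightarrow> 'w \<Rightarrow> bidegree"
    and U W :: "nat \<Rightarrow> label \<Rightarrow> 'w \<Rightarrow> real"
  assumes g_mean: "has_bochner_integral (measure_pmf gp) real \<nu>"
      "has_bochner_integral (measure_pmf gm) real \<nu>" "0 < \<nu>"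
    and f_mean: "has_bochner_integral (measure_pmf fp) real \<mu>"
      "has_bochner_integral (measure_pmf fm) real \<mu>" "1 < \<mu>"
    and params: "0 < \<epsilon>" "0 < \<kappa>" "\<kappa> \<le> 1"
    and coupling: "\<And>n. 1 \<le> n \<Longrightarrow> coupling_space (M n) n (D n) (U n) (W n)"
    and \<delta>: "0 < \<delta>" "\<delta> < 1"
    and \<gamma>: "0 < \<gamma>" "\<gamma> < min (\<delta> * \<kappa>) \<epsilon>"
  shows "\<exists>K>0. \<exists>a>0. \<forall>n\<ge>1. \<forall>d.
    measure (M n) {\<omega> \<in> space (M n). D n \<omega> = d} > 0 \<longrightarrow>
    regular_bidegree gp gm fp fm \<epsilon> \<kappa> K\<^sub>\<kappa> n d \<longrightarrow>
    (\<forall>k\<ge>1. real k \<le> (1 - \<delta>) * log \<mu> (real n) \<longrightarrow>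
      \<P>(\<omega> in M n. coupled_upto gp fp (D n \<omega>) (\<lambda>i. U n i \<omega>) (\<lambda>i. W n i \<omega>) \<gamma> k \<bar> D n \<omega> = d)
        \<ge> 1 - K * real n powr (- a) \<and>
      \<P>(\<omega> in M n. coupled_upto gm fm (flip_dir (D n \<omega>)) (\<lambda>i. U n i \<omega>) (\<lambda>i. W n i \<omega>) \<gamma> k \<bar> D n \<omega> = d)
        \<ge> 1 - K * real n powr (- a))"
proof -
  have mean: "(\<integral>\<^sup>+x. ennreal (real x) \<partial>measure_pmf p) = ennreal c"
    if "has_bochner_integral (measure_pmf p) real c" for p :: "nat pmf" and c
    using that by (subst nn_integral_eq_integral) (auto simp: has_bochner_integral_iff)
  obtain K1 a1 where 1: "K1 > 0" "a1 > 0"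
    and P: "\<And>n d k. 1 \<le> n \<Longrightarrow> bidegree_seq n d \<Longrightarrow>
      cdf_dist (g_emp d) (pmf gp) \<le> ennreal (real n powr (- \<epsilon>)) \<Longrightarrow>
      cdf_dist (f_emp d) (pmf fp) \<le> ennreal (real n powr (- \<epsilon>)) \<Longrightarrow>
      (\<Sum>r<n. real (indeg d r) powr \<kappa> * real (outdeg d r) * real (indeg d r)) \<le> K\<^sub>\<kappa> * real n \<Longrightarrow>
      real k \<le> (1 - \<delta>) * log \<mu> (real n) \<Longrightarrow>
      1 - K1 * real n powr (- a1)
        \<le> measure label_space {X \<in> space label_space. coupled_upto gp fp d (X \<circ> Inl) (X \<circ> Inr) \<gamma> k}"
    using coupling_asymptotics[OF mean[OF g_mean(1)] g_mean(3) mean[OF f_mean(1)] f_mean(3) params \<delta> \<gamma>, of K\<^sub>\<kappa>]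
    by blast
  obtain K2 a2 where 2: "K2 > 0" "a2 > 0"
    and Q: "\<And>n d k. 1 \<le> n \<Longrightarrow> bidegree_seq n d \<Longrightarrow>
      cdf_dist (g_emp d) (pmf gm) \<le> ennreal (real n powr (- \<epsilon>)) \<Longrightarrow>
      cdf_dist (f_emp d) (pmf fm) \<le> ennreal (real n powr (- \<epsilon>)) \<Longrightarrow>
      (\<Sum>r<n. real (indeg d r) powr \<kappa> * real (outdeg d r) * real (indeg d r)) \<le> K\<^sub>\<kappa> * real n \<Longrightarrow>
      real k \<le> (1 - \<delta>) * log \<mu> (real n) \<Longrightarrow>
      1 - K2 * real n powr (- a2)
        \<le> measure label_space {X \<in> space label_space. coupled_upto gm fm d (X \<circ> Inl) (X \<circ> Inr) \<gamma> k}"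
    using coupling_asymptotics[OF mean[OF g_mean(2)] g_mean(3) mean[OF f_mean(2)] f_mean(3) params \<delta> \<gamma>, of K\<^sub>\<kappa>]
    by blast
  define K where "K = max K1 K2"
  define a where "a = min a1 a2"
  have K: "0 < K" and a: "0 < a" using 1 2 by (auto simp: K_def a_def)
  have rate: "K1 * real n powr (- a1) \<le> K * real n powr (- a)" "K2 * real n powr (- a2) \<le> K * real n powr (- a)"
    if "1 \<le> n" for n :: nat
    using that 1 2 by (auto simp: K_def a_def intro!: mult_mono powr_mono)
  show ?thesis
  proof (rule exI[of _ K], rule conjI[OF K], rule exI[of _ a], rule conjI[OF a], intro allI impI conjI)
    fix n :: nat and d :: bidegree and k :: nat
    assume n: "1 \<le> n" and pos: "0 < measure (M n) {\<omega> \<in> space (M n). D n \<omega> = d}"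
      and reg: "regular_bidegree gp gm fp fm \<epsilon> \<kappa> K\<^sub>\<kappa> n d"
      and "1 \<le> k" and k: "real k \<le> (1 - \<delta>) * log \<mu> (real n)"
    interpret C: coupling_space "M n" n "D n" "U n" "W n" by (rule coupling[OF n])
    have "{\<omega> \<in> space (M n). D n \<omega> = d} \<noteq> {}" using pos by (metis less_irrefl measure_empty)
    then have bd: "bidegree_seq n d" using C.D_bidegree by blast
    then have len: "length d = n" by (simp add: bidegree_seq_def)
    note reg' = reg[unfolded regular_bidegree_def]
    note mom = moment_bounds[OF len, of \<kappa> K\<^sub>\<kappa>]
    have "1 - K1 * real n powr (- a1)
        \<le> measure label_space {X \<in> space label_space. coupled_upto gp fp d (X \<circ> Inl) (X \<circ> Inr) \<gamma> k}"
      using reg' by (intro P[OF n bd _ _ mom(1) k]) auto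
    then show "1 - K * real n powr (- a)
        \<le> \<P>(\<omega> in M n. coupled_upto gp fp (D n \<omega>) (\<lambda>i. U n i \<omega>) (\<lambda>i. W n i \<omega>) \<gamma> k \<bar> D n \<omega> = d)"
      using C.cond_prob_coupled_upto[OF pos, of gp fp "\<lambda>d. d"] rate(1)[OF n] by simp
    have "1 - K2 * real n powr (- a2)
        \<le> measure label_space {X \<in> space label_space. coupled_upto gm fm (flip_dir d) (X \<circ> Inl) (X \<circ> Inr) \<gamma> k}"
      using reg' by (intro Q[OF n bidegree_seq_flip[OF bd] _ _ mom(2) k]) auto
    then show "1 - K * real n powr (- a)
        \<le> \<P>(\<omega> in M n. coupled_upto gm fm (flip_dir (D n \<omega>)) (\<lambda>i. U n i \<omega>) (\<lambda>i. W n i \<omega>) \<gamma> k \<bar> D n \<omega> = d)"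
      using C.cond_prob_coupled_upto[OF pos, of gm fm flip_dir] rate(2)[OF n] by simp
  qed
qed

end
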